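(* Let $\mathcal M$ be an o-minimal structure in a language $\mathcal L$ with universe $M$, and $\mathcal N$ an expansion of $\mathcal M$ such that every open definable set is $\mathcal L$-definable and $\mathcal N$ admits a dimension function $\dim$ compatible with $\mathcal M$. Let $G=\langle G,\cdot,1\rangle$ be a strongly large definable group with $G\subseteq M^n$ and $\dim G=k$. Then there are - $\mathcal L$-definable sets $X\subseteq M^m$ and $Z\subseteq X^2$ with $\dim(X^2\setminus Z)<2k$, - a definable injective map $h:X\to G$ with $\dim(G\setminus h(X))<k$, and - an $\mathcal L$-definable map $F:X^2\to X$ such that $h(x)\cdot h(y)=h(F(x,y))$ for every $(x,y)\in Z$.
   Context: "Definable" means definable in $\mathcal N$ with parameters; "$\mathcal L$-definable" means definable in $\mathcal M$ with parameters. A dimension function compatible with $\mathcal M$ is a map $\dim$ from definable sets to $\{-\infty\}\cup\mathbb N$ such that for all definable $X,Y\subseteq M^n$, $a\in M$: (D1) $\dim\{a\}=0$, $\dim M=1$, $\dim X=-\infty$ iff $X=\emptyset$; (D2) $\dim(X\cup Y)=\max\{\dim X,\dim Y\}$; (D3) for a definable family $\{X_t\}_{t\in I}$ of pairwise disjoint sets: (a) each $\{t\in I:\dim X_t=d\}$ is definable; (b) if all $X_t$ have dimension $k$ then $\dim\bigcup_t X_t=\dim I+k$; (D4) definable bijections preserve $\dim$; (D5) on $\mathcal L$-definable sets $\dim$ is the o-minimal dimension; (D6) every definable $f:M^n\to M$ agrees with an $\mathcal L$-definable $F:M^n\to M$ outside a definable set of dimension $<n$. $cl$ denotes topological closure;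 a definable set $X$ is strongly large if $\dim X=\dim cl(X)$; a definable group is strongly large if its universe is. *)

theory Defs
  imports "HOL-Library.Extended_Real" "HOL-Algebra.Group"
begin

text \<open>Points of M^n are lists of length n over the universe type 'm.
  A "structure" on M (with parameters) is given by its collection of definable
  sets, as a predicate on sets of tuples (van den Dries' notion of a structure).\<close>

definition Mn :: "nat \<Rightarrow> 'm list set" where
  "Mn n = {x. length x = n}"

definition is_structure :: "('m::linorder list set \<Rightarrow> bool) \<Rightarrow> bool" where
  "is_structure D \<longleftrightarrow>
     (\<forall>X. D X \<longrightarrow> (\<exists>n. X \<subseteq> Mn n)) \<and>
     (\<forall>n. D (Mn n)) \<and>
     (\<forall>n X Y. D X \<and> D Y \<and> X \<subseteq> Mn n \<and> Y \<subseteq> Mn n \<longrightarrow> D (X \<union> Y) \<and> D (X - Y)) \<and>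
     (\<forall>X. D X \<longrightarrow> D {x @ [a] | x a. x \<in> X} \<and> D {[a] @ x | x a. x \<in> X}) \<and>
     (\<forall>n i j. i < n \<and> j < n \<longrightarrow> D {x \<in> Mn n. x ! i = x ! j}) \<and>
     (\<forall>n X. D X \<and> X \<subseteq> Mn (Suc n) \<longrightarrow> D (butlast ` X)) \<and>
     (\<forall>a. D {[a]}) \<and>
     D {[x, y] | x y. x < y}"

definition is_interval :: "'m::linorder set \<Rightarrow> bool" where
  "is_interval I \<longleftrightarrow> (\<exists>a b. I = {a<..<b}) \<or> (\<exists>a. I = {a<..}) \<or> (\<exists>b. I = {..<b}) \<or> I = UNIV"

definition o_minimal :: "('m::linorder list set \<Rightarrow> bool) \<Rightarrow> bool" where
  "o_minimal D \<longleftrightarrow> is_structure D \<and>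
     (\<forall>X. D X \<and> X \<subseteq> Mn 1 \<longrightarrow>
        (\<exists>P F. finite P \<and> finite F \<and> (\<forall>I\<in>F. is_interval I) \<and>
               X = (\<lambda>x. [x]) ` (P \<union> \<Union>F)))"

definition expansion :: "('m::linorder list set \<Rightarrow> bool) \<Rightarrow> ('m list set \<Rightarrow> bool) \<Rightarrow> bool" where
  "expansion DL DN \<longleftrightarrow> is_structure DN \<and> (\<forall>X. DL X \<longrightarrow> DN X)"

definition box :: "nat \<Rightarrow> 'm::linorder list \<Rightarrow> 'm list \<Rightarrow> 'm list set" where
  "box n a b = {y \<in> Mn n. \<forall>i<n. a ! i < y ! i \<and> y ! i < b ! i}"

definition open_n :: "nat \<Rightarrow> 'm::linorder list set \<Rightarrow> bool" where
  "open_n n U \<longleftrightarrow> U \<subseteq> Mn n \<and>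
     (\<forall>x\<in>U. \<exists>a b. length a = n \<and> length b = n \<and> x \<in> box n a b \<and> box n a b \<subseteq> U)"

definition cl :: "nat \<Rightarrow> 'm::linorder list set \<Rightarrow> 'm list set" where
  "cl n X = {x \<in> Mn n. \<forall>a b. length a = n \<and> length b = n \<and> x \<in> box n a b \<longrightarrow> box n a b \<inter> X \<noteq> {}}"

definition nonempty_interior :: "nat \<Rightarrow> 'm::linorder list set \<Rightarrow> bool" where
  "nonempty_interior n X \<longleftrightarrow> (\<exists>U. U \<noteq> {} \<and> open_n n U \<and> U \<subseteq> X)"

text \<open>o-minimal dimension: the largest d such that some coordinate projection
  of X onto M^d has nonempty interior; -\<infinity> for the empty set.\<close>

definition odim :: "'m::linorder list set \<Rightarrow> ereal" where
  "odim X = Sup {ereal (real (card s)) | s n. X \<subseteq> Mn n \<and> s \<subseteq> {..<n} \<and>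
                   nonempty_interior (card s) ((\<lambda>x. nths x s) ` X)}"

definition dimension_function ::
  "('m::linorder list set \<Rightarrow> bool) \<Rightarrow> ('m list set \<Rightarrow> bool) \<Rightarrow> ('m list set \<Rightarrow> ereal) \<Rightarrow> bool" where
  "dimension_function DL DN dimf \<longleftrightarrow>
   \<comment> \<open>values in {-\<infinity>} \<union> \<nat>\<close>
   (\<forall>X. DN X \<longrightarrow> dimf X = -\<infinity> \<or> (\<exists>d::nat. dimf X = ereal (real d))) \<and>
   \<comment> \<open>(D1)\<close>
   (\<forall>a. dimf {[a]} = 0) \<and> dimf (Mn 1) = 1 \<and>
   (\<forall>X. DN X \<longrightarrow> (dimf X = -\<infinity> \<longleftrightarrow> X = {})) \<and>
   \<comment> \<open>(D2)\<close>
   (\<forall>n X Y. DN X \<and> DN Y \<and> X \<subseteq> Mn n \<and> Y \<subseteq> Mn n \<longrightarrow> dimf (X \<union> Y) = max (dimf X) (dimf Y)) \<and>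
   \<comment> \<open>(D3): family X_t = {x. t @ x \<in> S}, t \<in> I\<close>
   (\<forall>p n S I. DN S \<and> S \<subseteq> Mn (p + n) \<and> DN I \<and> I \<subseteq> Mn p \<and>
      (\<forall>t\<in>I. \<forall>t'\<in>I. t \<noteq> t' \<longrightarrow> {x. t @ x \<in> S} \<inter> {x. t' @ x \<in> S} = {}) \<longrightarrow>
      (\<forall>d. DN {t \<in> I. dimf {x. t @ x \<in> S} = d}) \<and>
      (\<forall>k::nat. (\<forall>t\<in>I. dimf {x. t @ x \<in> S} = ereal (real k)) \<longrightarrow>
          dimf (\<Union>t\<in>I. {x. t @ x \<in> S}) = dimf I + ereal (real k))) \<and>
   \<comment> \<open>(D4)\<close>
   (\<forall>n m X Y f. DN X \<and> DN Y \<and> X \<subseteq> Mn n \<and> Y \<subseteq> Mn m \<and> bij_betw f X Y \<and>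
      DN {x @ f x | x. x \<in> X} \<longrightarrow> dimf X = dimf Y) \<and>
   \<comment> \<open>(D5)\<close>
   (\<forall>X. DL X \<longrightarrow> dimf X = odim X) \<and>
   \<comment> \<open>(D6)\<close>
   (\<forall>n (f :: 'm list \<Rightarrow> 'm). DN {x @ [f x] | x. x \<in> Mn n} \<longrightarrow>
      (\<exists>F E. DL {x @ [F x] | x. x \<in> Mn n} \<and> DN E \<and> E \<subseteq> Mn n \<and> dimf E < ereal (real n) \<and>
             (\<forall>x \<in> Mn n - E. f x = F x)))"

definition strongly_large :: "('m::linorder list set \<Rightarrow> ereal) \<Rightarrow> nat \<Rightarrow> 'm list set \<Rightarrow> bool" where
  "strongly_large dimf n X \<longleftrightarrow> dimf X = dimf (cl n X)"

definition definable_group :: "('m::linorder list set \<Rightarrow> bool) \<Rightarrow> nat \<Rightarrow> ('m list, 'b) monoid_scheme \<Rightarrow> bool" where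
  "definable_group DN n G \<longleftrightarrow> group G \<and> carrier G \<subseteq> Mn n \<and> DN (carrier G) \<and>
     DN {x @ y @ (x \<otimes>\<^bsub>G\<^esub> y) | x y. x \<in> carrier G \<and> y \<in> carrier G}"

definition sq :: "'m list set \<Rightarrow> 'm list set" where
  "sq X = {x @ y | x y. x \<in> X \<and> y \<in> X}"

end

theory Submission
  imports Defs
begin

text \<open>
  Call a set small if a definable set of dimension less than the expected one covers it. Small sets
  form an ideal, and additivity of dimension makes ``for almost all'' behave like a Fubini quantifier:
  an o-minimally definable subset of \<open>M\<^sup>p \<times> M\<^sup>q\<close> with full-dimensional fibres over a non-small base contains a box. Box arguments of this kind
  replace the monotonicity and cell decomposition theorems. The cardinality of a finite fibre is locally
  constant at generic parameters, and a definable locally constant function is bounded, which gives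
  uniform finiteness; ranking the finitely many points of a fibre then cuts the closure of \<open>G\<close>, up to a
  small set, into finitely many pieces on which a coordinate projection to \<open>M\<^sup>k\<close> is injective. Pulling (D6)
  back along these projections produces an o-minimally definable set \<open>X\<close> equal to \<open>G\<close> up to a
  small set, and o-minimally definable \<open>F\<close>, \<open>Q\<close>, \<open>R\<close> that agree with \<open>x y\<close>, \<open>x\<^sup>-\<^sup>1 y\<close>, \<open>x y\<^sup>-\<^sup>1\<close>
  almost everywhere; strong largeness is what bounds the dimension of the closure.

  Points of \<open>X\<close> outside \<open>G\<close> still have to be sent injectively into \<open>G\<close>. After removing from \<open>X\<close> a small
  o-minimally definable set, every remaining \<open>x\<close> satisfies \<open>F(F(x,y),z) = F(x,F(y,z))\<close> for almost all
  \<open>y, z\<close>. Hence \<open>F(x,\<cdot>)\<close> agrees almost everywhere with left translation by a unique \<open>h(x) \<in> G\<close>, and \<open>h\<close> is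
  the identity almost everywhere on \<open>G \<inter> X\<close>. Recovering \<open>x\<close> from \<open>R(F(x,y),y)\<close> shows that \<open>h\<close> is injective.
\<close>

section \<open>Definable sets, predicates and maps\<close>

lemma mem_Mn [simp]: "x \<in> Mn n \<longleftrightarrow> length x = n"
  by (simp add: Mn_def)

lemma snoc_split: "z \<in> Mn (Suc n) \<Longrightarrow> take n z @ [z ! n] = z"
  using take_Suc_conv_app_nth[of n z] by simp

lemma nth_past_end: "length xs \<le> i \<Longrightarrow> xs ! i = [] ! (i - length xs)"
  by (induction xs arbitrary: i) (auto simp: nth_Cons')

locale def_structure =
  fixes D :: "('m::{dense_linorder, no_top, no_bot}) list set \<Rightarrow> bool"
  assumes is_structure: "is_structure D"
begin

definition dset :: "nat \<Rightarrow> 'm list set \<Rightarrow> bool" where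
  "dset n X \<longleftrightarrow> D X \<and> X \<subseteq> Mn n"

definition dpred :: "nat \<Rightarrow> ('m list \<Rightarrow> bool) \<Rightarrow> bool" where
  "dpred n P \<longleftrightarrow> dset n {x \<in> Mn n. P x}"

definition dmap :: "nat \<Rightarrow> ('m list \<Rightarrow> 'm list) \<Rightarrow> bool" where
  "dmap n f \<longleftrightarrow> (\<exists>m. f ` Mn n \<subseteq> Mn m) \<and> D {x @ f x | x. x \<in> Mn n}"

abbreviation drel :: "nat \<Rightarrow> nat \<Rightarrow> ('m list \<Rightarrow> 'm list \<Rightarrow> bool) \<Rightarrow> bool" where
  "drel p n P \<equiv> dpred (p + n) (\<lambda>z. P (take p z) (drop p z))"

abbreviation dfam :: "nat \<Rightarrow> ('m list \<Rightarrow> 'm \<Rightarrow> bool) \<Rightarrow> bool" where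
  "dfam p P \<equiv> dpred (Suc p) (\<lambda>z. P (take p z) (z ! p))"

abbreviation dfun :: "nat \<Rightarrow> ('m list \<Rightarrow> 'm) \<Rightarrow> bool" where
  "dfun n f \<equiv> dmap n (\<lambda>x. [f x])"

lemma dset_Mn_subset: "dset n X \<Longrightarrow> X \<subseteq> Mn n"
  by (simp add: dset_def)

lemma dset_length: "dset n X \<Longrightarrow> x \<in> X \<Longrightarrow> length x = n"
  by (auto simp: dset_def)

lemma D_imp_dset: "D X \<Longrightarrow> \<exists>n. dset n X"
  using is_structure by (simp add: is_structure_def dset_def)

lemma dset_Mn: "dset n (Mn n)"
  using is_structure by (simp add: is_structure_def dset_def)

lemma dset_Un: "dset n X \<Longrightarrow> dset n Y \<Longrightarrow> dset n (X \<union> Y)"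
  and dset_Diff: "dset n X \<Longrightarrow> dset n Y \<Longrightarrow> dset n (X - Y)"
  using is_structure[unfolded is_structure_def, THEN conjunct2, THEN conjunct2, THEN conjunct1]
  by (auto simp: dset_def)

lemma dset_Cons:
  assumes "dset n X"
  shows "dset (Suc n) {a # x | a x. x \<in> X}"
proof -
  have "D {[a] @ x | x a. x \<in> X}"
    using is_structure assms unfolding is_structure_def dset_def by blast
  moreover have "{[a] @ x | x a. x \<in> X} = {a # x | a x. x \<in> X}"
    by auto
  ultimately show ?thesis
    using assms by (auto simp: dset_def)
qed

lemma dpred_nth_eq_nth: "i < n \<Longrightarrow> j < n \<Longrightarrow> dpred n (\<lambda>x. x ! i = x ! j)"
  using is_structure unfolding is_structure_def dpred_def dset_def by blast

lemma dset_butlast: "dset (Suc n) X \<Longrightarrow> dset n (butlast ` X)"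
  using is_structure unfolding is_structure_def by (fastforce simp: dset_def)

lemma dset_point: "dset 1 {[a]}"
  using is_structure unfolding is_structure_def by (auto simp: dset_def)

lemma dset_less: "dset 2 {[x, y] | x y. x < y}"
  using is_structure unfolding is_structure_def by (auto simp: dset_def)

lemma dpred_cong: "(\<And>x. x \<in> Mn n \<Longrightarrow> P x \<longleftrightarrow> Q x) \<Longrightarrow> dpred n P \<longleftrightarrow> dpred n Q"
  unfolding dpred_def by (rule arg_cong[where f = "dset n"]) blast

lemma dpred_congI: "dpred n Q \<Longrightarrow> (\<And>x. x \<in> Mn n \<Longrightarrow> P x \<longleftrightarrow> Q x) \<Longrightarrow> dpred n P"
  using dpred_cong by blast

lemma dpred_not:
  assumes "dpred n P"
  shows "dpred n (\<lambda>x. \<not> P x)"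
proof -
  have "{x \<in> Mn n. \<not> P x} = Mn n - {x \<in> Mn n. P x}"
    by blast
  then show ?thesis
    using dset_Diff[OF dset_Mn] assms by (simp only: dpred_def)
qed

lemma dpred_disj:
  assumes "dpred n P" "dpred n Q"
  shows "dpred n (\<lambda>x. P x \<or> Q x)"
proof -
  have "{x \<in> Mn n. P x \<or> Q x} = {x \<in> Mn n. P x} \<union> {x \<in> Mn n. Q x}"
    by blast
  then show ?thesis
    using dset_Un assms by (simp only: dpred_def)
qed

lemma dpred_conj: "dpred n P \<Longrightarrow> dpred n Q \<Longrightarrow> dpred n (\<lambda>x. P x \<and> Q x)"
  using dpred_not[OF dpred_disj[OF dpred_not dpred_not], of n P Q] by simp

lemma dpred_imp: "dpred n P \<Longrightarrow> dpred n Q \<Longrightarrow> dpred n (\<lambda>x. P x \<longrightarrow> Q x)"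
  unfolding imp_conv_disj by (intro dpred_disj dpred_not)

lemma dpred_iff: "dpred n P \<Longrightarrow> dpred n Q \<Longrightarrow> dpred n (\<lambda>x. P x \<longleftrightarrow> Q x)"
  unfolding iff_conv_conj_imp by (intro dpred_conj dpred_imp)

lemma dpred_const: "dpred n (\<lambda>x. c)"
proof -
  have "dpred n (\<lambda>x. True)"
    using dset_Mn[of n] by (simp add: dpred_def Mn_def)
  then show ?thesis
    using dpred_not[of n "\<lambda>x. True"] by (cases c) auto
qed

lemma dpred_ball_finite:
  "finite I \<Longrightarrow> (\<And>i. i \<in> I \<Longrightarrow> dpred n (P i)) \<Longrightarrow> dpred n (\<lambda>x. \<forall>i\<in>I. P i x)"
  by (induction I rule: finite_induct) (simp_all add: dpred_const dpred_conj)

lemma dpred_bex_finite: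
  "finite I \<Longrightarrow> (\<And>i. i \<in> I \<Longrightarrow> dpred n (P i)) \<Longrightarrow> dpred n (\<lambda>x. \<exists>i\<in>I. P i x)"
  using dpred_not[OF dpred_ball_finite, of I n "\<lambda>i x. \<not> P i x"] by (simp add: dpred_not)

lemma dpred_all_less:
  "(\<And>i::nat. i < m \<Longrightarrow> dpred n (P i)) \<Longrightarrow> dpred n (\<lambda>x. \<forall>i<m. P i x)"
  using dpred_ball_finite[of "{..<m}" n P] by (simp add: Ball_def)

lemma dpred_drop_mem: "dset n X \<Longrightarrow> dpred (m + n) (\<lambda>x. drop m x \<in> X)"
proof (induction m)
  case 0
  have "{x \<in> Mn n. x \<in> X} = X"
    using 0 by (auto simp: dset_def)
  then show ?case
    using 0 by (simp add: dpred_def)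
next
  case (Suc m)
  let ?S = "{x \<in> Mn (m + n). drop m x \<in> X}"
  have "{x \<in> Mn (Suc m + n). drop (Suc m) x \<in> X} = {a # x | a x. x \<in> ?S}"
    by (auto simp: length_Suc_conv)
  then show ?case
    using dset_Cons[of "m + n" ?S] Suc by (simp add: dpred_def)
qed

lemma dset_take: "dset (n + m) X \<Longrightarrow> dset n (take n ` X)"
proof (induction m arbitrary: X)
  case 0
  have "take n ` X = X"
    using 0 by (force simp: dset_def)
  then show ?case
    using 0 by simp
next
  case (Suc m)
  have "take n ` X = take n ` butlast ` X"
    unfolding image_image
    by (rule image_cong) (use Suc.prems in \<open>auto simp: dset_def butlast_conv_take min_def\<close>)
  then show ?case
    using Suc.IH[OF dset_butlast] Suc.prems by simp
qed

lemma dpred_ex: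
  assumes "drel n m P"
  shows "dpred n (\<lambda>x. \<exists>y\<in>Mn m. P x y)"
proof -
  have "{x \<in> Mn n. \<exists>y\<in>Mn m. P x y} = take n ` {z \<in> Mn (n + m). P (take n z) (drop n z)}"
    (is "?L = ?R")
  proof
    show "?L \<subseteq> ?R"
    proof
      fix x assume "x \<in> ?L"
      then obtain y where "x \<in> Mn n" "y \<in> Mn m" "P x y"
        by blast
      then show "x \<in> ?R"
        by (intro image_eqI[of _ _ "x @ y"]) auto
    qed
  qed (auto intro: bexI[of _ "drop n _"])
  then show ?thesis
    using dset_take assms by (simp add: dpred_def)
qed

lemma dpred_all: "drel n m P \<Longrightarrow> dpred n (\<lambda>x. \<forall>y\<in>Mn m. P x y)"
  using dpred_not[OF dpred_ex[OF dpred_not]] by fastforce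

lemma dpred_ex1:
  assumes "dfam n P"
  shows "dpred n (\<lambda>x. \<exists>v. P x v)"
proof -
  have "drel n 1 (\<lambda>x y. P x (hd y))"
    using assms unfolding Suc_eq_plus1 by (rule dpred_congI) (auto simp: hd_drop_conv_nth)
  from dpred_ex[OF this] show ?thesis
    by (rule dpred_congI) (force simp: length_Suc_conv Bex_def)
qed

lemma dpred_all1: "dfam n P \<Longrightarrow> dpred n (\<lambda>x. \<forall>v. P x v)"
  using dpred_not[OF dpred_ex1[OF dpred_not]] by fastforce

definition coord_map :: "nat \<Rightarrow> ('m list \<Rightarrow> 'm list) \<Rightarrow> bool" where
  "coord_map n f \<longleftrightarrow> (\<exists>idx. set idx \<subseteq> {..<n} \<and> (\<forall>x\<in>Mn n. f x = map ((!) x) idx))"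

lemma coord_map_id: "coord_map n (\<lambda>x. x)"
  unfolding coord_map_def by (rule exI[of _ "[0..<n]"]) (auto simp: map_nth)

lemma coord_map_nth: "i < n \<Longrightarrow> coord_map n (\<lambda>x. [x ! i])"
  unfolding coord_map_def by (rule exI[of _ "[i]"]) auto

lemma coord_map_append:
  assumes "coord_map n f" "coord_map n g"
  shows "coord_map n (\<lambda>x. f x @ g x)"
proof -
  obtain idx idx' where
    "set idx \<subseteq> {..<n}" "\<forall>x\<in>Mn n. f x = map ((!) x) idx"
    "set idx' \<subseteq> {..<n}" "\<forall>x\<in>Mn n. g x = map ((!) x) idx'"
    using assms by (auto simp: coord_map_def)
  then show ?thesis
    unfolding coord_map_def by (intro exI[of _ "idx @ idx'"]) auto
qed

lemma coord_map_select:
  assumes "coord_map n f"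
    and "\<And>idx. set (g idx) \<subseteq> set idx"
    and "\<And>x idx. g' (map ((!) x) idx) = map ((!) x) (g idx)"
  shows "coord_map n (\<lambda>x. g' (f x))"
proof -
  obtain idx where "set idx \<subseteq> {..<n}" "\<forall>x\<in>Mn n. f x = map ((!) x) idx"
    using assms(1) by (auto simp: coord_map_def)
  then show ?thesis
    unfolding coord_map_def using assms(2,3) by (intro exI[of _ "g idx"]) auto
qed

lemma coord_map_take: "coord_map n f \<Longrightarrow> coord_map n (\<lambda>x. take j (f x))"
  by (rule coord_map_select[where g = "take j"]) (auto simp: take_map dest: in_set_takeD)

lemma coord_map_drop: "coord_map n f \<Longrightarrow> coord_map n (\<lambda>x. drop j (f x))"
  by (rule coord_map_select[where g = "drop j"]) (auto simp: drop_map dest: in_set_dropD)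

lemma coord_map_nths: "coord_map n f \<Longrightarrow> coord_map n (\<lambda>x. nths (f x) s)"
  by (rule coord_map_select[where g = "\<lambda>idx. nths idx s"]) (auto simp: nths_map dest: in_set_nthsD)

lemmas coord_map_intros = coord_map_id coord_map_take coord_map_drop coord_map_append

lemma dpred_drop_eq_select:
  assumes "set idx \<subseteq> {..<n}"
  shows "dpred (n + length idx) (\<lambda>z. drop n z = map ((!) z) idx)"
proof -
  have "dpred (n + length idx) (\<lambda>z. \<forall>j<length idx. z ! (n + j) = z ! (idx ! j))"
  proof (intro dpred_all_less dpred_nth_eq_nth)
    fix j assume "j < length idx"
    then show "idx ! j < n + length idx"
      using assms nth_mem[of j idx] by fastforce
  qed simp
  then show ?thesis
    by (rule dpred_congI) (simp add: list_eq_iff_nth_eq[of "drop n _"])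
qed

lemma dpred_coord_map_mem:
  assumes "coord_map n f" "dset m X"
  shows "dpred n (\<lambda>x. f x \<in> X)"
proof -
  obtain idx where idx: "set idx \<subseteq> {..<n}" "\<And>x. x \<in> Mn n \<Longrightarrow> f x = map ((!) x) idx"
    using assms(1) by (auto simp: coord_map_def)
  show ?thesis
  proof (cases "m = length idx")
    case True
    have "dpred (n + m) (\<lambda>z. drop n z \<in> X \<and> drop n z = map ((!) z) idx)"
      unfolding True using assms(2) True idx(1)
      by (intro dpred_conj dpred_drop_mem dpred_drop_eq_select) auto
    moreover have "map ((!) (take n z)) idx = map ((!) z) idx" for z :: "'m list"
      using idx(1) by auto
    ultimately have "drel n m (\<lambda>x y. y \<in> X \<and> y = map ((!) x) idx)"
      by (simp only:)
    from dpred_ex[OF this] show ?thesis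
      by (rule dpred_congI) (use idx(2) True in auto)
  next
    case False
    then show ?thesis
      using assms(2) idx(2)
      by (intro dpred_congI[OF dpred_const[of n False]]) (auto dest: dset_length)
  qed
qed

lemma dmap_D: "dmap n f \<Longrightarrow> D {x @ f x | x. x \<in> Mn n}"
  by (simp add: dmap_def)

lemma dmap_length:
  assumes "dmap n f"
  obtains m where "\<And>x. x \<in> Mn n \<Longrightarrow> f x \<in> Mn m"
  using assms unfolding dmap_def by blast

lemma dmapI:
  assumes m: "\<And>x. x \<in> Mn n \<Longrightarrow> f x \<in> Mn m"
    and R: "drel n m R"
    and iff: "\<And>x y. x \<in> Mn n \<Longrightarrow> y \<in> Mn m \<Longrightarrow> R x y \<longleftrightarrow> y = f x"
  shows "dmap n f"
proof -
  have "{x @ f x | x. x \<in> Mn n} = {z \<in> Mn (n + m). R (take n z) (drop n z)}" (is "?L = ?R")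
  proof
    show "?L \<subseteq> ?R"
      using m iff by auto
    show "?R \<subseteq> ?L"
    proof
      fix z assume "z \<in> ?R"
      then have "take n z \<in> Mn n" "z = take n z @ f (take n z)"
        using iff[of "take n z" "drop n z"] append_take_drop_id[of n z] by auto
      then show "z \<in> ?L"
        by blast
    qed
  qed
  then show ?thesis
    using R m unfolding dmap_def dpred_def dset_def by auto
qed

lemma coord_map_dmap:
  assumes "coord_map n f"
  shows "dmap n f"
proof -
  obtain idx where idx: "set idx \<subseteq> {..<n}" "\<And>x. x \<in> Mn n \<Longrightarrow> f x = map ((!) x) idx"
    using assms by (auto simp: coord_map_def)
  show ?thesis
  proof (rule dmapI)
    show "drel n (length idx) (\<lambda>x y. y = map ((!) x) idx)"
      using dpred_drop_eq_select[OF idx(1)]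
      by (rule dpred_congI) (use idx(1) in \<open>auto simp: subset_iff cong: map_cong\<close>)
  qed (use idx(2) in auto)
qed

lemma dpred_coord_map_eq:
  assumes "dmap n f" "coord_map q a" "coord_map q b" "\<And>x. x \<in> Mn q \<Longrightarrow> a x \<in> Mn n"
  shows "dpred q (\<lambda>x. b x = f (a x))"
proof -
  obtain m where "dset m {x @ f x | x. x \<in> Mn n}"
    using D_imp_dset[OF dmap_D[OF assms(1)]] by blast
  from dpred_coord_map_mem[OF coord_map_append[OF assms(2,3)] this] show ?thesis
    by (rule dpred_congI) (use assms(4) in auto)
qed

lemma dpred_mem:
  assumes "dset m X" "dmap n f"
  shows "dpred n (\<lambda>x. f x \<in> X)"
proof -
  obtain m' where f: "\<And>x. x \<in> Mn n \<Longrightarrow> f x \<in> Mn m'"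
    using dmap_length[OF assms(2)] by blast
  have "dpred n (\<lambda>x. \<exists>y\<in>Mn m'. y = f x \<and> y \<in> X)"
    by (intro dpred_ex dpred_conj dpred_coord_map_eq[OF assms(2)]
        dpred_coord_map_mem[OF _ assms(1)] coord_map_intros) simp
  then show ?thesis
    by (rule dpred_congI) (use f in auto)
qed

lemma dpred_comp:
  assumes "dpred m P" "dmap n f" "\<And>x. x \<in> Mn n \<Longrightarrow> f x \<in> Mn m"
  shows "dpred n (\<lambda>x. P (f x))"
  using dpred_mem[OF assms(1)[unfolded dpred_def] assms(2)]
  by (rule dpred_congI) (use assms(3) in auto)

lemma dmap_append:
  assumes "dmap n f" "dmap n g"
  shows "dmap n (\<lambda>x. f x @ g x)"
proof -
  obtain m m' where m: "\<And>x. x \<in> Mn n \<Longrightarrow> f x \<in> Mn m" "\<And>x. x \<in> Mn n \<Longrightarrow> g x \<in> Mn m'"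
    using dmap_length assms by metis
  show ?thesis
  proof (rule dmapI)
    show "drel n (m + m') (\<lambda>x y. take m y = f x \<and> drop m y = g x)"
      by (intro dpred_conj dpred_coord_map_eq[OF assms(1)] dpred_coord_map_eq[OF assms(2)]
          coord_map_intros) simp_all
    fix x y :: "'m list" assume "x \<in> Mn n" "y \<in> Mn (m + m')"
    then show "take m y = f x \<and> drop m y = g x \<longleftrightarrow> y = f x @ g x"
      using m(1) by (metis append_eq_conv_conj mem_Mn)
  qed (use m in auto)
qed

lemma dmap_comp:
  assumes "dmap m g" "dmap n f" "\<And>x. x \<in> Mn n \<Longrightarrow> f x \<in> Mn m"
  shows "dmap n (\<lambda>x. g (f x))"
proof -
  obtain p where p: "\<And>x. x \<in> Mn m \<Longrightarrow> g x \<in> Mn p"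
    using dmap_length[OF assms(1)] by blast
  show ?thesis
  proof (rule dmapI)
    show "drel n p (\<lambda>x z. \<exists>y\<in>Mn m. y = f x \<and> z = g y)"
      by (intro dpred_ex dpred_conj dpred_coord_map_eq[OF assms(1)]
          dpred_coord_map_eq[OF assms(2)] coord_map_intros) simp_all
  qed (use assms(3) p in auto)
qed

lemma dmap_id: "dmap n (\<lambda>x. x)"
  by (intro coord_map_dmap coord_map_id)

lemma dmap_coord_map_comp:
  assumes "dmap n f" "\<And>m. coord_map m g"
  shows "dmap n (\<lambda>x. g (f x))"
  using dmap_length[OF assms(1)] dmap_comp[OF coord_map_dmap[OF assms(2)] assms(1)] by metis

lemma dmap_take: "dmap n f \<Longrightarrow> dmap n (\<lambda>x. take j (f x))"
  and dmap_drop: "dmap n f \<Longrightarrow> dmap n (\<lambda>x. drop j (f x))"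
  and dmap_nths: "dmap n f \<Longrightarrow> dmap n (\<lambda>x. nths (f x) s)"
  by (erule dmap_coord_map_comp, intro coord_map_intros coord_map_nths)+

lemma dset_singleton: "dset (length c) {c}"
proof -
  have "dpred (length c) (\<lambda>x. \<forall>i<length c. [x ! i] \<in> {[c ! i]})"
    by (intro dpred_all_less dpred_coord_map_mem[OF _ dset_point] coord_map_nth)
  moreover have "{x \<in> Mn (length c). \<forall>i<length c. [x ! i] \<in> {[c ! i]}} = {c}"
    by (auto simp: list_eq_iff_nth_eq)
  ultimately show ?thesis
    by (simp add: dpred_def)
qed

lemma dmap_const: "dmap n (\<lambda>x. c)"
proof (rule dmapI)
  show "drel n (length c) (\<lambda>x y. y \<in> {c})"
    by (intro dpred_coord_map_mem[OF _ dset_singleton] coord_map_intros)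
qed auto

lemma dmap_cong: "(\<And>x. x \<in> Mn n \<Longrightarrow> f x = g x) \<Longrightarrow> dmap n f \<longleftrightarrow> dmap n g"
proof -
  assume eq: "\<And>x. x \<in> Mn n \<Longrightarrow> f x = g x"
  then have "{x @ f x | x. x \<in> Mn n} = {x @ g x | x. x \<in> Mn n}" "f ` Mn n = g ` Mn n"
    by force+
  then show ?thesis
    by (simp add: dmap_def)
qed

(* For i beyond the length, x ! i is an unspecified value depending only on i and the length. *)
lemma dmap_nth:
  assumes "dmap n f"
  shows "dfun n (\<lambda>x. f x ! i)"
proof -
  obtain m where m: "\<And>x. x \<in> Mn n \<Longrightarrow> f x \<in> Mn m"
    using dmap_length[OF assms] by blast
  have "dfun m (\<lambda>x. x ! i)"
  proof (cases "i < m")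
    case True
    then show ?thesis
      by (intro coord_map_dmap coord_map_nth)
  next
    case False
    then have "x ! i = [] ! (i - m)" if "x \<in> Mn m" for x :: "'m list"
      using that nth_past_end[of x i] by simp
    then have "dfun m (\<lambda>x. x ! i) \<longleftrightarrow> dfun m (\<lambda>x. [] ! (i - m))"
      by (intro dmap_cong) (simp only:)
    then show ?thesis
      by (simp add: dmap_const)
  qed
  from dmap_comp[OF this assms m] show ?thesis .
qed

lemma dmap_Cons: "dfun n f \<Longrightarrow> dmap n g \<Longrightarrow> dmap n (\<lambda>x. f x # g x)"
  using dmap_append[of n "\<lambda>x. [f x]" g] by simp

lemmas dmap_intros = dmap_id dmap_take dmap_drop dmap_nths dmap_append dmap_nth dmap_const

lemma dpred_less: "dfun n f \<Longrightarrow> dfun n g \<Longrightarrow> dpred n (\<lambda>x. f x < g x)"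
  using dpred_mem[OF dset_less dmap_Cons, of n f "\<lambda>x. [g x]"] by simp

lemma dpred_le: "dfun n f \<Longrightarrow> dfun n g \<Longrightarrow> dpred n (\<lambda>x. f x \<le> g x)"
  using dpred_not[OF dpred_less, of n g f] by (simp add: not_less)

lemma dpred_eq_scalar: "dfun n f \<Longrightarrow> dfun n g \<Longrightarrow> dpred n (\<lambda>x. f x = g x)"
  using dpred_conj[OF dpred_le dpred_le, of n f g g f] by (simp add: eq_iff)

lemma dpred_eq:
  assumes "dmap n f" "dmap n g"
  shows "dpred n (\<lambda>x. f x = g x)"
proof -
  obtain m m' where m: "\<And>x. x \<in> Mn n \<Longrightarrow> f x \<in> Mn m" "\<And>x. x \<in> Mn n \<Longrightarrow> g x \<in> Mn m'"
    using dmap_length assms by metis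
  have "dpred n (\<lambda>x. m = m' \<and> (\<forall>i<m. f x ! i = g x ! i))"
    by (intro dpred_conj dpred_const dpred_all_less dpred_eq_scalar dmap_nth assms)
  then show ?thesis
    by (rule dpred_congI) (use m in \<open>auto simp: list_eq_iff_nth_eq\<close>)
qed

lemma dpred_mem_Mn: "dmap n f \<Longrightarrow> dpred n (\<lambda>x. f x \<in> Mn m)"
  by (intro dpred_mem[OF dset_Mn])

lemma dpred_mem_box:
  "dmap n f \<Longrightarrow> dmap n a \<Longrightarrow> dmap n b \<Longrightarrow> dpred n (\<lambda>x. f x \<in> box m (a x) (b x))"
  unfolding box_def mem_Collect_eq
  by (intro dpred_conj dpred_mem_Mn dpred_all_less dpred_less dmap_nth)

lemmas dpred_intros = dpred_conj dpred_disj dpred_not dpred_imp dpred_iff dpred_const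
  dpred_ex dpred_all dpred_ex1 dpred_all1 dpred_all_less
  dpred_less dpred_le dpred_eq dpred_eq_scalar dpred_mem_Mn dpred_mem_box dmap_intros

lemma drel_comp:
  assumes P: "drel p n P" and "dmap q f" "dmap q g"
    and f: "\<And>x. x \<in> Mn q \<Longrightarrow> f x \<in> Mn p" and "\<And>x. x \<in> Mn q \<Longrightarrow> g x \<in> Mn n"
  shows "dpred q (\<lambda>x. P (f x) (g x))"
proof (rule dpred_congI)
  show "dpred q (\<lambda>x. P (take p (f x @ g x)) (drop p (f x @ g x)))"
    by (rule dpred_comp[OF P]) (use assms in \<open>auto intro: dmap_append\<close>)
qed (use f in auto)

lemma dfam_comp:
  assumes P: "dfam p P" and "dmap q f" "dfun q g"
    and f: "\<And>x. x \<in> Mn q \<Longrightarrow> f x \<in> Mn p"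
  shows "dpred q (\<lambda>x. P (f x) (g x))"
proof (rule dpred_congI)
  show "dpred q (\<lambda>x. P (take p (f x @ [g x])) ((f x @ [g x]) ! p))"
    by (rule dpred_comp[OF P]) (use assms in \<open>auto intro: dmap_append\<close>)
qed (use f in \<open>auto simp: nth_append\<close>)

lemma dset_empty: "dset n {}"
  using dpred_const[of n False] by (simp add: dpred_def)

lemma dset_Collect:
  assumes "dset n X" "dpred n P"
  shows "dset n {x \<in> X. P x}"
proof -
  have "{x \<in> Mn n. x \<in> X \<and> P x} = {x \<in> X. P x}"
    using assms(1) by (auto simp: dset_def)
  then show ?thesis
    using dpred_conj[OF dpred_mem[OF assms(1) dmap_id] assms(2)] by (simp add: dpred_def)
qed

lemma dset_UN_finite: "finite I \<Longrightarrow> (\<And>i. i \<in> I \<Longrightarrow> dset n (X i)) \<Longrightarrow> dset n (\<Union>i\<in>I. X i)"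
  by (induction I rule: finite_induct) (simp_all add: dset_empty dset_Un)

lemma dset_box: "dset n (box n a b)"
proof -
  have "{x \<in> Mn n. x \<in> box n a b} = box n a b"
    by (auto simp: box_def)
  then show ?thesis
    using dpred_mem_box[OF dmap_id dmap_const dmap_const, of n n a b] by (simp add: dpred_def)
qed

lemma dset_image:
  assumes "dset n X" "dmap n f" "\<And>x. x \<in> X \<Longrightarrow> f x \<in> Mn m"
  shows "dset m (f ` X)"
proof -
  have "dpred m (\<lambda>y. \<exists>x\<in>Mn n. x \<in> X \<and> y = f x)"
    by (intro dpred_intros dpred_mem[OF assms(1)] dmap_comp[OF assms(2)]) simp
  moreover have "{y \<in> Mn m. \<exists>x\<in>Mn n. x \<in> X \<and> y = f x} = f ` X"
    using assms(3) dset_length[OF assms(1)] by auto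
  ultimately show ?thesis
    by (simp add: dpred_def)
qed

lemma dset_graph:
  assumes "dset n X" "dmap n f" "\<And>x. x \<in> X \<Longrightarrow> f x \<in> Mn m"
  shows "dset (n + m) {x @ f x | x. x \<in> X}"
  using dset_image[OF assms(1) dmap_append[OF dmap_id assms(2)], of "n + m"] assms(3)
    dset_length[OF assms(1)] by (simp add: setcompr_eq_image)

lemma dmap_if:
  assumes P: "dpred n P" and fg: "dmap n f" "dmap n g"
    and eq_length: "\<And>x. x \<in> Mn n \<Longrightarrow> length (f x) = length (g x)"
  shows "dmap n (\<lambda>x. if P x then f x else g x)"
proof -
  obtain m where m: "\<And>x. x \<in> Mn n \<Longrightarrow> f x \<in> Mn m"
    using dmap_length[OF fg(1)] by blast
  show ?thesis
  proof (rule dmapI)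
    show "drel n m (\<lambda>x y. P x \<and> y = f x \<or> \<not> P x \<and> y = g x)"
      by (intro dpred_intros dpred_comp[OF P] dmap_comp[OF fg(1)] dmap_comp[OF fg(2)]) simp_all
  qed (use m eq_length in auto)
qed

lemma definable_left_inverse:
  assumes W: "dset n W" and \<phi>: "dmap n \<phi>" "\<And>x. x \<in> Mn n \<Longrightarrow> \<phi> x \<in> Mn d" and inj: "inj_on \<phi> W"
  obtains \<psi> where "dmap d \<psi>" "\<And>y. y \<in> Mn d \<Longrightarrow> \<psi> y \<in> Mn n" "\<And>x. x \<in> W \<Longrightarrow> \<psi> (\<phi> x) = x"
proof
  define c where "c = replicate n (undefined :: 'm)"
  define \<psi> where "\<psi> y = (if y \<in> \<phi> ` W then inv_into W \<phi> y else c)" for y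
  have img: "dset d (\<phi> ` W)"
    using W \<phi> by (intro dset_image) (auto dest: dset_length)
  show left_inverse: "\<psi> (\<phi> x) = x" if "x \<in> W" for x
    using that inj by (simp add: \<psi>_def)
  show length_\<psi>: "\<psi> y \<in> Mn n" if "y \<in> Mn d" for y
    using dset_length[OF W] inj by (auto simp: \<psi>_def c_def)
  show "dmap d \<psi>"
  proof (rule dmapI)
    show "drel d n (\<lambda>y x. x \<in> W \<and> \<phi> x = y \<or> y \<notin> \<phi> ` W \<and> x = c)"
      by (intro dpred_intros dpred_mem[OF W] dpred_mem[OF img] dmap_comp[OF \<phi>(1)]) simp
    show "(x \<in> W \<and> \<phi> x = y \<or> y \<notin> \<phi> ` W \<and> x = c) \<longleftrightarrow> x = \<psi> y" for x y
    proof (cases "y \<in> \<phi> ` W")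
      case True
      then obtain w where "w \<in> W" "y = \<phi> w"
        by blast
      then show ?thesis
        using left_inverse[of w] inj_onD[OF inj, of x w] by auto
    qed (auto simp: \<psi>_def)
  qed (fact length_\<psi>)
qed

end

section \<open>Boxes and neighbourhoods\<close>

lemma box_subset_Mn: "box n a b \<subseteq> Mn n"
  by (auto simp: box_def)

lemma box_nonempty_iff:
  fixes a b :: "('m::dense_linorder) list"
  shows "box n a b \<noteq> {} \<longleftrightarrow> (\<forall>i<n. a ! i < b ! i)"
proof
  assume "\<forall>i<n. a ! i < b ! i"
  then have "\<forall>i. \<exists>c. i < n \<longrightarrow> a ! i < c \<and> c < b ! i"
    using dense by blast
  then obtain c where "\<forall>i<n. a ! i < c i \<and> c i < b ! i"
    by metis
  then have "map c [0..<n] \<in> box n a b"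
    by (auto simp: box_def)
  then show "box n a b \<noteq> {}"
    by blast
qed (auto simp: box_def intro: less_trans)

lemma box_Int:
  "box n a b \<inter> box n c d =
    box n (map (\<lambda>i. max (a ! i) (c ! i)) [0..<n]) (map (\<lambda>i. min (b ! i) (d ! i)) [0..<n])"
  by (auto simp: box_def)

lemma box_append:
  assumes "u \<in> Mn (p + n)" "v \<in> Mn (p + n)" "t \<in> Mn p"
  shows "t @ x \<in> box (p + n) u v \<longleftrightarrow>
    t \<in> box p (take p u) (take p v) \<and> x \<in> box n (drop p u) (drop p v)"
proof -
  have "(\<forall>i<p + n. Q i) \<longleftrightarrow> (\<forall>i<p. Q i) \<and> (\<forall>j<n. Q (p + j))" for Q
    by (auto, metis le_add_diff_inverse nat_add_left_cancel_less not_less)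
  then show ?thesis
    using assms by (auto simp: box_def nth_append)
qed

lemma box_1_image: "box (Suc 0) [c] [d] = (\<lambda>v. [v]) ` {c<..<d}"
  by (auto simp: box_def length_Suc_conv)

lemma nonempty_interior_iff:
  "nonempty_interior n X \<longleftrightarrow> (\<exists>a\<in>Mn n. \<exists>b\<in>Mn n. box n a b \<noteq> {} \<and> box n a b \<subseteq> X)"
proof
  assume "nonempty_interior n X"
  then obtain U x where "open_n n U" "U \<subseteq> X" "x \<in> U"
    by (auto simp: nonempty_interior_def)
  then obtain a b where "length a = n" "length b = n" "x \<in> box n a b" "box n a b \<subseteq> X"
    unfolding open_n_def by (meson subset_trans)
  then show "\<exists>a\<in>Mn n. \<exists>b\<in>Mn n. box n a b \<noteq> {} \<and> box n a b \<subseteq> X"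
    by (intro bexI[of _ a] bexI[of _ b]) auto
next
  assume "\<exists>a\<in>Mn n. \<exists>b\<in>Mn n. box n a b \<noteq> {} \<and> box n a b \<subseteq> X"
  moreover have "open_n n (box n a b)" if "a \<in> Mn n" "b \<in> Mn n" for a b :: "'a list"
    using that box_subset_Mn by (auto simp: open_n_def)
  ultimately show "nonempty_interior n X"
    unfolding nonempty_interior_def by blast
qed

lemma nonempty_interior_mono: "nonempty_interior n X \<Longrightarrow> X \<subseteq> Y \<Longrightarrow> nonempty_interior n Y"
  unfolding nonempty_interior_def by blast

(* The trivial filter bot unless t has length n. *)
definition nhd :: "nat \<Rightarrow> 'm::linorder list \<Rightarrow> 'm list filter" where
  "nhd n t = Abs_filter (\<lambda>P. t \<in> Mn n \<longrightarrow>
    (\<exists>a\<in>Mn n. \<exists>b\<in>Mn n. t \<in> box n a b \<and> (\<forall>u\<in>Mn n. u \<in> box n a b \<longrightarrow> P u)))"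

lemma box_around:
  fixes t :: "'m::{no_top, no_bot, linorder} list"
  assumes "t \<in> Mn n"
  obtains a b where "a \<in> Mn n" "b \<in> Mn n" "t \<in> box n a b"
proof -
  have "\<forall>i. \<exists>l. l < t ! i" "\<forall>i. \<exists>u. t ! i < u"
    using lt_ex gt_ex by blast+
  then obtain l u where "\<forall>i. l i < t ! i" "\<forall>i. t ! i < u i"
    by metis
  then have "t \<in> box n (map l [0..<n]) (map u [0..<n])"
    using assms by (auto simp: box_def)
  then show thesis
    using that[of "map l [0..<n]" "map u [0..<n]"] by simp
qed

lemma eventually_nhd:
  fixes t :: "'m::{no_top, no_bot, linorder} list"
  shows "eventually P (nhd n t) \<longleftrightarrow> (t \<in> Mn n \<longrightarrow>
    (\<exists>a\<in>Mn n. \<exists>b\<in>Mn n. t \<in> box n a b \<and> (\<forall>u\<in>Mn n. u \<in> box n a b \<longrightarrow> P u)))"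
    (is "_ \<longleftrightarrow> ?N P")
  unfolding nhd_def
proof (rule eventually_Abs_filter, unfold_locales)
  show "?N (\<lambda>_. True)"
    using box_around[of t n] by blast
  show "?N (\<lambda>u. P u \<and> Q u)" if P: "?N P" and Q: "?N Q" for P Q
  proof
    assume t: "t \<in> Mn n"
    obtain a b where ab: "t \<in> box n a b" "\<forall>u\<in>Mn n. u \<in> box n a b \<longrightarrow> P u"
      using P t by blast
    obtain c d where cd: "t \<in> box n c d" "\<forall>u\<in>Mn n. u \<in> box n c d \<longrightarrow> Q u"
      using Q t by blast
    let ?l = "map (\<lambda>i. max (a ! i) (c ! i)) [0..<n]" and ?u = "map (\<lambda>i. min (b ! i) (d ! i)) [0..<n]"
    have "t \<in> box n ?l ?u" "\<forall>u\<in>Mn n. u \<in> box n ?l ?u \<longrightarrow> P u \<and> Q u"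
      using ab cd unfolding box_Int[symmetric] by blast+
    then show "\<exists>a\<in>Mn n. \<exists>b\<in>Mn n. t \<in> box n a b \<and> (\<forall>u\<in>Mn n. u \<in> box n a b \<longrightarrow> P u \<and> Q u)"
      by (intro bexI[of _ ?l] bexI[of _ ?u]) auto
  qed
  show "?N Q" if "\<forall>u. P u \<longrightarrow> Q u" "?N P" for P Q
    using that by blast
qed

lemma eventually_nhd_self:
  fixes t :: "'m::{no_top, no_bot, linorder} list"
  shows "\<forall>\<^sub>F u in nhd n t. P u \<Longrightarrow> t \<in> Mn n \<Longrightarrow> P t"
  unfolding eventually_nhd by blast

lemma eventually_nhd_Mn:
  fixes t :: "'m::{no_top, no_bot, linorder} list"
  shows "\<forall>\<^sub>F u in nhd n t. u \<in> Mn n"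
  unfolding eventually_nhd using box_around[of t n] by blast

lemma eventually_nhd_box:
  fixes t :: "'m::{no_top, no_bot, linorder} list"
  shows "t \<in> box n a b \<Longrightarrow> a \<in> Mn n \<Longrightarrow> b \<in> Mn n \<Longrightarrow> \<forall>\<^sub>F u in nhd n t. u \<in> box n a b"
  unfolding eventually_nhd by blast

lemma eventually_nhd_snoc:
  fixes t :: "'m::{no_top, no_bot, linorder} list"
  assumes "\<forall>\<^sub>F z in nhd (Suc n) (t @ [v]). P z" "t \<in> Mn n"
  obtains c d where "c < v" "v < d" "\<forall>\<^sub>F u in nhd n t. \<forall>w\<in>{c<..<d}. P (u @ [w])"
proof -
  have "t @ [v] \<in> Mn (Suc n)"
    using assms(2) by simp
  then obtain a b where ab: "a \<in> Mn (Suc n)" "b \<in> Mn (Suc n)" "t @ [v] \<in> box (Suc n) a b"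
    "\<And>z. z \<in> box (Suc n) a b \<Longrightarrow> P z"
    using assms(1) box_subset_Mn[of "Suc n"] unfolding eventually_nhd by blast
  have snoc: "u @ [w] \<in> box (Suc n) a b \<longleftrightarrow>
      u \<in> box n (take n a) (take n b) \<and> a ! n < w \<and> w < b ! n" if "u \<in> Mn n" for u w
    using box_append[of a n 1 b u "[w]"] ab(1,2) that by (simp add: box_def)
  then have t: "t \<in> box n (take n a) (take n b)" "a ! n < v" "v < b ! n"
    using ab(3) assms(2) by auto
  then have "\<forall>\<^sub>F u in nhd n t. u \<in> box n (take n a) (take n b)"
    using ab(1,2) by (intro eventually_nhd_box) auto
  then have "\<forall>\<^sub>F u in nhd n t. \<forall>w\<in>{a ! n<..<b ! n}. P (u @ [w])"
    using eventually_nhd_Mn by eventually_elim (simp add: ab(4) snoc)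
  with t that show thesis
    by blast
qed

context def_structure
begin

lemma dpred_eventually_nhd:
  assumes P: "drel q n P" and f: "dmap q f"
  shows "dpred q (\<lambda>x. \<forall>\<^sub>F u in nhd n (f x). P x u)"
  unfolding eventually_nhd
  by (intro dpred_intros drel_comp[OF P] dmap_comp[OF f]) simp_all

abbreviation dpred_scalar :: "('m \<Rightarrow> bool) \<Rightarrow> bool" where
  "dpred_scalar P \<equiv> dpred 1 (\<lambda>z. P (z ! 0))"

lemma drel_section: "drel p n P \<Longrightarrow> t \<in> Mn p \<Longrightarrow> dpred n (P t)"
  by (rule drel_comp) (auto intro: dmap_intros)

lemma dset_section: "drel p n P \<Longrightarrow> t \<in> Mn p \<Longrightarrow> dset n {x \<in> Mn n. P t x}"
  using drel_section by (simp only: dpred_def)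

lemma dfam_section: "dfam p P \<Longrightarrow> t \<in> Mn p \<Longrightarrow> dpred_scalar (P t)"
  by (rule dfam_comp) (auto intro: dmap_intros)

end

section \<open>Definable subsets of the line\<close>

lemma finite_isolate:
  fixes b :: "'m::{no_top, no_bot, linorder}"
  assumes "finite B"
  obtains c d where "c < b" "b < d" "B \<inter> {c<..<d} \<subseteq> {b}"
proof -
  obtain l u where lu: "l < b" "b < u"
    using lt_ex gt_ex by blast
  define c where "c = Max (insert l {v \<in> B. v < b})"
  define d where "d = Min (insert u {v \<in> B. b < v})"
  have "c < b" "\<And>v. v \<in> B \<Longrightarrow> v < b \<Longrightarrow> v \<le> c"
    using assms lu by (auto simp: c_def)
  moreover have "b < d" "\<And>v. v \<in> B \<Longrightarrow> b < v \<Longrightarrow> d \<le> v"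
    using assms lu by (auto simp: d_def)
  ultimately show thesis
    using that by (metis IntE greaterThanLessThan_iff leD linorder_neqE singletonI subsetI)
qed

definition breakpoints :: "('m::linorder \<Rightarrow> bool) \<Rightarrow> 'm set \<Rightarrow> bool" where
  "breakpoints P E \<longleftrightarrow> (\<forall>x y. x \<le> y \<longrightarrow> E \<inter> {x..y} = {} \<longrightarrow> (P x \<longleftrightarrow> P y))"

lemma breakpointsD: "breakpoints P E \<Longrightarrow> x \<le> y \<Longrightarrow> E \<inter> {x..y} = {} \<Longrightarrow> P x \<longleftrightarrow> P y"
  unfolding breakpoints_def by blast

lemma breakpoints_mono: "breakpoints P E \<Longrightarrow> E \<subseteq> E' \<Longrightarrow> breakpoints P E'"
  unfolding breakpoints_def disjoint_iff by (meson subsetD)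

lemma is_interval_breakpoints:
  fixes I :: "'m::linorder set"
  assumes "is_interval I"
  shows "\<exists>E. finite E \<and> breakpoints (\<lambda>x. x \<in> I) E"
proof -
  consider (bounded) a b where "I = {a<..<b}" | (above) a where "I = {a<..}"
    | (below) b where "I = {..<b}" | (line) "I = UNIV"
    using assms by (auto simp: is_interval_def)
  then show ?thesis
  proof cases
    case (bounded a b)
    then show ?thesis
      by (intro exI[of _ "{a, b}"]) (auto simp: breakpoints_def)
  next
    case (above a)
    then show ?thesis
      by (intro exI[of _ "{a}"]) (auto simp: breakpoints_def)
  next
    case (below b)
    then show ?thesis
      by (intro exI[of _ "{b}"]) (auto simp: breakpoints_def)
  next
    case line
    then show ?thesis
      by (auto simp: breakpoints_def)
  qed
qed

definition bdry :: "('m::linorder \<Rightarrow> bool) \<Rightarrow> 'm \<Rightarrow> bool" where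
  "bdry P v \<longleftrightarrow> (\<forall>c d. c < v \<and> v < d \<longrightarrow> (\<exists>x. c < x \<and> x < d \<and> P x \<noteq> P v))"

lemma not_bdryE:
  assumes "\<not> bdry P v"
  obtains c d where "c < v" "v < d" "\<And>x. c < x \<Longrightarrow> x < d \<Longrightarrow> P x \<longleftrightarrow> P v"
  using assms unfolding bdry_def by blast

lemma bdry_in_breakpoints:
  fixes P :: "'m::{no_top, no_bot, linorder} \<Rightarrow> bool"
  assumes "finite E" and E: "breakpoints P E" and "bdry P v"
  shows "v \<in> E"
proof (rule ccontr)
  assume v: "v \<notin> E"
  obtain c d where cd: "c < v" "v < d" "E \<inter> {c<..<d} \<subseteq> {v}"
    using finite_isolate[OF \<open>finite E\<close>] by metis
  have "P x \<longleftrightarrow> P v" if "c < x" "x < d" for x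
  proof (cases "x \<le> v")
    case True
    have "E \<inter> {x..v} \<subseteq> E \<inter> {c<..<d}"
      using that cd by auto
    then show ?thesis
      using breakpointsD[OF E True] cd(3) v by blast
  next
    case False
    have "E \<inter> {v..x} \<subseteq> E \<inter> {c<..<d}"
      using that cd by auto
    then show ?thesis
      using breakpointsD[OF E, of v x] False cd(3) v by fastforce
  qed
  then show False
    using \<open>bdry P v\<close> cd unfolding bdry_def by blast
qed

lemma breakpoints_not_bdry:
  fixes P :: "'m::dense_linorder \<Rightarrow> bool"
  assumes E: "breakpoints P E" and "\<not> bdry P e"
  shows "x \<le> e \<Longrightarrow> E \<inter> {x..<e} = {} \<Longrightarrow> P x \<longleftrightarrow> P e"
    and "e \<le> y \<Longrightarrow> E \<inter> {e<..y} = {} \<Longrightarrow> P e \<longleftrightarrow> P y"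
proof -
  obtain c d where cd: "c < e" "e < d" "\<And>z. c < z \<Longrightarrow> z < d \<Longrightarrow> P z \<longleftrightarrow> P e"
    using not_bdryE[OF \<open>\<not> bdry P e\<close>] by metis
  show "P x \<longleftrightarrow> P e" if "x \<le> e" "E \<inter> {x..<e} = {}"
  proof (cases "x = e")
    case False
    then have "max c x < e"
      using cd(1) that(1) by auto
    then obtain m where m: "max c x < m" "m < e"
      using dense by blast
    have "E \<inter> {x..m} \<subseteq> E \<inter> {x..<e}"
      using m by auto
    then have "P x \<longleftrightarrow> P m"
      using breakpointsD[OF E, of x m] that(2) m by auto
    then show ?thesis
      using cd(2) cd(3)[of m] m by simp
  qed simp
  show "P e \<longleftrightarrow> P y" if "e \<le> y" "E \<inter> {e<..y} = {}"
  proof (cases "y = e")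
    case False
    then have "e < min d y"
      using cd(2) that(1) by auto
    then obtain m where m: "e < m" "m < min d y"
      using dense by blast
    have "E \<inter> {m..y} \<subseteq> E \<inter> {e<..y}"
      using m by auto
    then have "P m \<longleftrightarrow> P y"
      using breakpointsD[OF E, of m y] that(2) m by auto
    then show ?thesis
      using cd(1) cd(3)[of m] m by simp
  qed simp
qed

lemma breakpoints_remove:
  fixes P :: "'m::dense_linorder \<Rightarrow> bool"
  assumes E: "breakpoints P E" and e: "\<not> bdry P e"
  shows "breakpoints P (E - {e})"
  unfolding breakpoints_def
proof (intro allI impI)
  fix x y assume xy: "x \<le> y" "(E - {e}) \<inter> {x..y} = {}"
  show "P x \<longleftrightarrow> P y"
  proof (cases "e \<in> {x..y}")
    case True
    then have "E \<inter> {x..<e} \<subseteq> (E - {e}) \<inter> {x..y}" "E \<inter> {e<..y} \<subseteq> (E - {e}) \<inter> {x..y}"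
      by auto
    then have "E \<inter> {x..<e} = {}" "E \<inter> {e<..y} = {}"
      using xy(2) by blast+
    with True have "P x \<longleftrightarrow> P e" "P e \<longleftrightarrow> P y"
      by (simp_all only: breakpoints_not_bdry[OF E e] atLeastAtMost_iff)
    then show ?thesis
      by (rule trans)
  next
    case False
    then show ?thesis
      using breakpointsD[OF E xy(1)] xy(2) by blast
  qed
qed

lemma breakpoints_bdry:
  fixes P :: "'m::dense_linorder \<Rightarrow> bool"
  assumes "finite E" "breakpoints P E"
  shows "breakpoints P {v. bdry P v}"
proof -
  have remove: "breakpoints P (E - F)" if "finite F" "\<And>e. e \<in> F \<Longrightarrow> \<not> bdry P e" for F
    using that
  proof (induction F rule: finite_induct)
    case (insert e F)
    then have "breakpoints P (E - F - {e})"
      by (intro breakpoints_remove) simp_all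
    then show ?case
      by (subst Diff_insert)
  qed (simp add: assms)
  have "breakpoints P (E - {e \<in> E. \<not> bdry P e})"
    by (rule remove) (simp_all add: \<open>finite E\<close>)
  then show ?thesis
    by (rule breakpoints_mono) auto
qed

lemma (in def_structure) dfam_bdry:
  assumes "dfam p P"
  shows "dfam p (\<lambda>t. bdry (P t))"
  unfolding bdry_def by (intro dpred_intros dfam_comp[OF assms]) simp_all

locale o_minimal_structure =
  fixes D :: "('m::{dense_linorder, no_top, no_bot}) list set \<Rightarrow> bool"
  assumes o_minimal: "o_minimal D"
begin

sublocale def_structure D
  using o_minimal by unfold_locales (simp add: o_minimal_def)

lemma definable_breakpoints:
  assumes "dpred_scalar P"
  obtains E where "finite E" "breakpoints P E"
proof -
  obtain Q \<I> where decomp: "finite Q" "finite \<I>" "\<forall>I\<in>\<I>. is_interval I"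
    "{z \<in> Mn 1. P (z ! 0)} = (\<lambda>x. [x]) ` (Q \<union> \<Union>\<I>)"
    using o_minimal assms unfolding o_minimal_def dpred_def dset_def by meson
  have P_iff: "P v \<longleftrightarrow> v \<in> Q \<or> v \<in> \<Union>\<I>" for v
  proof -
    have "P v \<longleftrightarrow> [v] \<in> {z \<in> Mn 1. P (z ! 0)}"
      by simp
    then show ?thesis
      unfolding decomp(4) by blast
  qed
  obtain e where e: "\<And>I. I \<in> \<I> \<Longrightarrow> finite (e I)" "\<And>I. I \<in> \<I> \<Longrightarrow> breakpoints (\<lambda>x. x \<in> I) (e I)"
    using is_interval_breakpoints decomp(3) by metis
  show thesis
  proof
    show "finite (Q \<union> \<Union>(e ` \<I>))"
      using decomp e(1) by simp
    show "breakpoints P (Q \<union> \<Union>(e ` \<I>))"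
      unfolding breakpoints_def
    proof (intro allI impI)
      fix x y assume xy: "x \<le> y" "(Q \<union> \<Union>(e ` \<I>)) \<inter> {x..y} = {}"
      then have "x \<notin> Q" "y \<notin> Q"
        by auto
      moreover have "x \<in> I \<longleftrightarrow> y \<in> I" if "I \<in> \<I>" for I
        using breakpointsD[OF e(2)[OF that] xy(1)] xy(2) that by blast
      ultimately show "P x \<longleftrightarrow> P y"
        unfolding P_iff by blast
    qed
  qed
qed

lemma finite_bdry:
  assumes "dpred_scalar P"
  shows "finite {v. bdry P v}"
proof -
  obtain E where E: "finite E" "breakpoints P E"
    using definable_breakpoints[OF assms] by blast
  then have "{v. bdry P v} \<subseteq> E"
    using bdry_in_breakpoints by blast
  then show ?thesis
    using E(1) by (rule finite_subset)
qed

lemma bdry_between: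
  assumes "dpred_scalar P" "x \<le> y" "P x \<noteq> P y"
  obtains b where "x \<le> b" "b \<le> y" "bdry P b"
proof -
  obtain E where "finite E" "breakpoints P E"
    using definable_breakpoints[OF assms(1)] by blast
  from breakpointsD[OF breakpoints_bdry[OF this] assms(2)] assms(3)
  have "{v. bdry P v} \<inter> {x..y} \<noteq> {}"
    by blast
  with that show thesis
    by auto
qed

lemma infinite_has_interval:
  assumes "dpred_scalar P" "infinite {v. P v}"
  obtains c d where "c < d" "\<And>v. c < v \<Longrightarrow> v < d \<Longrightarrow> P v"
proof -
  obtain v where "P v" "\<not> bdry P v"
    using finite_bdry[OF assms(1)] assms(2) rev_finite_subset[of "{v. bdry P v}" "{v. P v}"] by auto
  then show thesis
    using that not_bdryE[of P v] by (metis less_trans)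
qed

end

section \<open>Dimension and small sets\<close>

lemma nths_mem_Mn: "x \<in> Mn n \<Longrightarrow> s \<subseteq> {..<n} \<Longrightarrow> nths x s \<in> Mn (card s)"
  by (auto simp: length_nths intro!: arg_cong[where f = card])

lemma nths_lessThan_length: "x \<in> Mn n \<Longrightarrow> nths x {..<n} = x"
  by (intro nths_all) auto

abbreviation open_projection :: "nat set \<Rightarrow> 'm::linorder list set \<Rightarrow> bool" where
  "open_projection s X \<equiv> nonempty_interior (card s) ((\<lambda>x. nths x s) ` X)"

lemma open_projection_mono: "open_projection s X \<Longrightarrow> X \<subseteq> Y \<Longrightarrow> open_projection s Y"
  by (erule nonempty_interior_mono) (rule image_mono)

lemma odim_eq_Sup:
  assumes X: "X \<subseteq> Mn n"
  shows "odim X = Sup ((\<lambda>s. ereal (real (card s))) ` {s. s \<subseteq> {..<n} \<and> open_projection s X})"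
proof -
  have "n' = n" if "X \<subseteq> Mn n'" "open_projection s X" for n' s
  proof -
    have "X \<noteq> {}"
      using that(2) by (auto simp: nonempty_interior_def)
    then show ?thesis
      using X that(1) by (auto simp: Mn_def)
  qed
  then have "{ereal (real (card s)) | s n. X \<subseteq> Mn n \<and> s \<subseteq> {..<n} \<and> open_projection s X} =
      (\<lambda>s. ereal (real (card s))) ` {s. s \<subseteq> {..<n} \<and> open_projection s X}"
    using X by blast
  then show ?thesis
    by (simp only: odim_def)
qed

lemma odim_less_iff:
  assumes X: "X \<subseteq> Mn n"
  shows "odim X < ereal (real d) \<longleftrightarrow> (\<forall>s\<subseteq>{..<n}. d \<le> card s \<longrightarrow> \<not> open_projection s X)"
proof -
  let ?S = "{s. s \<subseteq> {..<n} \<and> open_projection s X}"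
  have "odim X < ereal (real d) \<longleftrightarrow> (\<forall>s\<in>?S. card s < d)"
  proof (cases "?S = {}")
    case True
    have "odim X = -\<infinity>"
      unfolding odim_eq_Sup[OF X] True by (simp add: bot_ereal_def)
    with True show ?thesis
      by auto
  next
    case False
    have "finite ?S"
      by (rule finite_subset[of _ "Pow {..<n}"]) auto
    with False have "odim X < ereal (real d) \<longleftrightarrow> (\<forall>c\<in>(\<lambda>s. ereal (real (card s))) ` ?S. c < ereal (real d))"
      unfolding odim_eq_Sup[OF X] by (intro finite_Sup_less_iff) simp_all
    then show ?thesis
      by simp
  qed
  then show ?thesis
    by (auto simp: not_le[symmetric])
qed

lemma odim_less_full_iff:
  assumes X: "X \<subseteq> Mn n"
  shows "odim X < ereal (real n) \<longleftrightarrow> \<not> nonempty_interior n X"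
proof -
  have "(\<lambda>x. nths x {..<n}) ` X = (\<lambda>x. x) ` X"
    using X nths_lessThan_length by (intro image_cong) auto
  moreover have "s = {..<n}" if "s \<subseteq> {..<n}" "n \<le> card s" for s
    using that card_seteq[of "{..<n}" s] by simp
  ultimately show ?thesis
    unfolding odim_less_iff[OF X] by (metis card_lessThan image_ident order_refl)
qed

lemma odim_less_Suc: "X \<subseteq> Mn n \<Longrightarrow> odim X < ereal (real (Suc n))"
  unfolding odim_less_iff by (metis card_lessThan card_mono finite_lessThan not_less_eq_eq)

locale tame_pair = L: o_minimal_structure DL + N: def_structure DN
  for DL DN :: "('m::{dense_linorder, no_top, no_bot}) list set \<Rightarrow> bool" +
  fixes dimf :: "'m list set \<Rightarrow> ereal"
  assumes expansion: "expansion DL DN"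
    and open_DL: "\<And>p U. DN U \<Longrightarrow> open_n p U \<Longrightarrow> DL U"
    and dimension_function: "dimension_function DL DN dimf"
begin

lemma DL_DN: "DL X \<Longrightarrow> DN X"
  using expansion by (simp add: expansion_def)

lemma dset_LN: "L.dset n X \<Longrightarrow> N.dset n X"
  by (simp add: L.dset_def N.dset_def DL_DN)

lemma dpred_LN: "L.dpred n P \<Longrightarrow> N.dpred n P"
  by (simp add: L.dpred_def N.dpred_def dset_LN)

lemma dmap_LN: "L.dmap n f \<Longrightarrow> N.dmap n f"
  by (simp add: L.dmap_def N.dmap_def DL_DN)

lemma dim_values: "N.dset n X \<Longrightarrow> dimf X = -\<infinity> \<or> (\<exists>d::nat. dimf X = ereal (real d))"
  using dimension_function unfolding dimension_function_def N.dset_def by (elim conjE) blast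

lemma dim_point: "dimf {[a]} = 0"
  using dimension_function unfolding dimension_function_def by (elim conjE) blast

lemma dim_empty_iff: "N.dset n X \<Longrightarrow> dimf X = -\<infinity> \<longleftrightarrow> X = {}"
  using dimension_function unfolding dimension_function_def N.dset_def by (elim conjE) blast

lemma dim_Un: "N.dset n X \<Longrightarrow> N.dset n Y \<Longrightarrow> dimf (X \<union> Y) = max (dimf X) (dimf Y)"
  using dimension_function unfolding dimension_function_def N.dset_def by (elim conjE) blast

lemma dim_disjoint_family:
  assumes "N.dset (p + n) S" "N.dset p I"
    "\<And>t t'. t \<in> I \<Longrightarrow> t' \<in> I \<Longrightarrow> t \<noteq> t' \<Longrightarrow> {x. t @ x \<in> S} \<inter> {x. t' @ x \<in> S} = {}"
  shows "DN {t \<in> I. dimf {x. t @ x \<in> S} = d}"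
    and "(\<And>t. t \<in> I \<Longrightarrow> dimf {x. t @ x \<in> S} = ereal (real k)) \<Longrightarrow>
      dimf (\<Union>t\<in>I. {x. t @ x \<in> S}) = dimf I + ereal (real k)"
proof -
  have "\<forall>p n S I. DN S \<and> S \<subseteq> Mn (p + n) \<and> DN I \<and> I \<subseteq> Mn p \<and>
      (\<forall>t\<in>I. \<forall>t'\<in>I. t \<noteq> t' \<longrightarrow> {x. t @ x \<in> S} \<inter> {x. t' @ x \<in> S} = {}) \<longrightarrow>
      (\<forall>d. DN {t \<in> I. dimf {x. t @ x \<in> S} = d}) \<and>
      (\<forall>k::nat. (\<forall>t\<in>I. dimf {x. t @ x \<in> S} = ereal (real k)) \<longrightarrow>
          dimf (\<Union>t\<in>I. {x. t @ x \<in> S}) = dimf I + ereal (real k))"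
    using dimension_function unfolding dimension_function_def by (elim conjE) assumption
  from this[rule_format, of S p n I]
  have D3: "(\<forall>d. DN {t \<in> I. dimf {x. t @ x \<in> S} = d}) \<and>
      (\<forall>k::nat. (\<forall>t\<in>I. dimf {x. t @ x \<in> S} = ereal (real k)) \<longrightarrow>
          dimf (\<Union>t\<in>I. {x. t @ x \<in> S}) = dimf I + ereal (real k))"
    using assms unfolding N.dset_def by blast
  show "DN {t \<in> I. dimf {x. t @ x \<in> S} = d}"
    using D3 by blast
  show "(\<And>t. t \<in> I \<Longrightarrow> dimf {x. t @ x \<in> S} = ereal (real k)) \<Longrightarrow>
      dimf (\<Union>t\<in>I. {x. t @ x \<in> S}) = dimf I + ereal (real k)"
    using D3 by blast
qed

lemma dim_bij:
  assumes "N.dset n X" "N.dset m Y" "bij_betw f X Y" "N.dmap n f"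
  shows "dimf X = dimf Y"
proof -
  have "\<forall>n m X Y f. DN X \<and> DN Y \<and> X \<subseteq> Mn n \<and> Y \<subseteq> Mn m \<and> bij_betw f X Y \<and>
      DN {x @ f x | x. x \<in> X} \<longrightarrow> dimf X = dimf Y"
    using dimension_function unfolding dimension_function_def by (elim conjE) assumption
  note D4 = this[rule_format, of X Y n m f]
  have graph: "N.dset (n + m) {x @ f x | x. x \<in> X}"
    using bij_betwE[OF assms(3)] N.dset_Mn_subset[OF assms(2)]
    by (intro N.dset_graph[OF assms(1,4)]) blast
  show ?thesis
    by (rule D4) (use assms graph in \<open>auto simp only: N.dset_def\<close>)
qed

lemma dim_DL: "L.dset n X \<Longrightarrow> dimf X = odim X"
proof -
  have "\<forall>X. DL X \<longrightarrow> dimf X = odim X"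
    using dimension_function unfolding dimension_function_def by (elim conjE) assumption
  then show "L.dset n X \<Longrightarrow> dimf X = odim X"
    by (simp add: L.dset_def)
qed

lemma D6:
  assumes "N.dfun n f"
  obtains F E where "L.dfun n F" "N.dset n E" "dimf E < ereal (real n)"
    "\<And>x. x \<in> Mn n \<Longrightarrow> x \<notin> E \<Longrightarrow> f x = F x"
proof -
  have "\<forall>n (f :: 'm list \<Rightarrow> 'm). DN {x @ [f x] | x. x \<in> Mn n} \<longrightarrow>
      (\<exists>F E. DL {x @ [F x] | x. x \<in> Mn n} \<and> DN E \<and> E \<subseteq> Mn n \<and> dimf E < ereal (real n) \<and>
             (\<forall>x \<in> Mn n - E. f x = F x))"
    using dimension_function unfolding dimension_function_def by (elim conjE) assumption
  then obtain F E where "DL {x @ [F x] | x. x \<in> Mn n}" "DN E" "E \<subseteq> Mn n" "dimf E < ereal (real n)"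
    "\<forall>x \<in> Mn n - E. f x = F x"
    using N.dmap_D[OF assms] by blast
  moreover have "(\<lambda>x. [F x]) ` Mn n \<subseteq> Mn 1"
    by auto
  ultimately show thesis
    using that[of F E] unfolding L.dmap_def N.dset_def by blast
qed

lemma dim_mono: "N.dset n X \<Longrightarrow> N.dset n Y \<Longrightarrow> X \<subseteq> Y \<Longrightarrow> dimf X \<le> dimf Y"
  using dim_Un[of n X Y] by (metis Un_absorb1 max.cobounded1)

(* Only a definable cover is required, so that the small subsets of M^n form an ideal. *)
definition small :: "nat \<Rightarrow> nat \<Rightarrow> 'm list set \<Rightarrow> bool" where
  "small n d X \<longleftrightarrow> (\<exists>Y. N.dset n Y \<and> X \<subseteq> Y \<and> dimf Y < ereal (real d))"

lemma small_subset: "small n d Y \<Longrightarrow> X \<subseteq> Y \<Longrightarrow> small n d X"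
  unfolding small_def by blast

lemma small_Un:
  assumes "small n d X" "small n d Y"
  shows "small n d (X \<union> Y)"
proof -
  obtain A B where "N.dset n A" "X \<subseteq> A" "dimf A < ereal (real d)"
    "N.dset n B" "Y \<subseteq> B" "dimf B < ereal (real d)"
    using assms by (auto simp: small_def)
  then show ?thesis
    unfolding small_def by (intro exI[of _ "A \<union> B"]) (auto simp: N.dset_Un dim_Un)
qed

lemma small_iff_dim: "N.dset n X \<Longrightarrow> small n d X \<longleftrightarrow> dimf X < ereal (real d)"
  unfolding small_def using dim_mono le_less_trans by blast

lemma small_empty: "small n d {}"
  using small_iff_dim[OF N.dset_empty] dim_empty_iff[OF N.dset_empty] by simp

lemma small_0_iff: "small n 0 X \<longleftrightarrow> X = {}"
proof
  assume "small n 0 X"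
  then obtain Y where Y: "N.dset n Y" "X \<subseteq> Y" "dimf Y < 0"
    by (auto simp: small_def zero_ereal_def)
  then have "dimf Y = -\<infinity>"
    using dim_values[OF Y(1)] by auto
  then show "X = {}"
    using Y dim_empty_iff by auto
qed (simp add: small_empty)

lemma small_mono: "small n d X \<Longrightarrow> d \<le> e \<Longrightarrow> small n e X"
  unfolding small_def by (meson ereal_less_eq(3) less_le_trans of_nat_le_iff)

lemma small_UN_finite: "finite I \<Longrightarrow> (\<And>i. i \<in> I \<Longrightarrow> small n d (X i)) \<Longrightarrow> small n d (\<Union>i\<in>I. X i)"
  by (induction I rule: finite_induct) (simp_all add: small_empty small_Un)

lemma small_iff_projections:
  assumes "L.dset n X"
  shows "small n d X \<longleftrightarrow>
    (\<forall>s\<subseteq>{..<n}. d \<le> card s \<longrightarrow> \<not> open_projection s X)"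
  using small_iff_dim[OF dset_LN[OF assms]] dim_DL[OF assms]
    odim_less_iff[OF L.dset_Mn_subset[OF assms]] by simp

lemma small_full_iff: "L.dset n X \<Longrightarrow> small n n X \<longleftrightarrow> \<not> nonempty_interior n X"
  by (simp add: small_iff_dim dset_LN dim_DL odim_less_full_iff L.dset_Mn_subset)

lemma small_Suc_arity: "X \<subseteq> Mn n \<Longrightarrow> small n (Suc n) X"
  using small_subset[of n "Suc n" "Mn n" X] odim_less_Suc[of "Mn n" n]
  by (simp add: small_iff_dim N.dset_Mn dim_DL[OF L.dset_Mn])

lemma dim_cases:
  assumes X: "N.dset n X"
  shows "X = {} \<or> (\<exists>d\<le>n. dimf X = ereal (real d))"
proof (cases "X = {}")
  case False
  then obtain d where d: "dimf X = ereal (real d)"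
    using dim_values[OF X] dim_empty_iff[OF X] by blast
  moreover have "d \<le> n"
    using small_Suc_arity[OF N.dset_Mn_subset[OF X]] d by (simp add: small_iff_dim[OF X])
  ultimately show ?thesis
    by blast
qed simp

lemma small_inj:
  assumes A: "N.dset n A" and f: "N.dmap n f" "inj_on f A" "\<And>x. x \<in> A \<Longrightarrow> f x \<in> Mn m"
    and Y: "small m d Y"
  shows "small n d {x \<in> A. f x \<in> Y}"
proof -
  obtain E where E: "N.dset m E" "Y \<subseteq> E" "dimf E < ereal (real d)"
    using Y by (auto simp: small_def)
  define B where "B = {x \<in> A. f x \<in> E}"
  have B: "N.dset n B"
    unfolding B_def by (intro N.dset_Collect A N.dpred_mem[OF E(1)] f)
  have img: "N.dset m (f ` B)"
    by (rule N.dset_image[OF B f(1)]) (use f(3) in \<open>auto simp: B_def\<close>)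
  have "bij_betw f B (f ` B)"
    using f(2) by (auto simp: bij_betw_def B_def inj_on_def)
  then have "dimf B = dimf (f ` B)"
    using dim_bij B img f(1) by blast
  also have "\<dots> \<le> dimf E"
    by (rule dim_mono[OF img E(1)]) (auto simp: B_def)
  finally have "small n d B"
    using E(3) B by (simp add: small_iff_dim)
  then show ?thesis
    by (rule small_subset) (use E(2) in \<open>auto simp: B_def\<close>)
qed

lemma small_singleton:
  assumes "x \<in> Mn n"
  shows "small n 1 {x}"
proof -
  have "dimf {x} = dimf {[undefined :: 'm]}"
    using dim_bij[OF N.dset_singleton[of x] N.dset_point[of undefined], of "\<lambda>_. [undefined]"]
    by (auto simp: bij_betw_def intro: N.dmap_const)
  then have "small (length x) 1 {x}"
    by (simp add: small_iff_dim N.dset_singleton dim_point)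
  then show ?thesis
    using assms by simp
qed

lemma small_finite:
  assumes "finite X" "X \<subseteq> Mn n"
  shows "small n 1 X"
proof -
  have "small n 1 (\<Union>x\<in>X. {x})"
    using assms by (intro small_UN_finite small_singleton) auto
  then show ?thesis
    by simp
qed

section \<open>Additivity of dimension\<close>

abbreviation rel_set :: "nat \<Rightarrow> nat \<Rightarrow> ('m list \<Rightarrow> 'm list \<Rightarrow> bool) \<Rightarrow> 'm list set" where
  "rel_set p n P \<equiv> {z \<in> Mn (p + n). P (take p z) (drop p z)}"

abbreviation fibre :: "nat \<Rightarrow> ('m list \<Rightarrow> 'm list \<Rightarrow> bool) \<Rightarrow> 'm list \<Rightarrow> 'm list set" where
  "fibre n P t \<equiv> {x \<in> Mn n. P t x}"

abbreviation dim_stratum :: "nat \<Rightarrow> nat \<Rightarrow> ('m list \<Rightarrow> 'm list \<Rightarrow> bool) \<Rightarrow> nat \<Rightarrow> 'm list set" where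
  "dim_stratum p n P d \<equiv> {t \<in> Mn p. dimf (fibre n P t) = ereal (real d)}"

lemma dim_graph_fibre:
  assumes P: "N.drel p n P" and t: "t \<in> Mn p"
  shows "dimf {z \<in> rel_set p n P. take p z = t} = dimf (fibre n P t)"
proof -
  have "N.dset (p + n) {z \<in> rel_set p n P. take p z = t}"
    using P unfolding N.dpred_def by (rule N.dset_Collect) (intro N.dpred_intros)
  moreover have "bij_betw ((@) t) (fibre n P t) {z \<in> rel_set p n P. take p z = t}"
  proof (rule bij_betwI[where g = "drop p"])
    show "t @ drop p z = z" if "z \<in> {z \<in> rel_set p n P. take p z = t}" for z
      using that append_take_drop_id[of p z] by auto
  qed (use t in auto)
  moreover have "N.dmap n ((@) t)"
    by (intro N.dmap_intros)
  ultimately show ?thesis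
    by (rule dim_bij[OF N.dset_section[OF P t], symmetric])
qed

lemma dim_fibres:
  assumes P: "N.drel p n P"
  shows "N.dpred p (\<lambda>t. dimf (fibre n P t) = d)"
    and "N.dset p I \<Longrightarrow> (\<And>t. t \<in> I \<Longrightarrow> dimf (fibre n P t) = ereal (real e)) \<Longrightarrow>
      dimf {z \<in> rel_set p n P. take p z \<in> I} = dimf I + ereal (real e)"
proof -
  define S where "S = rel_set p (p + n) (\<lambda>t z. t = take p z \<and> P t (drop p z))"
  have S: "N.dset (p + (p + n)) S"
    unfolding S_def N.dpred_def[symmetric] by (intro N.dpred_intros N.drel_comp[OF P]) simp_all
  have graph: "{z. t @ z \<in> S} = {z \<in> rel_set p n P. take p z = t}" if "t \<in> Mn p" for t
    using that by (auto simp: S_def)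
  have disjoint: "{z. t @ z \<in> S} \<inter> {z. t' @ z \<in> S} = {}" if "t \<noteq> t'" "t \<in> Mn p" "t' \<in> Mn p" for t t'
    using that graph by auto
  have dim_graph: "dimf {z. t @ z \<in> S} = dimf (fibre n P t)" if "t \<in> Mn p" for t
    unfolding graph[OF that] by (rule dim_graph_fibre[OF P that])
  have "DN {t \<in> Mn p. dimf {z. t @ z \<in> S} = d}"
    using dim_disjoint_family(1)[OF S N.dset_Mn] disjoint by blast
  moreover have "{t \<in> Mn p. dimf {z. t @ z \<in> S} = d} = {t \<in> Mn p. dimf (fibre n P t) = d}"
    using dim_graph by auto
  ultimately show "N.dpred p (\<lambda>t. dimf (fibre n P t) = d)"
    by (simp only: N.dpred_def N.dset_def) blast
  assume I: "N.dset p I" and e: "\<And>t. t \<in> I \<Longrightarrow> dimf (fibre n P t) = ereal (real e)"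
  have I_Mn: "t \<in> Mn p" if "t \<in> I" for t
    using N.dset_Mn_subset[OF I] that by blast
  have "dimf (\<Union>t\<in>I. {z. t @ z \<in> S}) = dimf I + ereal (real e)"
  proof (rule dim_disjoint_family(2)[OF S I])
    show "{z. t @ z \<in> S} \<inter> {z. t' @ z \<in> S} = {}" if "t \<in> I" "t' \<in> I" "t \<noteq> t'" for t t'
      using that by (intro disjoint I_Mn)
    show "dimf {z. t @ z \<in> S} = ereal (real e)" if "t \<in> I" for t
      using that by (simp only: dim_graph[OF I_Mn] e)
  qed
  moreover have "(\<Union>t\<in>I. {z. t @ z \<in> S}) = {z \<in> rel_set p n P. take p z \<in> I}"
    using graph I_Mn by auto
  ultimately show "dimf {z \<in> rel_set p n P. take p z \<in> I} = dimf I + ereal (real e)"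
    by simp
qed

lemma small_rel_set_iff:
  assumes P: "N.drel p n P"
  shows "small (p + n) m (rel_set p n P) \<longleftrightarrow> (\<forall>d. small p (m - d) (dim_stratum p n P d))"
proof -
  define S where "S d = {z \<in> rel_set p n P. take p z \<in> dim_stratum p n P d}" for d
  have small_S: "small (p + n) m (S d) \<longleftrightarrow> small p (m - d) (dim_stratum p n P d)" for d
  proof -
    have J: "N.dset p (dim_stratum p n P d)"
      using dim_fibres(1)[OF P] by (simp add: N.dpred_def)
    have S: "N.dset (p + n) (S d)"
      unfolding S_def using P unfolding N.dpred_def
      by (rule N.dset_Collect) (intro N.dpred_mem[OF J] N.dmap_intros)
    have "dimf (S d) = dimf (dim_stratum p n P d) + ereal (real d)"
      unfolding S_def using dim_fibres(2)[OF P J] by simp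
    then show ?thesis
      unfolding small_iff_dim[OF J] small_iff_dim[OF S] using dim_values[OF J] by auto
  qed
  have "rel_set p n P \<subseteq> (\<Union>d\<in>{..n}. S d)"
  proof
    fix z assume z: "z \<in> rel_set p n P"
    then have "take p z \<in> Mn p" "drop p z \<in> fibre n P (take p z)"
      by auto
    with dim_cases[OF N.dset_section[OF P this(1)]]
    show "z \<in> (\<Union>d\<in>{..n}. S d)"
      using z unfolding S_def by blast
  qed
  then have "small (p + n) m (rel_set p n P)" if "\<And>d. small (p + n) m (S d)"
    using that small_UN_finite[of "{..n}" "p + n" m S] small_subset by blast
  moreover have "small (p + n) m (S d)" if "small (p + n) m (rel_set p n P)" for d
    using that by (rule small_subset) (auto simp: S_def)
  ultimately show ?thesis
    using small_S by blast
qed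

lemma small_fibre_iff:
  assumes "N.drel p n P" "t \<in> Mn p"
  shows "small n b (fibre n P t) \<longleftrightarrow> dimf (fibre n P t) < ereal (real b)"
  by (rule small_iff_dim[OF N.dset_section[OF assms]])

lemma small_fibres_if_small:
  assumes P: "N.drel p n P" and small: "small (p + n) (a + b) (rel_set p n P)"
  shows "small p a {t \<in> Mn p. \<not> small n b (fibre n P t)}"
proof -
  have "{t \<in> Mn p. \<not> small n b (fibre n P t)} \<subseteq> (\<Union>d\<in>{b..n}. dim_stratum p n P d)"
  proof
    fix t assume "t \<in> {t \<in> Mn p. \<not> small n b (fibre n P t)}"
    then have t: "t \<in> Mn p" and large: "\<not> small n b (fibre n P t)"
      by auto
    then have "fibre n P t \<noteq> {}"
      using small_empty by metis
    then obtain d where d: "d \<le> n" "dimf (fibre n P t) = ereal (real d)"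
      using dim_cases[OF N.dset_section[OF P t]] by blast
    then have "b \<le> d"
      using large unfolding small_fibre_iff[OF P t] d(2) by simp
    with d t show "t \<in> (\<Union>d\<in>{b..n}. dim_stratum p n P d)"
      by auto
  qed
  moreover have "small p a (dim_stratum p n P d)" if "d \<in> {b..n}" for d
    using small_rel_set_iff[OF P, of "a + b"] small that by (auto intro: small_mono[of p "a + b - d"])
  then have "small p a (\<Union>d\<in>{b..n}. dim_stratum p n P d)"
    by (intro small_UN_finite) auto
  ultimately show ?thesis
    using small_subset by blast
qed

lemma small_if_small_fibres:
  assumes P: "N.drel p n P"
    and base: "small p (Suc a) {t \<in> Mn p. fibre n P t \<noteq> {}}"
    and fibre: "\<And>t. t \<in> Mn p \<Longrightarrow> small n (Suc b) (fibre n P t)"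
    and generic: "small p a {t \<in> Mn p. \<not> small n b (fibre n P t)}"
  shows "small (p + n) (a + b) (rel_set p n P)"
  unfolding small_rel_set_iff[OF P]
proof
  fix d
  consider "d < b" | "d = b" | "b < d"
    by linarith
  then show "small p (a + b - d) (dim_stratum p n P d)"
  proof cases
    assume "d < b"
    have "fibre n P t \<noteq> {}" if "dimf (fibre n P t) = ereal (real d)" for t
      using that dim_empty_iff[OF N.dset_empty] by (metis MInfty_neq_ereal(1))
    then have "small p (Suc a) (dim_stratum p n P d)"
      by (intro small_subset[OF base]) blast
    then show ?thesis
      by (rule small_mono) (use \<open>d < b\<close> in simp)
  next
    assume "d = b"
    then have "dim_stratum p n P d \<subseteq> {t \<in> Mn p. \<not> small n b (fibre n P t)}"
      using small_fibre_iff[OF P] by auto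
    then show ?thesis
      using small_subset[OF generic] \<open>d = b\<close> by simp
  next
    assume "b < d"
    then have "dim_stratum p n P d = {}"
      using small_fibre_iff[OF P, of _ "Suc b"] fibre by force
    then show ?thesis
      by (simp only: small_empty)
  qed
qed

lemma N_dpred_small:
  assumes P: "N.drel p n P"
  shows "N.dpred p (\<lambda>t. small n b (fibre n P t))"
proof -
  have "N.dpred p (\<lambda>t. dimf (fibre n P t) = -\<infinity> \<or> (\<exists>e\<in>{..<b}. dimf (fibre n P t) = ereal (real e)))"
    by (intro N.dpred_disj N.dpred_bex_finite dim_fibres(1)[OF P]) simp
  then show ?thesis
  proof (rule N.dpred_congI)
    fix t :: "'m list" assume t: "t \<in> Mn p"
    from dim_values[OF N.dset_section[OF P t]]
    show "small n b (fibre n P t) \<longleftrightarrow>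
        dimf (fibre n P t) = -\<infinity> \<or> (\<exists>e\<in>{..<b}. dimf (fibre n P t) = ereal (real e))"
      unfolding small_fibre_iff[OF P t] by auto
  qed
qed

lemma L_dpred_small:
  assumes P: "L.drel p n P"
  shows "L.dpred p (\<lambda>t. small n b (fibre n P t))"
proof -
  define proj_has_interior where "proj_has_interior s t \<longleftrightarrow>
      (\<exists>c\<in>Mn (card s). \<exists>d\<in>Mn (card s). (\<forall>i<card s. c ! i < d ! i) \<and>
        (\<forall>y\<in>Mn (card s). y \<in> box (card s) c d \<longrightarrow> (\<exists>x\<in>Mn n. P t x \<and> y = nths x s)))" for s t
  have "L.dpred p (proj_has_interior s)" for s
    unfolding proj_has_interior_def by (intro L.dpred_intros L.drel_comp[OF P]) simp_all
  then have "L.dpred p (\<lambda>t. \<forall>s\<in>{s. s \<subseteq> {..<n} \<and> b \<le> card s}. \<not> proj_has_interior s t)"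
    by (intro L.dpred_ball_finite L.dpred_not) auto
  then show ?thesis
  proof (rule L.dpred_congI)
    fix t :: "'m list" assume t: "t \<in> Mn p"
    have "open_projection s (fibre n P t) \<longleftrightarrow> proj_has_interior s t" for s
    proof -
      have "box (card s) c d \<subseteq> (\<lambda>x. nths x s) ` fibre n P t \<longleftrightarrow>
          (\<forall>y\<in>Mn (card s). y \<in> box (card s) c d \<longrightarrow> (\<exists>x\<in>Mn n. P t x \<and> y = nths x s))" for c d
        using box_subset_Mn[of "card s" c d] by blast
      then show ?thesis
        unfolding nonempty_interior_iff proj_has_interior_def box_nonempty_iff by simp
    qed
    then show "small n b (fibre n P t) \<longleftrightarrow>
        (\<forall>s\<in>{s. s \<subseteq> {..<n} \<and> b \<le> card s}. \<not> proj_has_interior s t)"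
      unfolding small_iff_projections[OF L.dset_section[OF P t]] by auto
  qed
qed

end

section \<open>Generic points\<close>

context tame_pair
begin

definition generic :: "nat \<Rightarrow> nat \<Rightarrow> 'm list set \<Rightarrow> 'm list filter" where
  "generic n d Y = Abs_filter (\<lambda>P. small n d {x \<in> Y. \<not> P x})"

abbreviation almost_all :: "nat \<Rightarrow> 'm list filter" where
  "almost_all n \<equiv> generic n n (Mn n)"

lemma eventually_generic: "eventually P (generic n d Y) \<longleftrightarrow> small n d {x \<in> Y. \<not> P x}"
  unfolding generic_def
proof (rule eventually_Abs_filter, unfold_locales)
  show "small n d {x \<in> Y. \<not> True}"
    by (simp add: small_empty)
  show "small n d {x \<in> Y. \<not> (P x \<and> Q x)}"
    if "small n d {x \<in> Y. \<not> P x}" "small n d {x \<in> Y. \<not> Q x}" for P Q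
    by (rule small_subset[OF small_Un[OF that]]) blast
  show "small n d {x \<in> Y. \<not> Q x}" if "\<forall>x. P x \<longrightarrow> Q x" "small n d {x \<in> Y. \<not> P x}" for P Q
    by (rule small_subset[OF that(2)]) (use that(1) in blast)
qed

lemma eventually_generic_mem: "\<forall>\<^sub>F x in generic n d Y. x \<in> Y"
  by (simp add: eventually_generic small_empty)

lemma generic_ex:
  assumes "\<not> small n d Y" "\<forall>\<^sub>F x in generic n d Y. P x"
  shows "\<exists>x\<in>Y. P x"
proof (rule ccontr)
  assume "\<not> ?thesis"
  then have "{x \<in> Y. \<not> P x} = Y"
    by blast
  with assms show False
    by (simp add: eventually_generic)
qed

lemma generic_cong:
  assumes "small n d (Y - Y')" "small n d (Y' - Y)"
  shows "generic n d Y = generic n d Y'"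
proof -
  have "eventually P (generic n d B)" if "small n d (B - A)" "eventually P (generic n d A)" for A B P
    unfolding eventually_generic
    by (rule small_subset[OF small_Un[OF that(1) that(2)[unfolded eventually_generic]]]) blast
  with assms show ?thesis
    unfolding filter_eq_iff by blast
qed

lemma filterlim_generic:
  assumes f: "N.dmap n f" "\<And>x. x \<in> Mn n \<Longrightarrow> f x \<in> Mn m" and g: "N.dmap m g"
    and Y: "Y \<subseteq> Mn n"
    and left_inverse: "\<forall>\<^sub>F x in generic n d Y. g (f x) = x"
    and mem: "\<forall>\<^sub>F x in generic n d Y. f x \<in> Y'"
  shows "filterlim f (generic m d Y') (generic n d Y)"
  unfolding filterlim_iff
proof (intro allI impI)
  fix P assume "\<forall>\<^sub>F y in generic m d Y'. P y"
  then have "small m d {y \<in> Y'. \<not> P y}"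
    by (simp add: eventually_generic)
  moreover have "N.dset n {x \<in> Mn n. g (f x) = x}"
    unfolding N.dpred_def[symmetric] by (intro N.dpred_intros N.dmap_comp[OF g f])
  moreover have "inj_on f {x \<in> Mn n. g (f x) = x}"
    by (auto intro: inj_on_inverseI)
  ultimately have "small n d {x \<in> {x \<in> Mn n. g (f x) = x}. f x \<in> {y \<in> Y'. \<not> P y}}"
    using f by (intro small_inj) auto
  then have "\<forall>\<^sub>F x in generic n d Y. \<not> (g (f x) = x \<and> f x \<in> Y' \<and> \<not> P (f x))"
    unfolding eventually_generic by (rule small_subset) (use Y in auto)
  with left_inverse mem show "\<forall>\<^sub>F x in generic n d Y. P (f x)"
    by eventually_elim blast
qed

lemma N_dpred_eventually_generic:
  assumes "N.dset n Y" "N.drel p n P"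
  shows "N.dpred p (\<lambda>t. \<forall>\<^sub>F x in generic n d Y. P t x)"
proof (rule N.dpred_congI)
  show "N.dpred p (\<lambda>t. small n d {x \<in> Mn n. x \<in> Y \<and> \<not> P t x})"
    by (intro N_dpred_small N.dpred_intros N.dpred_mem[OF assms(1)] assms(2))
  have "{x \<in> Mn n. x \<in> Y \<and> Q x} = {x \<in> Y. Q x}" for Q
    using N.dset_Mn_subset[OF assms(1)] by blast
  then show "(\<forall>\<^sub>F x in generic n d Y. P t x) \<longleftrightarrow> small n d {x \<in> Mn n. x \<in> Y \<and> \<not> P t x}" for t
    by (simp only: eventually_generic)
qed

lemma L_dpred_eventually_generic:
  assumes "L.dset n Y" "L.drel p n P"
  shows "L.dpred p (\<lambda>t. \<forall>\<^sub>F x in generic n d Y. P t x)"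
proof (rule L.dpred_congI)
  show "L.dpred p (\<lambda>t. small n d {x \<in> Mn n. x \<in> Y \<and> \<not> P t x})"
    by (intro L_dpred_small L.dpred_intros L.dpred_mem[OF assms(1)] assms(2))
  have "{x \<in> Mn n. x \<in> Y \<and> Q x} = {x \<in> Y. Q x}" for Q
    using L.dset_Mn_subset[OF assms(1)] by blast
  then show "(\<forall>\<^sub>F x in generic n d Y. P t x) \<longleftrightarrow> small n d {x \<in> Mn n. x \<in> Y \<and> \<not> P t x}" for t
    by (simp only: eventually_generic)
qed

lemma eventually_eventually_generic:
  assumes Y: "N.dset p Y" "small p (Suc a) Y" and Y': "N.dset n Y'" "small n (Suc b) Y'"
    and P: "N.drel p n P"
  shows "(\<forall>\<^sub>F t in generic p a Y. \<forall>\<^sub>F x in generic n b Y'. P t x) \<longleftrightarrow>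
    small (p + n) (a + b) (rel_set p n (\<lambda>t x. t \<in> Y \<and> x \<in> Y' \<and> \<not> P t x))"
proof -
  define Q where "Q t x \<longleftrightarrow> t \<in> Y \<and> x \<in> Y' \<and> \<not> P t x" for t x
  have Q: "N.drel p n Q"
    unfolding Q_def by (intro N.dpred_intros P N.dpred_mem[OF Y(1)] N.dpred_mem[OF Y'(1)])
  have fibre: "fibre n Q t = (if t \<in> Y then {x \<in> Y'. \<not> P t x} else {})" for t
    using N.dset_Mn_subset[OF Y'(1)] by (auto simp: Q_def)
  have "{t \<in> Y. \<not> (\<forall>\<^sub>F x in generic n b Y'. P t x)} = {t \<in> Mn p. \<not> small n b (fibre n Q t)}"
    using N.dset_Mn_subset[OF Y(1)] unfolding fibre eventually_generic by (auto simp: small_empty)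
  then have "(\<forall>\<^sub>F t in generic p a Y. \<forall>\<^sub>F x in generic n b Y'. P t x) \<longleftrightarrow>
      small p a {t \<in> Mn p. \<not> small n b (fibre n Q t)}"
    by (simp only: eventually_generic[of _ p])
  also have "\<dots> \<longleftrightarrow> small (p + n) (a + b) (rel_set p n Q)"
  proof
    assume "small p a {t \<in> Mn p. \<not> small n b (fibre n Q t)}"
    then show "small (p + n) (a + b) (rel_set p n Q)"
    proof (rule small_if_small_fibres[OF Q, rotated 2])
      show "small p (Suc a) {t \<in> Mn p. fibre n Q t \<noteq> {}}"
        by (rule small_subset[OF Y(2)]) (auto simp: Q_def)
      show "small n (Suc b) (fibre n Q t)" for t
        by (rule small_subset[OF Y'(2)]) (auto simp: Q_def)
    qed
  qed (rule small_fibres_if_small[OF Q])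
  finally show ?thesis
    by (simp only: Q_def)
qed

lemma eventually_generic_swap:
  assumes Y: "N.dset p Y" "small p (Suc a) Y" and Y': "N.dset n Y'" "small n (Suc b) Y'"
    and P: "N.drel p n P"
    and ev: "\<forall>\<^sub>F t in generic p a Y. \<forall>\<^sub>F x in generic n b Y'. P t x"
  shows "\<forall>\<^sub>F x in generic n b Y'. \<forall>\<^sub>F t in generic p a Y. P t x"
proof -
  define swap where "swap z = drop n z @ take n z" for z :: "'m list"
  have P': "N.drel n p (\<lambda>x t. P t x)"
    by (rule N.drel_comp[OF P]) (auto intro: N.dmap_intros)
  have swap: "swap z \<in> Mn (p + n)" "take p (swap z) = drop n z" "drop p (swap z) = take n z"
    if "z \<in> Mn (n + p)" for z
    using that by (auto simp: swap_def)
  have "small (n + p) (a + b) {z \<in> Mn (n + p). swap z \<in> rel_set p n (\<lambda>t x. t \<in> Y \<and> x \<in> Y' \<and> \<not> P t x)}"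
  proof (rule small_inj[OF N.dset_Mn])
    show "N.dmap (n + p) swap"
      unfolding swap_def by (intro N.dmap_intros)
    show "inj_on swap (Mn (n + p))"
      by (rule inj_onI) (metis append_take_drop_id swap(2,3))
    show "small (p + n) (a + b) (rel_set p n (\<lambda>t x. t \<in> Y \<and> x \<in> Y' \<and> \<not> P t x))"
      using ev eventually_eventually_generic[OF Y Y' P] by blast
  qed (rule swap)
  also have "{z \<in> Mn (n + p). swap z \<in> rel_set p n (\<lambda>t x. t \<in> Y \<and> x \<in> Y' \<and> \<not> P t x)} =
      rel_set n p (\<lambda>x t. x \<in> Y' \<and> t \<in> Y \<and> \<not> P t x)"
    using swap by auto
  finally show ?thesis
    using eventually_eventually_generic[OF Y' Y P'] by (simp only: add.commute[of a b])
qed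

lemma almost_all_box:
  assumes "\<forall>\<^sub>F x in almost_all n. P x" "a \<in> Mn n" "b \<in> Mn n" "\<And>i. i < n \<Longrightarrow> a ! i < b ! i"
  shows "\<exists>x\<in>box n a b. P x"
proof -
  have "nonempty_interior n (box n a b)"
    using assms(2-4) box_nonempty_iff[of n a b] unfolding nonempty_interior_iff by blast
  then have "\<not> small n n (box n a b)"
    using small_full_iff[OF L.dset_box] by blast
  moreover have "\<forall>\<^sub>F x in generic n n (box n a b). P x"
    using assms(1) unfolding eventually_generic
    by (rule small_subset) (use box_subset_Mn[of n a b] in blast)
  ultimately show ?thesis
    by (rule generic_ex)
qed

definition persistent :: "nat \<Rightarrow> nat \<Rightarrow> ('m list \<Rightarrow> 'm list \<Rightarrow> bool) \<Rightarrow> 'm list \<Rightarrow> bool" where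
  "persistent k n W t \<longleftrightarrow> (\<forall>\<^sub>F x in almost_all n. W t x \<longrightarrow> (\<forall>\<^sub>F u in nhd k t. W u x))"

lemma drel_eventually_nhd:
  assumes "L.drel k n W"
  shows "L.drel k n (\<lambda>t x. \<forall>\<^sub>F u in nhd k t. W u x)"
  by (intro L.dpred_eventually_nhd L.dpred_intros L.drel_comp[OF assms]) simp_all

lemma dpred_persistent: "L.drel k n W \<Longrightarrow> L.dpred k (persistent k n W)"
  unfolding persistent_def
  by (intro L_dpred_eventually_generic[OF L.dset_Mn] L.dpred_imp drel_eventually_nhd)

lemma nonempty_interior_rel_set:
  assumes "nonempty_interior (k + n) (rel_set k n S)"
  obtains t x where "t \<in> Mn k" "\<forall>\<^sub>F u in nhd k t. S u x"
proof -
  obtain a b z where ab: "a \<in> Mn (k + n)" "b \<in> Mn (k + n)" "box (k + n) a b \<subseteq> rel_set k n S"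
    and z: "z \<in> box (k + n) a b"
    using assms unfolding nonempty_interior_iff by blast
  define t x where "t = take k z" and "x = drop k z"
  have t: "t \<in> Mn k" and z_eq: "z = t @ x"
    using z box_subset_Mn[of "k + n" a b] by (auto simp: t_def x_def)
  have box_iff: "u @ x \<in> box (k + n) a b \<longleftrightarrow>
      u \<in> box k (take k a) (take k b) \<and> x \<in> box n (drop k a) (drop k b)" if "u \<in> Mn k" for u
    using box_append ab(1,2) that by blast
  then have z_box: "t \<in> box k (take k a) (take k b)" "x \<in> box n (drop k a) (drop k b)"
    using t z unfolding z_eq by blast+
  then have "\<forall>\<^sub>F u in nhd k t. u \<in> box k (take k a) (take k b)"
    using ab(1,2) by (intro eventually_nhd_box) auto
  then have "\<forall>\<^sub>F u in nhd k t. S u x"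
    using eventually_nhd_Mn
  proof eventually_elim
    case (elim u)
    then have "u @ x \<in> rel_set k n S"
      using box_iff z_box(2) ab(3) by blast
    then show ?case
      using elim(2) by simp
  qed
  with t that show thesis
    by blast
qed

(* A box on which W fails to persist would itself be a neighbourhood on which W holds. *)
lemma almost_all_persistent:
  assumes W: "L.drel k n W"
  shows "\<forall>\<^sub>F t in almost_all k. persistent k n W t"
proof (rule ccontr)
  assume not_persistent: "\<not> ?thesis"
  define S where "S t x \<longleftrightarrow> W t x \<and> \<not> (\<forall>\<^sub>F u in nhd k t. W u x)" for t x
  have S: "L.drel k n S"
    unfolding S_def by (intro L.dpred_conj L.dpred_not W drel_eventually_nhd)
  have "\<not> small k k {t \<in> Mn k. \<not> small n n (fibre n S t)}"
    using not_persistent by (simp add: eventually_generic persistent_def S_def)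
  then have "\<not> small (k + n) (k + n) (rel_set k n S)"
    using small_fibres_if_small[OF dpred_LN[OF S]] by blast
  then have "nonempty_interior (k + n) (rel_set k n S)"
    using small_full_iff S unfolding L.dpred_def by blast
  then obtain t x where t: "t \<in> Mn k" and ev: "\<forall>\<^sub>F u in nhd k t. S u x"
    by (rule nonempty_interior_rel_set)
  from ev have "\<forall>\<^sub>F u in nhd k t. W u x"
    by eventually_elim (simp add: S_def)
  moreover have "S t x"
    using eventually_nhd_self[OF ev t] .
  ultimately show False
    by (simp add: S_def)
qed

lemma persistent_box:
  assumes "persistent k n W t" "a \<in> Mn n" "b \<in> Mn n" "\<And>i. i < n \<Longrightarrow> a ! i < b ! i"
    and "\<And>x. x \<in> box n a b \<Longrightarrow> W t x"
  shows "\<exists>x\<in>box n a b. \<forall>\<^sub>F u in nhd k t. W u x"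
  using almost_all_box[OF assms(1)[unfolded persistent_def] assms(2-4)] assms(5) by blast

lemma nths_singleton: "i < length x \<Longrightarrow> nths x {i} = [x ! i]"
proof (induction x arbitrary: i)
  case (Cons a x)
  have "{j. Suc j \<in> {Suc i'}} = {i'}" for i'
    by auto
  with Cons show ?case
    by (cases i) (simp_all add: nths_Cons)
qed simp

lemma open_projection_if_infinite_coordinate:
  assumes X: "L.dset n X" and i: "i < n" and infinite: "infinite ((\<lambda>x. x ! i) ` X)"
  shows "open_projection {i} X"
proof -
  let ?P = "\<lambda>v. \<exists>x\<in>Mn n. x \<in> X \<and> x ! i = v"
  have image: "(\<lambda>x. x ! i) ` X = {v. ?P v}"
    using L.dset_Mn_subset[OF X] by blast
  have "L.dpred_scalar ?P"
    by (intro L.dpred_intros L.dpred_mem[OF X])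
  then obtain c d where cd: "c < d" "\<And>v. c < v \<Longrightarrow> v < d \<Longrightarrow> ?P v"
    using L.infinite_has_interval[OF _ infinite[unfolded image]] by blast
  show ?thesis
    unfolding nonempty_interior_iff
  proof (rule bexI[of _ "[c]"], rule bexI[of _ "[d]"], rule conjI)
    show "box (card {i}) [c] [d] \<noteq> {}"
      using cd(1) by (simp add: box_nonempty_iff)
    show "box (card {i}) [c] [d] \<subseteq> (\<lambda>x. nths x {i}) ` X"
    proof
      fix y assume "y \<in> box (card {i}) [c] [d]"
      then obtain v where v: "y = [v]" "c < v" "v < d"
        by (auto simp: box_1_image)
      then obtain x where "x \<in> Mn n" "x \<in> X" "x ! i = v"
        using cd(2) by blast
      then show "y \<in> (\<lambda>x. nths x {i}) ` X"
        using v i nths_singleton[of i x] by (intro image_eqI[of _ _ x]) auto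
    qed
  qed auto
qed

lemma small_1_iff_finite:
  assumes X: "L.dset n X"
  shows "small n 1 X \<longleftrightarrow> finite X"
proof
  assume "small n 1 X"
  then have "\<not> open_projection {i} X" if "i < n" for i
    using that unfolding small_iff_projections[OF X] by force
  then have "finite ((\<lambda>x. x ! i) ` X)" if "i < n" for i
    using open_projection_if_infinite_coordinate[OF X] that by blast
  then have "finite (\<Union>i\<in>{..<n}. (\<lambda>x. x ! i) ` X)"
    by simp
  moreover have "X \<subseteq> {x. set x \<subseteq> (\<Union>i\<in>{..<n}. (\<lambda>x. x ! i) ` X) \<and> length x = n}"
    using L.dset_length[OF X] by (force simp: in_set_conv_nth)
  ultimately show "finite X"
    using finite_lists_length_eq finite_subset by blast
qed (use small_finite L.dset_Mn_subset[OF X] in blast)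

lemma almost_all_1_iff:
  assumes "L.dpred_scalar P"
  shows "(\<forall>\<^sub>F x in almost_all 1. P (x ! 0)) \<longleftrightarrow> finite {v. \<not> P v}"
proof -
  have "{x \<in> Mn 1. \<not> P (x ! 0)} = (\<lambda>v. [v]) ` {v. \<not> P v}"
    by (auto simp: length_Suc_conv)
  then have "finite {x \<in> Mn 1. \<not> P (x ! 0)} \<longleftrightarrow> finite {v. \<not> P v}"
    by (simp add: finite_image_iff inj_on_def)
  moreover have "L.dset 1 {x \<in> Mn 1. \<not> P (x ! 0)}"
    using L.dpred_not[OF assms] by (simp only: L.dpred_def)
  ultimately show ?thesis
    using small_1_iff_finite by (simp only: eventually_generic)
qed

lemma almost_all_Suc_if_finite_fibres:
  assumes P: "L.dfam k P" and fin: "\<forall>\<^sub>F t in almost_all k. finite {v. \<not> P t v}"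
  shows "\<forall>\<^sub>F z in almost_all (Suc k). P (take k z) (z ! k)"
proof -
  define Q where "Q t x \<longleftrightarrow> P t (x ! 0)" for t x
  have Q: "L.drel k 1 Q"
    unfolding Q_def by (intro L.dfam_comp[OF P] L.dpred_intros) simp
  have "\<forall>\<^sub>F t in almost_all k. \<forall>\<^sub>F x in almost_all 1. Q t x"
    using fin eventually_generic_mem
  proof eventually_elim
    case (elim t)
    then show ?case
      using almost_all_1_iff[OF L.dfam_section[OF P elim(2)]] by (simp only: Q_def)
  qed
  then have "small (k + 1) (k + 1) (rel_set k 1 (\<lambda>t x. t \<in> Mn k \<and> x \<in> Mn 1 \<and> \<not> Q t x))"
    using eventually_eventually_generic[OF N.dset_Mn _ N.dset_Mn _ dpred_LN[OF Q]] small_Suc_arity by blast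
  then show ?thesis
    unfolding eventually_generic Q_def Suc_eq_plus1 by (rule small_subset) auto
qed

lemma almost_all_finite_nonpersistent:
  assumes A: "L.dfam k A"
  shows "\<forall>\<^sub>F t in almost_all k. finite {v. A t v \<and> \<not> (\<forall>\<^sub>F u in nhd k t. A u v)}"
proof -
  have W: "L.drel k 1 (\<lambda>t x. A t (x ! 0))"
    by (intro L.dfam_comp[OF A] L.dpred_intros) simp
  have near: "L.dfam k (\<lambda>t v. A t v \<longrightarrow> (\<forall>\<^sub>F u in nhd k t. A u v))"
    by (intro L.dpred_imp A L.dpred_eventually_nhd L.dpred_intros L.dfam_comp[OF A]) simp_all
  show ?thesis
    using almost_all_persistent[OF W] eventually_generic_mem
  proof eventually_elim
    case (elim t)
    then show ?case
      using almost_all_1_iff[OF L.dfam_section[OF near elim(2)]]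
      by (simp only: persistent_def not_imp)
  qed
qed

end

section \<open>Uniform finiteness\<close>

lemma Suc_le_card_iff:
  fixes S :: "'a::linorder set"
  assumes "finite S"
  shows "Suc j \<le> card S \<longleftrightarrow> (\<exists>v\<in>S. j \<le> card {x \<in> S. x < v})"
proof
  assume le: "Suc j \<le> card S"
  then have "S \<noteq> {}"
    by auto
  then have Max: "Max S \<in> S"
    using assms by simp
  then have "S = insert (Max S) {x \<in> S. x < Max S}"
    using assms by (auto simp: less_le)
  then have "card S = card (insert (Max S) {x \<in> S. x < Max S})"
    by (rule arg_cong)
  also have "\<dots> = Suc (card {x \<in> S. x < Max S})"
    using assms by simp
  finally show "\<exists>v\<in>S. j \<le> card {x \<in> S. x < v}"
    using le Max by (intro bexI[of _ "Max S"]) auto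
next
  assume "\<exists>v\<in>S. j \<le> card {x \<in> S. x < v}"
  then obtain v where "v \<in> S" "j \<le> card {x \<in> S. x < v}"
    by blast
  moreover from this(1) have "card {x \<in> S. x < v} < card S"
    using assms by (intro psubset_card_mono) auto
  ultimately show "Suc j \<le> card S"
    by simp
qed

lemma (in def_structure) dfam_le_card_less:
  assumes A: "dfam k A" and fin: "\<And>t. t \<in> Mn k \<Longrightarrow> finite {v. A t v}"
  shows "dfam k (\<lambda>t v. j \<le> card {w. A t w \<and> w < v})"
proof (induction j)
  case (Suc j)
  have "dfam k (\<lambda>t v. \<exists>w. w < v \<and> A t w \<and> j \<le> card {x. A t x \<and> x < w})"
    by (intro dpred_intros dfam_comp[OF A] dfam_comp[OF Suc]) simp_all
  then show ?case
  proof (rule dpred_congI)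
    fix z :: "'m list" assume "z \<in> Mn (Suc k)"
    then have "finite {w. A (take k z) w \<and> w < z ! k}"
      using fin[of "take k z"] by (auto elim: rev_finite_subset)
    note step = Suc_le_card_iff[OF this]
    have "{x. (A t x \<and> x < v) \<and> x < w} = {x. A t x \<and> x < w}" if "w < v" for t v w
      using that by auto
    then show "Suc j \<le> card {w. A (take k z) w \<and> w < z ! k} \<longleftrightarrow>
        (\<exists>w. w < z ! k \<and> A (take k z) w \<and> j \<le> card {x. A (take k z) x \<and> x < w})"
      unfolding step by (auto cong: conj_cong)
  qed
qed (simp add: dpred_const)

lemma (in def_structure) dfam_card_less_eq:
  assumes "dfam k A" "\<And>t. t \<in> Mn k \<Longrightarrow> finite {v. A t v}"
  shows "dfam k (\<lambda>t v. card {w. A t w \<and> w < v} = j)"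
proof (rule dpred_congI)
  show "dfam k (\<lambda>t v. j \<le> card {w. A t w \<and> w < v} \<and> \<not> Suc j \<le> card {w. A t w \<and> w < v})"
    using assms by (intro dpred_conj dpred_not dfam_le_card_less)
qed auto

lemma (in def_structure) dpred_card_eq:
  assumes A: "dfam k A" and fin: "\<And>t. t \<in> Mn k \<Longrightarrow> finite {v. A t v}"
  shows "dpred k (\<lambda>t. card {v. A t v} = j)"
proof -
  have le: "dpred k (\<lambda>t. j \<le> card {v. A t v})" for j
  proof (cases j)
    case (Suc i)
    have "dpred k (\<lambda>t. \<exists>v. A t v \<and> i \<le> card {w. A t w \<and> w < v})"
      by (intro dpred_intros dfam_le_card_less A fin)
    then show ?thesis
      unfolding Suc by (rule dpred_congI) (simp add: Suc_le_card_iff[OF fin])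
  qed (simp add: dpred_const)
  show ?thesis
    by (rule dpred_congI[OF dpred_conj[OF le[of j] dpred_not[OF le[of "Suc j"]]]]) auto
qed

lemma finite_greatest_le:
  fixes u :: "'a::{no_bot, no_top, linorder}"
  assumes fin: "finite {v. P v}" and card: "card {v. P v \<and> v \<le> u} = Suc m"
  obtains a b where "a < b" "b \<le> u" "P b" "\<And>v. a < v \<Longrightarrow> v \<le> u \<Longrightarrow> P v \<Longrightarrow> v = b"
    "card {v. P v \<and> v \<le> a} = m"
proof -
  define S where "S = {v. P v \<and> v \<le> u}"
  define b where "b = Max S"
  have S: "finite S" "S \<noteq> {}"
    using card by (auto simp: S_def[symmetric] intro: card_ge_0_finite)
  then have b: "P b" "b \<le> u" and le_b: "\<And>v. P v \<Longrightarrow> v \<le> u \<Longrightarrow> v \<le> b"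
    using Max_in[OF S] Max_ge[OF S(1)] by (auto simp: b_def S_def)
  obtain a a' where a: "a < b" "b < a'" "{v. P v} \<inter> {a<..<a'} \<subseteq> {b}"
    using finite_isolate[OF fin] by metis
  then have a_gap: "v = b" if "a < v" "v \<le> u" "P v" for v
    using that le_b[of v] by fastforce
  then have "v \<le> a \<or> v = b" if "P v" "v \<le> u" for v
    using that by (meson leI)
  then have "S = insert b {v. P v \<and> v \<le> a}"
    using b a(1) by (auto simp: S_def)
  moreover have "finite {v. P v \<and> v \<le> a}" "b \<notin> {v. P v \<and> v \<le> a}"
    using fin a(1) by (auto elim: rev_finite_subset)
  ultimately have "card {v. P v \<and> v \<le> a} = m"
    using card by (simp add: S_def)
  with a(1) b a_gap that show thesis
    by blast
qed

definition isolates :: "('m::linorder \<Rightarrow> bool) \<Rightarrow> 'm \<Rightarrow> 'm \<Rightarrow> 'm \<Rightarrow> bool" where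
  "isolates P c d e \<longleftrightarrow>
    (\<exists>w. c < w \<and> w < d \<and> P w \<and> (\<forall>v. c < v \<and> v \<le> e \<and> P v \<longrightarrow> v = w))"

lemma isolates_imp_card_less:
  fixes c :: "'m::linorder"
  assumes fin: "finite {v. P v}" and isolates: "isolates P c d e" and "d \<le> e"
    and gap: "\<And>v. p \<le> v \<Longrightarrow> v \<le> q \<Longrightarrow> \<not> P v" and c: "p < c" "c < q"
  shows "card {v. P v \<and> v < d} = Suc (card {v. P v \<and> v < p})"
    and "d \<le> v \<Longrightarrow> v \<le> e \<Longrightarrow> \<not> P v"
proof -
  obtain w where w: "c < w" "w < d" "P w" "\<And>v. c < v \<Longrightarrow> v \<le> e \<Longrightarrow> P v \<Longrightarrow> v = w"
    using isolates unfolding isolates_def by blast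
  have "v < p \<or> v = w" if "P v" "v < d" for v
  proof (cases "c < v")
    case True
    then show ?thesis
      using w(4)[of v] that \<open>d \<le> e\<close> by auto
  next
    case False
    then show ?thesis
      using gap[of v] that c by fastforce
  qed
  then have "{v. P v \<and> v < d} = insert w {v. P v \<and> v < p}"
    using w(1-3) c by force
  moreover have "finite {v. P v \<and> v < p}" "w \<notin> {v. P v \<and> v < p}"
    using fin w(1) c by (auto elim: rev_finite_subset)
  ultimately show "card {v. P v \<and> v < d} = Suc (card {v. P v \<and> v < p})"
    by simp
  show "d \<le> v \<Longrightarrow> v \<le> e \<Longrightarrow> \<not> P v"
    using w(1,2) w(4)[of v] by (metis leD less_le_trans less_trans)
qed

context tame_pair
begin

lemma persistent_interval:
  assumes "persistent k 1 (\<lambda>t x. W t (x ! 0)) t" "c < d" "\<And>v. c < v \<Longrightarrow> v < d \<Longrightarrow> W t v"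
  obtains v where "c < v" "v < d" "\<forall>\<^sub>F u in nhd k t. W u v"
proof -
  have "\<exists>x\<in>box 1 [c] [d]. \<forall>\<^sub>F u in nhd k t. W u (x ! 0)"
  proof (rule persistent_box[OF assms(1), of "[c]" "[d]"])
    show "W t (x ! 0)" if "x \<in> box 1 [c] [d]" for x
      using that assms(3) by (simp add: box_def)
  qed (use assms(2) in auto)
  then obtain x where "x \<in> box 1 [c] [d]" "\<forall>\<^sub>F u in nhd k t. W u (x ! 0)"
    by blast
  then show thesis
    using that[of "x ! 0"] by (simp add: box_def)
qed

definition count_stable :: "nat \<Rightarrow> ('m list \<Rightarrow> 'm \<Rightarrow> bool) \<Rightarrow> 'm list \<Rightarrow> bool" where
  "count_stable k A t \<longleftrightarrow>
    persistent k 3 (\<lambda>t x. isolates (A t) (x ! 0) (x ! 1) (x ! 2)) t \<and>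
    persistent k 1 (\<lambda>t x. \<forall>w. A t w \<longrightarrow> x ! 0 < w) t \<and>
    persistent k 1 (\<lambda>t x. \<forall>w. A t w \<longrightarrow> w < x ! 0) t"

lemma count_stable_relations:
  assumes "L.dfam k A"
  shows "L.drel k 3 (\<lambda>t x. isolates (A t) (x ! 0) (x ! 1) (x ! 2))"
    and "L.drel k 1 (\<lambda>t x. \<forall>w. A t w \<longrightarrow> x ! 0 < w)"
    and "L.drel k 1 (\<lambda>t x. \<forall>w. A t w \<longrightarrow> w < x ! 0)"
  unfolding isolates_def by (intro L.dpred_intros L.dfam_comp[OF assms]; simp)+

lemma dpred_count_stable: "L.dfam k A \<Longrightarrow> L.dpred k (count_stable k A)"
  unfolding count_stable_def by (intro L.dpred_conj dpred_persistent count_stable_relations)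

lemma almost_all_count_stable: "L.dfam k A \<Longrightarrow> \<forall>\<^sub>F t in almost_all k. count_stable k A t"
  unfolding count_stable_def
  by (intro eventually_conj almost_all_persistent count_stable_relations)

definition stable_gap ::
  "nat \<Rightarrow> ('m list \<Rightarrow> 'm \<Rightarrow> bool) \<Rightarrow> 'm list \<Rightarrow> 'm \<Rightarrow> 'm \<Rightarrow> nat \<Rightarrow> bool" where
  "stable_gap k A t u v m \<longleftrightarrow> (\<exists>p q. u < p \<and> p < q \<and> q < v \<and>
    (\<forall>\<^sub>F t' in nhd k t. (\<forall>w. p \<le> w \<and> w \<le> q \<longrightarrow> \<not> A t' w) \<and> card {w. A t' w \<and> w < p} = m))"

lemma stable_gapI:
  assumes "u < p" "p < q" "q < v"
    and "\<forall>\<^sub>F t' in nhd k t. (\<forall>w. p \<le> w \<and> w \<le> q \<longrightarrow> \<not> A t' w) \<and> card {w. A t' w \<and> w < p} = m"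
  shows "stable_gap k A t u v m"
  using assms unfolding stable_gap_def by blast

lemma stable_gap_below_all:
  assumes stable: "count_stable k A t" and "u < v" and none: "\<And>w. w < v \<Longrightarrow> \<not> A t w"
  shows "stable_gap k A t u v 0"
proof -
  have above: "\<forall>w. A t w \<longrightarrow> x < w" if "x < v" for x
    using none that by (meson leI le_less_trans)
  have "persistent k 1 (\<lambda>t x. \<forall>w. A t w \<longrightarrow> x ! 0 < w) t"
    using stable by (simp add: count_stable_def)
  from persistent_interval[of k "\<lambda>t x. \<forall>w. A t w \<longrightarrow> x < w", OF this \<open>u < v\<close> above]
  obtain q where q: "u < q" "q < v" "\<forall>\<^sub>F t' in nhd k t. \<forall>w. A t' w \<longrightarrow> q < w"
    by blast
  then obtain p where p: "u < p" "p < q"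
    using dense by blast
  from p q(2) show ?thesis
  proof (rule stable_gapI)
    from q(3) show "\<forall>\<^sub>F t' in nhd k t.
        (\<forall>w. p \<le> w \<and> w \<le> q \<longrightarrow> \<not> A t' w) \<and> card {w. A t' w \<and> w < p} = 0"
    proof eventually_elim
      case (elim t')
      then have "{w. A t' w \<and> w < p} = {}"
        using p by force
      then show ?case
        using elim by (metis card.empty leD)
    qed
  qed
qed

lemma stable_gap_step:
  assumes stable: "count_stable k A t" and fin: "\<And>t. t \<in> Mn k \<Longrightarrow> finite {v. A t v}"
    and gap: "stable_gap k A t a b m" and b: "b \<le> u" "A t b" and "u < v"
    and only: "\<And>w. a < w \<Longrightarrow> w < v \<Longrightarrow> A t w \<Longrightarrow> w = b"
  shows "stable_gap k A t u v (Suc m)"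
proof -
  obtain p q where pq: "a < p" "p < q" "q < b"
    and below_b: "\<forall>\<^sub>F t' in nhd k t. (\<forall>w. p \<le> w \<and> w \<le> q \<longrightarrow> \<not> A t' w) \<and> card {w. A t' w \<and> w < p} = m"
    using gap unfolding stable_gap_def by blast
  obtain y where y: "u < y" "y < v"
    using \<open>u < v\<close> dense by blast
  have box3: "x \<in> box 3 [p, u, y] [q, y, v] \<longleftrightarrow>
      length x = 3 \<and> p < x ! 0 \<and> x ! 0 < q \<and> u < x ! 1 \<and> x ! 1 < y \<and> y < x ! 2 \<and> x ! 2 < v" for x
    by (auto simp: box_def eval_nat_numeral All_less_Suc)
  have "\<exists>x\<in>box 3 [p, u, y] [q, y, v]. \<forall>\<^sub>F t' in nhd k t. isolates (A t') (x ! 0) (x ! 1) (x ! 2)"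
  proof (rule persistent_box[of k 3 "\<lambda>t x. isolates (A t) (x ! 0) (x ! 1) (x ! 2)" t])
    show "persistent k 3 (\<lambda>t x. isolates (A t) (x ! 0) (x ! 1) (x ! 2)) t"
      using stable by (simp add: count_stable_def)
    show "isolates (A t) (x ! 0) (x ! 1) (x ! 2)" if "x \<in> box 3 [p, u, y] [q, y, v]" for x
      unfolding isolates_def
      by (intro exI[of _ b] conjI allI impI only) (use that b pq in \<open>auto simp: box3\<close>)
    show "[p, u, y] ! i < [q, y, v] ! i" if "i < 3" for i
      using that pq y by (auto simp: eval_nat_numeral less_Suc_eq)
  qed auto
  then obtain x where x: "p < x ! 0" "x ! 0 < q" "u < x ! 1" "x ! 1 < y" "y < x ! 2" "x ! 2 < v"
    and isolates: "\<forall>\<^sub>F t' in nhd k t. isolates (A t') (x ! 0) (x ! 1) (x ! 2)"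
    unfolding Bex_def box3 by blast
  then have x12: "x ! 1 < x ! 2"
    by simp
  from x(3) x12 x(6) show ?thesis
  proof (rule stable_gapI)
    from below_b isolates eventually_nhd_Mn
    show "\<forall>\<^sub>F t' in nhd k t. (\<forall>w. x ! 1 \<le> w \<and> w \<le> x ! 2 \<longrightarrow> \<not> A t' w) \<and>
        card {w. A t' w \<and> w < x ! 1} = Suc m"
    proof eventually_elim
      case (elim t')
      note isolates_imp_card_less[OF fin[OF elim(3)] elim(2) less_imp_le[OF x12] _ x(1,2)]
      then show ?case
        using elim(1) by simp
    qed
  qed
qed

lemma stable_gap:
  assumes t: "t \<in> Mn k" and stable: "count_stable k A t"
    and fin: "\<And>t. t \<in> Mn k \<Longrightarrow> finite {v. A t v}"
    and "u < v" and "\<And>w. u < w \<Longrightarrow> w < v \<Longrightarrow> \<not> A t w"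
  shows "stable_gap k A t u v (card {w. A t w \<and> w \<le> u})"
  using assms(4,5)
proof (induction "card {w. A t w \<and> w \<le> u}" arbitrary: u v)
  case 0
  have "finite {w. A t w \<and> w \<le> u}"
    using fin[OF t] by (rule rev_finite_subset) auto
  with 0(1) have "{w. A t w \<and> w \<le> u} = {}"
    by simp
  then have "\<not> A t w" if "w < v" for w
    using 0(3)[OF _ that] by (cases "w \<le> u") auto
  then show ?case
    unfolding 0(1)[symmetric] by (rule stable_gap_below_all[OF stable 0(2)])
next
  case (Suc m)
  obtain a b where ab: "a < b" "b \<le> u" "A t b" "\<And>w. a < w \<Longrightarrow> w \<le> u \<Longrightarrow> A t w \<Longrightarrow> w = b"
    and m: "m = card {w. A t w \<and> w \<le> a}"
    using finite_greatest_le[OF fin[OF t] Suc(2)[symmetric]] by metis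
  then have "\<not> A t w" if "a < w" "w < b" for w
    using that by (metis less_imp_le less_irrefl less_le_trans)
  then have gap: "stable_gap k A t a b m"
    using Suc(1)[OF m ab(1)] m by simp
  show ?case
    unfolding Suc(2)[symmetric]
  proof (rule stable_gap_step[OF stable fin gap ab(2,3) Suc.prems(1)])
    show "w = b" if "a < w" "w < v" "A t w" for w
      using ab(4) Suc.prems(2) that by (meson leI)
  qed
qed

lemma card_locally_constant:
  assumes t: "t \<in> Mn k" and stable: "count_stable k A t"
    and fin: "\<And>t. t \<in> Mn k \<Longrightarrow> finite {v. A t v}"
  shows "\<forall>\<^sub>F t' in nhd k t. card {v. A t' v} = card {v. A t v}"
proof -
  obtain u where u: "\<And>w. A t w \<Longrightarrow> w \<le> u"
    using Max_ge[OF fin[OF t]] by blast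
  obtain v where "u < v"
    using gt_ex by blast
  moreover have "\<not> A t w" if "u < w" for w
    using u that by (meson leD)
  ultimately obtain p q where pq: "u < p" "p < q"
    and below: "\<forall>\<^sub>F t' in nhd k t. (\<forall>w. p \<le> w \<and> w \<le> q \<longrightarrow> \<not> A t' w) \<and>
      card {w. A t' w \<and> w < p} = card {w. A t w \<and> w \<le> u}"
    using stable_gap[OF assms, of u v] unfolding stable_gap_def by blast
  have "persistent k 1 (\<lambda>t x. \<forall>w. A t w \<longrightarrow> w < x ! 0) t"
    using stable by (simp add: count_stable_def)
  moreover have "\<forall>w. A t w \<longrightarrow> w < x" if "p < x" for x
    using u pq that by (meson le_less_trans less_trans)
  ultimately obtain x where x: "p < x" "x < q" "\<forall>\<^sub>F t' in nhd k t. \<forall>w. A t' w \<longrightarrow> w < x"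
    using persistent_interval[of k "\<lambda>t x. \<forall>w. A t w \<longrightarrow> w < x" t p q] pq(2) by blast
  from below x(3) show ?thesis
  proof eventually_elim
    case (elim t')
    then have "w < p" if "A t' w" for w
      using that x(2) by (meson leI less_imp_le less_trans)
    then have "{w. A t' w \<and> w < p} = {w. A t' w}"
      by blast
    moreover have "{w. A t w \<and> w \<le> u} = {w. A t w}"
      using u by blast
    ultimately show ?case
      using elim(1) by simp
  qed
qed

end

context o_minimal_structure
begin

definition line_component :: "('m \<Rightarrow> bool) \<Rightarrow> nat \<Rightarrow> 'm \<Rightarrow> bool" where
  "line_component P j v \<longleftrightarrow> P v \<and> \<not> bdry P v \<and> card {w. bdry P w \<and> w < v} = j"

lemma dfam_line_component:
  assumes "dfam k P"
  shows "dfam k (\<lambda>t. line_component (P t) j)"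
  unfolding line_component_def
  by (intro dpred_intros assms dfam_bdry[OF assms] dfam_card_less_eq[OF dfam_bdry[OF assms]]
      finite_bdry dfam_section[OF assms])

lemma line_component_convex:
  assumes P: "dpred_scalar P" and u: "line_component P j u" and v: "line_component P j v"
    and w: "u \<le> w" "w \<le> v"
  shows "line_component P j w"
proof -
  have fin: "finite {x. bdry P x \<and> x < y}" for y
    using finite_bdry[OF P] by (rule rev_finite_subset) auto
  have "{x. bdry P x \<and> x < u} \<subseteq> {x. bdry P x \<and> x < v}"
    using w by auto
  then have "{x. bdry P x \<and> x < u} = {x. bdry P x \<and> x < v}"
    using u v card_subset_eq[OF fin] by (simp add: line_component_def)
  then have no_bdry: "\<not> bdry P b" if "u \<le> b" "b \<le> v" for b
    using that v unfolding line_component_def by (metis (mono_tags, lifting) le_less leD mem_Collect_eq)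
  then have "P w"
    using bdry_between[OF P w(1)] u w(2) unfolding line_component_def by (metis order_trans)
  moreover have "{x. bdry P x \<and> x < w} = {x. bdry P x \<and> x < u}"
    using no_bdry w by (metis (no_types, lifting) leI less_imp_le less_le_trans)
  ultimately show ?thesis
    using u no_bdry w by (simp add: line_component_def)
qed

lemma line_component_constant:
  fixes c :: "'m \<Rightarrow> 'a"
  assumes P: "dpred_scalar P" and levels: "\<And>i. dpred_scalar (\<lambda>v. P v \<and> c v = i)"
    and locally_constant: "\<And>v. P v \<Longrightarrow> \<exists>l r. l < v \<and> v < r \<and> (\<forall>x. l < x \<and> x < r \<and> P x \<longrightarrow> c x = c v)"
    and "line_component P j u" "line_component P j v"
  shows "c u = c v"
  using assms(4,5)
proof (induction u v rule: linorder_wlog)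
  case (le u v)
  show ?case
  proof (rule ccontr)
    assume "c u \<noteq> c v"
    then obtain b where b: "u \<le> b" "b \<le> v" and bdry_b: "bdry (\<lambda>x. P x \<and> c x = c u) b"
      using bdry_between[OF levels le(1), of "c u"] le by (auto simp: line_component_def)
    have "line_component P j b"
      using line_component_convex[OF P] le b by blast
    then have "P b" "\<not> bdry P b"
      by (simp_all add: line_component_def)
    then obtain l r where lr: "l < b" "b < r" "\<And>x. l < x \<Longrightarrow> x < r \<Longrightarrow> P x"
      using not_bdryE by metis
    obtain l' r' where lr': "l' < b" "b < r'" "\<And>x. l' < x \<Longrightarrow> x < r' \<Longrightarrow> P x \<Longrightarrow> c x = c b"
      using locally_constant[OF \<open>P b\<close>] by blast
    have "max l l' < b" "b < min r r'"
      using lr lr' by simp_all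
    then obtain x where "max l l' < x" "x < min r r'" "(P x \<and> c x = c u) \<noteq> (P b \<and> c b = c u)"
      using bdry_b unfolding bdry_def by blast
    then show False
      using lr(3)[of x] lr'(3)[of x] \<open>P b\<close> by simp
  qed
qed (simp add: eq_commute)

end

context tame_pair
begin

definition locally_constant_bounded :: "nat \<Rightarrow> bool" where
  "locally_constant_bounded k \<longleftrightarrow> (\<forall>S (c :: 'm list \<Rightarrow> nat).
    L.dset k S \<longrightarrow> (\<forall>i. L.dpred k (\<lambda>t. t \<in> S \<and> c t = i)) \<longrightarrow>
    (\<forall>t\<in>S. \<forall>\<^sub>F u in nhd k t. u \<in> S \<longrightarrow> c u = c t) \<longrightarrow>
    (\<exists>N. \<forall>\<^sub>F t in almost_all k. t \<in> S \<longrightarrow> c t \<le> N))"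

lemma uniform_finiteness_if_locally_constant_bounded:
  assumes bounded: "locally_constant_bounded k"
    and A: "L.dfam k A" and fin: "\<And>t. t \<in> Mn k \<Longrightarrow> finite {v. A t v}"
  shows "\<exists>N. \<forall>\<^sub>F t in almost_all k. card {v. A t v} \<le> N"
proof -
  define S where "S = {t \<in> Mn k. count_stable k A t}"
  have "L.dset k S"
    using dpred_count_stable[OF A] by (simp add: S_def L.dpred_def)
  moreover have "L.dpred k (\<lambda>t. t \<in> S \<and> card {v. A t v} = i)" for i
    by (intro L.dpred_conj L.dpred_mem[OF \<open>L.dset k S\<close>] L.dmap_id L.dpred_card_eq A fin)
  moreover have "\<forall>\<^sub>F u in nhd k t. u \<in> S \<longrightarrow> card {v. A u v} = card {v. A t v}" if "t \<in> S" for t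
  proof -
    have "\<forall>\<^sub>F u in nhd k t. card {v. A u v} = card {v. A t v}"
      using that by (intro card_locally_constant fin) (auto simp: S_def)
    then show ?thesis
      by eventually_elim simp
  qed
  ultimately obtain N where N: "\<forall>\<^sub>F t in almost_all k. t \<in> S \<longrightarrow> card {v. A t v} \<le> N"
    using bounded[unfolded locally_constant_bounded_def, rule_format, of S "\<lambda>t. card {v. A t v}"] by blast
  from N almost_all_count_stable[OF A] eventually_generic_mem
  have "\<forall>\<^sub>F t in almost_all k. card {v. A t v} \<le> N"
    by eventually_elim (simp add: S_def)
  then show ?thesis ..
qed

lemma locally_constant_bounded_0: "locally_constant_bounded 0"
  unfolding locally_constant_bounded_def
proof (intro allI impI)
  fix S and c :: "'m list \<Rightarrow> nat"
  have "\<forall>\<^sub>F t in almost_all 0. t \<in> S \<longrightarrow> c t \<le> c []"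
    using eventually_generic_mem by eventually_elim simp
  then show "\<exists>N. \<forall>\<^sub>F t in almost_all 0. t \<in> S \<longrightarrow> c t \<le> N" ..
qed

context
  fixes k :: nat and S :: "'m list set" and c :: "'m list \<Rightarrow> nat"
  assumes S: "L.dset (Suc k) S"
    and levels: "\<And>i. L.dpred (Suc k) (\<lambda>z. z \<in> S \<and> c z = i)"
    and locally_constant: "\<And>z. z \<in> S \<Longrightarrow> \<forall>\<^sub>F u in nhd (Suc k) z. u \<in> S \<longrightarrow> c u = c z"
begin

definition component :: "nat \<Rightarrow> 'm list \<Rightarrow> 'm \<Rightarrow> bool" where
  "component j t = L.line_component (\<lambda>v. t @ [v] \<in> S) j"

lemma dfam_fibre: "L.dfam k (\<lambda>t v. t @ [v] \<in> S)"
  by (intro L.dpred_mem[OF S] L.dmap_intros)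

lemma dfam_component: "L.dfam k (component j)"
  unfolding component_def by (intro L.dfam_line_component dfam_fibre)

lemma component_mem: "component j t v \<Longrightarrow> t @ [v] \<in> S"
  by (simp add: component_def L.line_component_def)

lemma dfam_levels: "L.dfam k (\<lambda>t v. t @ [v] \<in> S \<and> c (t @ [v]) = i)"
  using levels[of i] by (rule L.dpred_congI) (simp add: snoc_split)

lemma fibre_locally_constant:
  assumes "t @ [v] \<in> S" "t \<in> Mn k"
  obtains l r where "l < v" "v < r"
    "\<forall>\<^sub>F u in nhd k t. \<forall>w\<in>{l<..<r}. u @ [w] \<in> S \<longrightarrow> c (u @ [w]) = c (t @ [v])"
  using eventually_nhd_snoc[OF locally_constant[OF assms(1)] assms(2)] by blast

lemma component_value_unique:
  assumes t: "t \<in> Mn k" and "component j t u" "component j t v"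
  shows "c (t @ [u]) = c (t @ [v])"
proof (rule L.line_component_constant[OF L.dfam_section[OF dfam_fibre t]
      L.dfam_section[OF dfam_levels t] _ assms(2,3)[unfolded component_def]])
  show "\<exists>l r. l < v \<and> v < r \<and> (\<forall>x. l < x \<and> x < r \<and> t @ [x] \<in> S \<longrightarrow> c (t @ [x]) = c (t @ [v]))"
    if v: "t @ [v] \<in> S" for v
  proof -
    obtain l r where "l < v" "v < r"
      and "\<forall>\<^sub>F u in nhd k t. \<forall>w\<in>{l<..<r}. u @ [w] \<in> S \<longrightarrow> c (u @ [w]) = c (t @ [v])"
      using fibre_locally_constant[OF v t] by blast
    from this(1,2) eventually_nhd_self[OF this(3) t] show ?thesis
      by (intro exI[of _ l] exI[of _ r]) simp
  qed
qed

definition component_value :: "nat \<Rightarrow> 'm list \<Rightarrow> nat" where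
  "component_value j t = c (t @ [SOME v. component j t v])"

lemma component_value_eq:
  assumes "t \<in> Mn k" "component j t v"
  shows "component_value j t = c (t @ [v])"
  unfolding component_value_def
  by (rule component_value_unique[OF assms(1) someI[of "component j t", OF assms(2)] assms(2)])

definition persistent_base :: "nat \<Rightarrow> 'm list set" where
  "persistent_base j = {t \<in> Mn k. \<exists>v. component j t v \<and> (\<forall>\<^sub>F u in nhd k t. component j u v)}"

lemma dset_persistent_base: "L.dset k (persistent_base j)"
  unfolding persistent_base_def L.dpred_def[symmetric]
  by (intro L.dpred_ex1 L.dpred_conj dfam_component L.dpred_eventually_nhd
      L.dfam_comp[OF dfam_component] L.dpred_intros) simp_all

lemma dpred_component_value: "L.dpred k (\<lambda>t. t \<in> persistent_base j \<and> component_value j t = i)"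
proof (rule L.dpred_congI)
  show "L.dpred k (\<lambda>t. t \<in> persistent_base j \<and>
      (\<exists>v. component j t v \<and> t @ [v] \<in> S \<and> c (t @ [v]) = i))"
    by (intro L.dpred_conj[OF L.dpred_mem[OF dset_persistent_base L.dmap_id]] L.dpred_ex1
        L.dpred_conj[OF dfam_component] dfam_levels)
  have "component_value j t = i \<longleftrightarrow> (\<exists>v. component j t v \<and> t @ [v] \<in> S \<and> c (t @ [v]) = i)"
    if t: "t \<in> persistent_base j" for t
  proof -
    obtain v where "t \<in> Mn k" "component j t v"
      using t unfolding persistent_base_def by blast
    then show ?thesis
      using component_value_eq component_mem by metis
  qed
  then show "t \<in> persistent_base j \<and> component_value j t = i \<longleftrightarrow>
      t \<in> persistent_base j \<and> (\<exists>v. component j t v \<and> t @ [v] \<in> S \<and> c (t @ [v]) = i)" for t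
    by blast
qed

lemma component_value_locally_constant:
  assumes "t \<in> persistent_base j"
  shows "\<forall>\<^sub>F u in nhd k t. component_value j u = component_value j t"
proof -
  obtain v where t: "t \<in> Mn k" and v: "component j t v" and persists: "\<forall>\<^sub>F u in nhd k t. component j u v"
    using assms unfolding persistent_base_def by blast
  obtain l r where "l < v" "v < r"
    and "\<forall>\<^sub>F u in nhd k t. \<forall>w\<in>{l<..<r}. u @ [w] \<in> S \<longrightarrow> c (u @ [w]) = c (t @ [v])"
    using fibre_locally_constant[OF component_mem[OF v] t] by blast
  from this(3) persists eventually_nhd_Mn show ?thesis
    by eventually_elim
      (use \<open>l < v\<close> \<open>v < r\<close> component_value_eq component_mem t v in \<open>auto simp del: mem_Mn\<close>)
qed

lemma persistent_component_bounded:
  assumes bounded: "locally_constant_bounded k"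
  shows "\<exists>N. \<forall>\<^sub>F t in almost_all k. \<forall>v. component j t v \<longrightarrow>
    (\<forall>\<^sub>F u in nhd k t. component j u v) \<longrightarrow> c (t @ [v]) \<le> N"
proof -
  have "\<forall>\<^sub>F u in nhd k t. u \<in> persistent_base j \<longrightarrow> component_value j u = component_value j t"
    if "t \<in> persistent_base j" for t
    using component_value_locally_constant[OF that] by eventually_elim simp
  then obtain N where "\<forall>\<^sub>F t in almost_all k. t \<in> persistent_base j \<longrightarrow> component_value j t \<le> N"
    using bounded dset_persistent_base dpred_component_value
    unfolding locally_constant_bounded_def by blast
  then have "\<forall>\<^sub>F t in almost_all k. \<forall>v. component j t v \<longrightarrow>
      (\<forall>\<^sub>F u in nhd k t. component j u v) \<longrightarrow> c (t @ [v]) \<le> N"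
    using eventually_generic_mem
    by eventually_elim (use component_value_eq in \<open>auto simp: persistent_base_def simp del: mem_Mn\<close>)
  then show ?thesis ..
qed

lemma component_bounded:
  assumes "locally_constant_bounded k"
  shows "\<exists>N. \<forall>\<^sub>F t in almost_all k. finite {v. component j t v \<and> N < c (t @ [v])}"
proof -
  obtain N where "\<forall>\<^sub>F t in almost_all k. \<forall>v. component j t v \<longrightarrow>
      (\<forall>\<^sub>F u in nhd k t. component j u v) \<longrightarrow> c (t @ [v]) \<le> N"
    using persistent_component_bounded[OF assms] by blast
  with almost_all_finite_nonpersistent[OF dfam_component[of j]]
  have "\<forall>\<^sub>F t in almost_all k. finite {v. component j t v \<and> N < c (t @ [v])}"
  proof eventually_elim
    case (elim t)
    from elim(1) show ?case
      by (rule rev_finite_subset) (use elim(2) in \<open>auto simp: not_le[symmetric]\<close>)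
  qed
  then show ?thesis ..
qed

lemma components_bounded:
  assumes "locally_constant_bounded k"
  shows "\<exists>N. \<forall>\<^sub>F t in almost_all k. finite {v. \<exists>j\<le>M. component j t v \<and> N < c (t @ [v])}"
proof -
  have "\<forall>j. \<exists>N. \<forall>\<^sub>F t in almost_all k. finite {v. component j t v \<and> N < c (t @ [v])}"
    using component_bounded[OF assms] by blast
  from choice[OF this]
  obtain N where N: "\<And>j. \<forall>\<^sub>F t in almost_all k. finite {v. component j t v \<and> N j < c (t @ [v])}"
    by blast
  define bound where "bound = Max (N ` {..M})"
  have bound: "N j \<le> bound" if "j \<le> M" for j
    using that by (simp add: bound_def)
  have "\<forall>\<^sub>F t in almost_all k. \<forall>j\<in>{..M}. finite {v. component j t v \<and> N j < c (t @ [v])}"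
    using N by (intro eventually_ball_finite) simp_all
  then have "\<forall>\<^sub>F t in almost_all k. finite {v. \<exists>j\<le>M. component j t v \<and> bound < c (t @ [v])}"
  proof eventually_elim
    case (elim t)
    then have "finite (\<Union>j\<in>{..M}. {v. component j t v \<and> N j < c (t @ [v])})"
      by simp
    then show ?case
      by (rule rev_finite_subset) (use bound le_less_trans in blast)
  qed
  then show ?thesis ..
qed

lemma component_exists:
  assumes t: "t \<in> Mn k" and "t @ [v] \<in> S" "\<not> bdry (\<lambda>v. t @ [v] \<in> S) v"
  shows "\<exists>j\<le>card {v. bdry (\<lambda>v. t @ [v] \<in> S) v}. component j t v"
proof -
  let ?B = "{v. bdry (\<lambda>v. t @ [v] \<in> S) v}" and ?j = "card {w. bdry (\<lambda>v. t @ [v] \<in> S) w \<and> w < v}"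
  have "?j \<le> card ?B"
    by (intro card_mono L.finite_bdry L.dfam_section[OF dfam_fibre t]) auto
  moreover have "component ?j t v"
    using assms(2,3) by (simp add: component_def L.line_component_def)
  ultimately show ?thesis
    by blast
qed

lemma bounded_on_fibres:
  assumes bounded: "locally_constant_bounded k"
  shows "\<exists>N. \<forall>\<^sub>F t in almost_all k. finite {v. t @ [v] \<in> S \<and> N < c (t @ [v])}"
proof -
  let ?B = "\<lambda>t. bdry (\<lambda>v. t @ [v] \<in> S)"
  have fin_B: "finite {v. ?B t v}" if "t \<in> Mn k" for t
    by (intro L.finite_bdry L.dfam_section[OF dfam_fibre that])
  obtain M where M: "\<forall>\<^sub>F t in almost_all k. card {v. ?B t v} \<le> M"
    using uniform_finiteness_if_locally_constant_bounded[OF bounded L.dfam_bdry[OF dfam_fibre] fin_B]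
    by blast
  obtain N where "\<forall>\<^sub>F t in almost_all k. finite {v. \<exists>j\<le>M. component j t v \<and> N < c (t @ [v])}"
    using components_bounded[OF bounded] by blast
  with M eventually_generic_mem
  have "\<forall>\<^sub>F t in almost_all k. finite {v. t @ [v] \<in> S \<and> N < c (t @ [v])}"
  proof eventually_elim
    case (elim t)
    have "finite ({v. ?B t v} \<union> {v. \<exists>j\<le>M. component j t v \<and> N < c (t @ [v])})"
      using fin_B elim(2,3) by blast
    then show ?case
      by (rule rev_finite_subset) (use component_exists[OF elim(2)] elim(1) order_trans in blast)
  qed
  then show ?thesis ..
qed

lemma bounded_on_total_space:
  assumes "locally_constant_bounded k"
  shows "\<exists>N. \<forall>\<^sub>F z in almost_all (Suc k). z \<in> S \<longrightarrow> c z \<le> N"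
proof -
  obtain N where N: "\<forall>\<^sub>F t in almost_all k. finite {v. t @ [v] \<in> S \<and> N < c (t @ [v])}"
    using bounded_on_fibres[OF assms] by blast
  have "L.dfam k (\<lambda>t v. t @ [v] \<in> S \<longrightarrow> c (t @ [v]) \<le> N)"
  proof (rule L.dpred_congI)
    show "L.dfam k (\<lambda>t v. t @ [v] \<in> S \<longrightarrow> (\<exists>i\<in>{..N}. t @ [v] \<in> S \<and> c (t @ [v]) = i))"
      by (intro L.dpred_imp dfam_fibre L.dpred_bex_finite dfam_levels) simp
  qed auto
  then have "\<forall>\<^sub>F z in almost_all (Suc k). take k z @ [z ! k] \<in> S \<longrightarrow> c (take k z @ [z ! k]) \<le> N"
    using N by (intro almost_all_Suc_if_finite_fibres) (simp_all only: not_imp not_le)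
  then have "\<forall>\<^sub>F z in almost_all (Suc k). z \<in> S \<longrightarrow> c z \<le> N"
    using eventually_generic_mem by eventually_elim (simp only: snoc_split)
  then show ?thesis ..
qed

end

lemma locally_constant_bounded: "locally_constant_bounded k"
proof (induction k)
  case (Suc k)
  show ?case
    unfolding locally_constant_bounded_def using bounded_on_total_space Suc by blast
qed (rule locally_constant_bounded_0)

lemma uniform_finiteness:
  assumes "L.dfam k A" "\<And>t. t \<in> Mn k \<Longrightarrow> finite {v. A t v}"
  shows "\<exists>N. \<forall>\<^sub>F t in almost_all k. card {v. A t v} \<le> N"
  by (rule uniform_finiteness_if_locally_constant_bounded[OF locally_constant_bounded assms])

end

section \<open>Approximation on sets of smaller dimension\<close>

lemma card_less_inj:
  fixes v w :: "'a::linorder"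
  assumes "finite S" "v \<in> S" "w \<in> S" "card {x \<in> S. x < v} = card {x \<in> S. x < w}"
  shows "v = w"
proof -
  have less: "card {z \<in> S. z < x} < card {z \<in> S. z < y}" if "x \<in> S" "x < y" for x y
    using assms(1) that by (intro psubset_card_mono) (auto intro: less_trans)
  show ?thesis
    using less[of v w] less[of w v] assms(2-4) by (cases v w rule: linorder_cases) auto
qed

context tame_pair
begin

lemma small_finite_to_one:
  assumes X: "N.dset n X" and f: "N.dmap n f" "\<And>x. x \<in> Mn n \<Longrightarrow> f x \<in> Mn k"
    and fin: "\<And>t. t \<in> Mn k \<Longrightarrow> finite {x \<in> X. f x = t}" and E: "small k d E"
  shows "small n d {x \<in> X. f x \<in> E}"
proof -
  obtain E' where E': "N.dset k E'" "E \<subseteq> E'" "dimf E' < ereal (real d)"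
    using E by (auto simp: small_def)
  define P where "P t x \<longleftrightarrow> t \<in> E' \<and> x \<in> X \<and> f x = t" for t x
  have P: "N.drel k n P"
    unfolding P_def
    by (intro N.dpred_intros N.dpred_mem[OF E'(1)] N.dpred_mem[OF X] N.dmap_comp[OF f(1)]) simp
  have small_E': "small k d {t \<in> Mn k. Q t}" if "\<And>t. Q t \<Longrightarrow> t \<in> E'" for Q
    using E' small_iff_dim by (blast intro: small_subset that)
  have "small (k + n) (d + 0) (rel_set k n P)"
  proof (rule small_if_small_fibres[OF P])
    have "small k d {t \<in> Mn k. fibre n P t \<noteq> {}}"
      by (rule small_E') (auto simp: P_def)
    then show "small k (Suc d) {t \<in> Mn k. fibre n P t \<noteq> {}}"
      by (rule small_mono) simp
    show "small n (Suc 0) (fibre n P t)" if "t \<in> Mn k" for t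
    proof -
      have "finite (fibre n P t)"
        using fin[OF that] by (rule rev_finite_subset) (auto simp: P_def)
      then show ?thesis
        unfolding One_nat_def[symmetric] by (rule small_finite) blast
    qed
    show "small k d {t \<in> Mn k. \<not> small n 0 (fibre n P t)}"
      by (rule small_E') (auto simp: small_0_iff P_def)
  qed
  then have "small (k + n) d (rel_set k n P)"
    by simp
  then have "small n d {x \<in> X. f x @ x \<in> rel_set k n P}"
    using X f N.dset_length[OF X] by (intro small_inj) (auto simp: inj_on_def intro: N.dmap_intros)
  then show ?thesis
    by (rule small_subset) (use f(2) N.dset_length[OF X] E'(2) in \<open>auto simp: P_def\<close>)
qed

definition piece :: "nat \<Rightarrow> nat \<Rightarrow> 'm list set \<Rightarrow> bool" where
  "piece d n W \<longleftrightarrow> L.dset n W \<and>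
    (\<exists>\<phi>. L.dmap n \<phi> \<and> (\<forall>x\<in>Mn n. \<phi> x \<in> Mn d) \<and> inj_on \<phi> W)"

lemma piece_dset: "piece d n W \<Longrightarrow> L.dset n W"
  by (simp add: piece_def)

context
  fixes n k :: nat and \<phi> :: "'m list \<Rightarrow> 'm list"
  assumes \<phi>: "L.dmap n \<phi>" "\<And>x. x \<in> Mn n \<Longrightarrow> \<phi> x \<in> Mn k"
begin

lemma drel_fibre: "L.dset n V \<Longrightarrow> L.drel k n (\<lambda>t x. x \<in> V \<and> \<phi> x = t)"
  by (intro L.dpred_intros L.dpred_mem[of n V] L.dmap_comp[OF \<phi>(1)]) simp_all

lemma fibre_eq: "L.dset n V \<Longrightarrow> {x \<in> Mn n. x \<in> V \<and> \<phi> x = t} = {x \<in> V. \<phi> x = t}"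
  using L.dset_Mn_subset by blast

lemma finite_fibre_iff:
  assumes "L.dset n V" "t \<in> Mn k"
  shows "finite {x \<in> V. \<phi> x = t} \<longleftrightarrow> small n 1 {x \<in> Mn n. x \<in> V \<and> \<phi> x = t}"
  using small_1_iff_finite[OF L.dset_section[OF drel_fibre[OF assms(1)] assms(2)]]
  by (simp only: fibre_eq[OF assms(1)])

lemma dpred_finite_fibre:
  assumes "L.dset n V"
  shows "L.dpred k (\<lambda>t. finite {x \<in> V. \<phi> x = t})"
  using L_dpred_small[OF drel_fibre[OF assms]] by (rule L.dpred_congI) (rule finite_fibre_iff[OF assms])

lemma almost_all_finite_fibre:
  assumes V: "L.dset n V" and small: "small n (Suc k) V"
  shows "\<forall>\<^sub>F t in almost_all k. finite {x \<in> V. \<phi> x = t}"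
proof -
  let ?P = "\<lambda>t x. x \<in> V \<and> \<phi> x = t"
  have P: "N.drel k n ?P"
    by (intro dpred_LN drel_fibre V)
  have "small (k + n) (Suc k) {z \<in> rel_set k n ?P. drop k z \<in> V}"
    by (rule small_inj[OF P[unfolded N.dpred_def] _ _ _ small])
      (auto intro: N.dmap_intros simp: inj_on_def, metis append_take_drop_id)
  then have "small (k + n) (k + 1) (rel_set k n ?P)"
    unfolding Suc_eq_plus1 by (rule small_subset) auto
  then have "small k k {t \<in> Mn k. \<not> small n 1 {x \<in> Mn n. ?P t x}}"
    by (rule small_fibres_if_small[OF P])
  then show ?thesis
    unfolding eventually_generic by (rule small_subset) (use finite_fibre_iff[OF V] in auto)
qed

(* The points of a fibre are told apart by the ranks of their coordinates among the coordinates of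
   all points of the fibre; uniform finiteness bounds these ranks. *)
definition coord_values :: "'m list set \<Rightarrow> nat \<Rightarrow> 'm list \<Rightarrow> 'm \<Rightarrow> bool" where
  "coord_values B i t v \<longleftrightarrow> (\<exists>x\<in>Mn n. x \<in> B \<and> \<phi> x = t \<and> x ! i = v)"

definition ranks :: "'m list set \<Rightarrow> 'm list \<Rightarrow> nat list" where
  "ranks B x = map (\<lambda>i. card {v. coord_values B i (\<phi> x) v \<and> v < x ! i}) [0..<n]"

context
  fixes B :: "'m list set"
  assumes B: "L.dset n B" and fin: "\<And>t. t \<in> Mn k \<Longrightarrow> finite {x \<in> B. \<phi> x = t}"
begin

lemma dfam_coord_values: "L.dfam k (coord_values B i)"
  unfolding coord_values_def
  by (intro L.dpred_intros L.dpred_mem[OF B] L.dmap_comp[OF \<phi>(1)]) simp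

lemma finite_coord_values:
  assumes "t \<in> Mn k"
  shows "finite {v. coord_values B i t v}"
proof -
  have "{v. coord_values B i t v} \<subseteq> (\<lambda>x. x ! i) ` {x \<in> B. \<phi> x = t}"
    by (auto simp: coord_values_def)
  then show ?thesis
    using fin[OF assms] finite_surj by blast
qed

lemma coord_values_nth: "x \<in> B \<Longrightarrow> coord_values B i (\<phi> x) (x ! i)"
  using L.dset_length[OF B] by (auto simp: coord_values_def)

lemma piece_ranks: "piece k n {x \<in> B. ranks B x = r}"
  unfolding piece_def
proof (intro conjI exI[of _ \<phi>] ballI \<phi> L.dset_Collect B)
  have "L.dpred n (\<lambda>x. length r = n \<and> (\<forall>i<n. card {v. coord_values B i (\<phi> x) v \<and> v < x ! i} = r ! i))"
  proof (intro L.dpred_conj L.dpred_const L.dpred_all_less)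
    show "L.dpred n (\<lambda>x. card {v. coord_values B i (\<phi> x) v \<and> v < x ! i} = r ! i)" for i
      by (rule L.dfam_comp[OF L.dfam_card_less_eq[OF dfam_coord_values finite_coord_values] \<phi>(1)])
        (auto intro: L.dmap_intros \<phi>(2) simp del: mem_Mn)
  qed
  then show "L.dpred n (\<lambda>x. ranks B x = r)"
    by (rule L.dpred_congI) (auto simp: ranks_def list_eq_iff_nth_eq)
  show "inj_on \<phi> {x \<in> B. ranks B x = r}"
  proof (rule inj_onI)
    fix x y assume xy: "x \<in> {x \<in> B. ranks B x = r}" "y \<in> {x \<in> B. ranks B x = r}" "\<phi> x = \<phi> y"
    have "x ! i = y ! i" if "i < n" for i
    proof (rule card_less_inj[OF finite_coord_values])
      show "\<phi> x \<in> Mn k"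
        using xy(1) L.dset_length[OF B] \<phi>(2) by simp
      show "x ! i \<in> {v. coord_values B i (\<phi> x) v}" "y ! i \<in> {v. coord_values B i (\<phi> x) v}"
        using xy coord_values_nth[of x i] coord_values_nth[of y i] by simp_all
      have "ranks B x ! i = ranks B y ! i"
        using xy by simp
      then show "card {v \<in> {v. coord_values B i (\<phi> x) v}. v < x ! i} =
          card {v \<in> {v. coord_values B i (\<phi> x) v}. v < y ! i}"
        using that xy(3) by (simp add: ranks_def)
    qed
    then show "x = y"
      using xy L.dset_length[OF B] by (auto simp: list_eq_iff_nth_eq)
  qed
qed

lemma coord_values_bounded:
  "\<exists>M. \<forall>\<^sub>F t in almost_all k. \<forall>i\<in>{..<n}. card {v. coord_values B i t v} \<le> M"
proof -
  have "\<forall>i. \<exists>N. \<forall>\<^sub>F t in almost_all k. card {v. coord_values B i t v} \<le> N"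
    using uniform_finiteness[OF dfam_coord_values finite_coord_values] by blast
  from choice[OF this]
  obtain N where N: "\<And>i. \<forall>\<^sub>F t in almost_all k. card {v. coord_values B i t v} \<le> N i"
    by blast
  have "\<forall>\<^sub>F t in almost_all k. \<forall>i\<in>{..<n}. card {v. coord_values B i t v} \<le> N i"
    using N by (intro eventually_ball_finite) simp_all
  then have "\<forall>\<^sub>F t in almost_all k. \<forall>i\<in>{..<n}. card {v. coord_values B i t v} \<le> Max (N ` {..<n})"
    by eventually_elim (meson Max_ge finite_imageI finite_lessThan imageI order_trans)
  then show ?thesis ..
qed

lemma ranks_bounded:
  assumes "x \<in> B" and "\<And>i. i < n \<Longrightarrow> card {v. coord_values B i (\<phi> x) v} \<le> M"
  shows "ranks B x \<in> {r. set r \<subseteq> {..M} \<and> length r = n}"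
proof -
  have "card {v. coord_values B i (\<phi> x) v \<and> v < x ! i} \<le> M" if "i < n" for i
  proof -
    have "\<phi> x \<in> Mn k"
      using assms(1) L.dset_length[OF B] \<phi>(2) by simp
    then have "card {v. coord_values B i (\<phi> x) v \<and> v < x ! i} \<le> card {v. coord_values B i (\<phi> x) v}"
      by (intro card_mono finite_coord_values) auto
    also have "\<dots> \<le> M"
      using that by (rule assms(2))
    finally show ?thesis .
  qed
  then show ?thesis
    by (auto simp: ranks_def)
qed

lemma finite_to_one_pieces:
  "\<exists>\<W>. finite \<W> \<and> (\<forall>W\<in>\<W>. piece k n W \<and> W \<subseteq> B) \<and> small n k (B - \<Union>\<W>)"
proof -
  obtain M where M: "\<forall>\<^sub>F t in almost_all k. \<forall>i\<in>{..<n}. card {v. coord_values B i t v} \<le> M"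
    using coord_values_bounded by blast
  define E where "E = {t \<in> Mn k. \<not> (\<forall>i\<in>{..<n}. card {v. coord_values B i t v} \<le> M)}"
  define \<W> where "\<W> = (\<lambda>r. {x \<in> B. ranks B x = r}) ` {r. set r \<subseteq> {..M} \<and> length r = n}"
  have "finite \<W>"
    unfolding \<W>_def by (intro finite_imageI finite_lists_length_eq) simp
  moreover have "\<forall>W\<in>\<W>. piece k n W \<and> W \<subseteq> B"
    unfolding \<W>_def using piece_ranks by blast
  moreover have "small n k (B - \<Union>\<W>)"
  proof (rule small_subset)
    have small_E: "small k k E"
      using M by (simp only: eventually_generic E_def)
    show "small n k {x \<in> B. \<phi> x \<in> E}"
      by (rule small_finite_to_one[OF dset_LN[OF B] dmap_LN[OF \<phi>(1)] _ _ small_E]) (fact \<phi>(2) fin)+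
    show "B - \<Union>\<W> \<subseteq> {x \<in> B. \<phi> x \<in> E}"
    proof
      fix x assume x: "x \<in> B - \<Union>\<W>"
      then have "ranks B x \<notin> {r. set r \<subseteq> {..M} \<and> length r = n}"
        unfolding \<W>_def by blast
      then have "\<not> (\<forall>i\<in>{..<n}. card {v. coord_values B i (\<phi> x) v} \<le> M)"
        using ranks_bounded x by blast
      then show "x \<in> {x \<in> B. \<phi> x \<in> E}"
        using x \<phi>(2) L.dset_length[OF B] by (simp add: E_def)
    qed
  qed
  ultimately show ?thesis
    by blast
qed

end

end

definition finite_projection :: "nat set \<Rightarrow> 'm list set \<Rightarrow> 'm list set" where
  "finite_projection s V = {x \<in> V. finite {y \<in> V. nths y s = nths x s}}"

context
  fixes n k :: nat and V :: "'m list set" and s :: "nat set"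
  assumes V: "L.dset n V" and s: "s \<subseteq> {..<n}" "card s = k"
begin

lemma nths_map: "L.dmap n (\<lambda>x. nths x s)" "x \<in> Mn n \<Longrightarrow> nths x s \<in> Mn k"
  using L.dmap_nths[OF L.dmap_id] nths_mem_Mn s by blast+

lemma dset_finite_projection: "L.dset n (finite_projection s V)"
  unfolding finite_projection_def
  by (intro L.dset_Collect V L.dpred_comp[OF dpred_finite_fibre[OF nths_map V]] nths_map)

lemma finite_projection_pieces:
  "\<exists>\<W>. finite \<W> \<and> (\<forall>W\<in>\<W>. piece k n W \<and> W \<subseteq> finite_projection s V) \<and>
    small n k (finite_projection s V - \<Union>\<W>)"
proof (rule finite_to_one_pieces[OF nths_map dset_finite_projection])
  fix t
  have "{x \<in> finite_projection s V. nths x s = t} =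
      (if finite {y \<in> V. nths y s = t} then {y \<in> V. nths y s = t} else {})"
    by (auto simp: finite_projection_def)
  then show "finite {x \<in> finite_projection s V. nths x s = t}"
    by (simp only: finite.emptyI split: if_split) blast
qed

lemma not_open_projection_infinite_fibres:
  assumes "small n (Suc k) V"
  shows "\<not> open_projection s (V - finite_projection s V)"
proof -
  let ?T = "{t \<in> Mn k. \<not> finite {y \<in> V. nths y s = t}}"
  have "L.dset k ?T"
    using L.dpred_not[OF dpred_finite_fibre[OF nths_map V]] by (simp only: L.dpred_def)
  moreover have "small k k ?T"
    using almost_all_finite_fibre[OF nths_map V assms] by (simp only: eventually_generic)
  ultimately have "\<not> nonempty_interior k ?T"
    using small_full_iff by blast
  moreover have "(\<lambda>x. nths x s) ` (V - finite_projection s V) \<subseteq> ?T"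
    using nths_map(2) L.dset_Mn_subset[OF V] unfolding finite_projection_def by blast
  ultimately show ?thesis
    using nonempty_interior_mono s(2) by blast
qed

end

lemma small_off_finite_projections:
  assumes V: "L.dset n V" and small: "small n (Suc k) V"
  shows "small n k (V - (\<Union>s\<in>{s. s \<subseteq> {..<n} \<and> card s = k}. finite_projection s V))"
    (is "small n k (V - ?U)")
proof -
  have "L.dset n ?U"
    by (intro L.dset_UN_finite dset_finite_projection[OF V]) auto
  then have "L.dset n (V - ?U)"
    by (rule L.dset_Diff[OF V])
  then show ?thesis
  proof (rule small_iff_projections[THEN iffD2], intro allI impI)
    fix s assume s: "s \<subseteq> {..<n}" "k \<le> card s"
    show "\<not> open_projection s (V - ?U)"
    proof (cases "card s = k")
      case True
      then have "V - ?U \<subseteq> V - finite_projection s V"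
        using s(1) by blast
      then show ?thesis
        using not_open_projection_infinite_fibres[OF V s(1) True small] open_projection_mono by blast
    next
      case False
      then have "Suc k \<le> card s"
        using s(2) by simp
      then have "\<not> open_projection s V"
        using small s(1) small_iff_projections[OF V] by blast
      then show ?thesis
        using open_projection_mono Diff_subset by blast
    qed
  qed
qed

lemma piece_decomposition:
  assumes V: "L.dset n V" and small: "small n (Suc k) V"
  shows "\<exists>\<W>. finite \<W> \<and> (\<forall>W\<in>\<W>. piece k n W \<and> W \<subseteq> V) \<and> small n k (V - \<Union>\<W>)"
proof -
  define I where "I = {s. s \<subseteq> {..<n} \<and> card s = k}"
  have I: "finite I"
    by (simp add: I_def)
  have "\<forall>s\<in>I. \<exists>\<W>. finite \<W> \<and> (\<forall>W\<in>\<W>. piece k n W \<and> W \<subseteq> finite_projection s V) \<and>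
      small n k (finite_projection s V - \<Union>\<W>)"
    using finite_projection_pieces[OF V] by (simp add: I_def)
  from bchoice[OF this] obtain \<W> where choice: "\<forall>s\<in>I. finite (\<W> s) \<and>
      (\<forall>W\<in>\<W> s. piece k n W \<and> W \<subseteq> finite_projection s V) \<and>
      small n k (finite_projection s V - \<Union>(\<W> s))"
    by blast
  then have small_rest: "\<And>s. s \<in> I \<Longrightarrow> small n k (finite_projection s V - \<Union>(\<W> s))"
    by blast
  have "small n k ((V - (\<Union>s\<in>I. finite_projection s V)) \<union>
      (\<Union>s\<in>I. finite_projection s V - \<Union>(\<W> s)))"
    unfolding I_def
    by (intro small_Un small_off_finite_projections[OF V small] small_UN_finite I[unfolded I_def]
        small_rest[unfolded I_def])
  then have "small n k (V - \<Union>(\<Union>s\<in>I. \<W> s))"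
    by (rule small_subset) blast
  moreover have "finite (\<Union>s\<in>I. \<W> s)"
    using I choice by blast
  moreover have "\<forall>W\<in>(\<Union>s\<in>I. \<W> s). piece k n W \<and> W \<subseteq> V"
    using choice unfolding finite_projection_def by blast
  ultimately show ?thesis
    by blast
qed

lemma D6_map:
  assumes "N.dmap n f" "\<And>x. x \<in> Mn n \<Longrightarrow> f x \<in> Mn m"
  shows "\<exists>F. L.dmap n F \<and> (\<forall>x\<in>Mn n. F x \<in> Mn m) \<and> (\<forall>\<^sub>F x in almost_all n. f x = F x)"
  using assms
proof (induction m arbitrary: f)
  case 0
  have "\<forall>\<^sub>F x in almost_all n. f x = []"
    using eventually_generic_mem by eventually_elim (use 0(2) in simp)
  then show ?case
    using L.dmap_const[of n "[]"] by (intro exI[of _ "\<lambda>_. []"]) simp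
next
  case (Suc m)
  have "N.dmap n (\<lambda>x. take m (f x))" "take m (f x) \<in> Mn m" if "x \<in> Mn n" for x
    using Suc.prems that by (auto intro: N.dmap_take)
  then obtain F1 where F1: "L.dmap n F1" "\<forall>x\<in>Mn n. F1 x \<in> Mn m"
    "\<forall>\<^sub>F x in almost_all n. take m (f x) = F1 x"
    using Suc.IH[of "\<lambda>x. take m (f x)"] Suc.prems by (auto intro: N.dmap_take)
  obtain F2 E where F2: "L.dfun n F2" "N.dset n E" "dimf E < ereal (real n)"
    "\<And>x. x \<in> Mn n \<Longrightarrow> x \<notin> E \<Longrightarrow> f x ! m = F2 x"
    using D6[OF N.dmap_nth[OF Suc.prems(1), of m]] by metis
  have "\<forall>\<^sub>F x in almost_all n. f x ! m = F2 x"
    unfolding eventually_generic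
    by (rule small_subset[of n n E]) (use F2 small_iff_dim in auto)
  with F1(3) eventually_generic_mem have "\<forall>\<^sub>F x in almost_all n. f x = F1 x @ [F2 x]"
    by eventually_elim (metis Suc.prems(2) snoc_split)
  moreover have "L.dmap n (\<lambda>x. F1 x @ [F2 x])"
    by (intro L.dmap_append F1 F2)
  ultimately show ?case
    using F1(2) by (intro exI[of _ "\<lambda>x. F1 x @ [F2 x]"]) simp
qed

lemma approximation_on_piece:
  assumes W: "piece d n W" and f: "N.dmap n f" "\<And>x. x \<in> Mn n \<Longrightarrow> f x \<in> Mn m"
  shows "\<exists>F. L.dmap n F \<and> (\<forall>x\<in>Mn n. F x \<in> Mn m) \<and> (\<forall>\<^sub>F x in generic n d W. f x = F x)"
proof -
  obtain \<phi> where \<phi>: "L.dset n W" "L.dmap n \<phi>" "\<And>x. x \<in> Mn n \<Longrightarrow> \<phi> x \<in> Mn d" "inj_on \<phi> W"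
    using W by (auto simp: piece_def)
  obtain \<psi> where \<psi>: "L.dmap d \<psi>" "\<And>y. y \<in> Mn d \<Longrightarrow> \<psi> y \<in> Mn n" "\<And>x. x \<in> W \<Longrightarrow> \<psi> (\<phi> x) = x"
    using L.definable_left_inverse[OF \<phi>] by metis
  obtain F where F: "L.dmap d F" "\<forall>y\<in>Mn d. F y \<in> Mn m" "\<forall>\<^sub>F y in almost_all d. f (\<psi> y) = F y"
    using D6_map[of d "\<lambda>y. f (\<psi> y)" m] N.dmap_comp[OF f(1) dmap_LN[OF \<psi>(1)] \<psi>(2)] f(2) \<psi>(2) by blast
  have "\<forall>\<^sub>F x in generic n d W. x \<in> W"
    by (rule eventually_generic_mem)
  then have W_Mn: "\<forall>\<^sub>F x in generic n d W. x \<in> W \<and> x \<in> Mn n"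
    by eventually_elim (use L.dset_Mn_subset[OF \<phi>(1)] in blast)
  have "filterlim \<phi> (almost_all d) (generic n d W)"
  proof (rule filterlim_generic[OF dmap_LN[OF \<phi>(2)] \<phi>(3) dmap_LN[OF \<psi>(1)] L.dset_Mn_subset[OF \<phi>(1)]])
    show "\<forall>\<^sub>F x in generic n d W. \<psi> (\<phi> x) = x" "\<forall>\<^sub>F x in generic n d W. \<phi> x \<in> Mn d"
      using W_Mn by (eventually_elim, use \<psi>(3) \<phi>(3) in blast)+
  qed
  from eventually_compose_filterlim[OF F(3) this] W_Mn
  have "\<forall>\<^sub>F x in generic n d W. f x = F (\<phi> x)"
    by eventually_elim (simp add: \<psi>(3))
  moreover have "L.dmap n (\<lambda>x. F (\<phi> x))"
    by (rule L.dmap_comp[OF F(1) \<phi>(2,3)])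
  ultimately show ?thesis
    using F(2) \<phi>(3) by (intro exI[of _ "\<lambda>x. F (\<phi> x)"]) blast
qed

lemma approximation_on_pieces:
  assumes "finite \<W>" "\<And>W. W \<in> \<W> \<Longrightarrow> piece d n W"
    and f: "N.dmap n f" "\<And>x. x \<in> Mn n \<Longrightarrow> f x \<in> Mn m"
  shows "\<exists>F. L.dmap n F \<and> (\<forall>x\<in>Mn n. F x \<in> Mn m) \<and> (\<forall>\<^sub>F x in generic n d (\<Union>\<W>). f x = F x)"
  using assms(1,2)
proof (induction \<W> rule: finite_induct)
  case empty
  have "\<forall>\<^sub>F x in generic n d (\<Union>{}). f x = replicate m undefined"
    by (simp add: eventually_generic small_empty)
  then show ?case
    using L.dmap_const[of n "replicate m undefined"]
    by (intro exI[of _ "\<lambda>_. replicate m undefined"]) simp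
next
  case (insert W \<W>)
  obtain F where F: "L.dmap n F" "\<forall>x\<in>Mn n. F x \<in> Mn m" "\<forall>\<^sub>F x in generic n d (\<Union>\<W>). f x = F x"
    using insert by auto
  obtain H where H: "L.dmap n H" "\<forall>x\<in>Mn n. H x \<in> Mn m" "\<forall>\<^sub>F x in generic n d W. f x = H x"
    using approximation_on_piece[OF _ f, of d W] insert by auto
  define K where "K x = (if x \<in> W then H x else F x)" for x
  have "L.dmap n K"
    unfolding K_def using F(2) H(2) insert.prems
    by (intro L.dmap_if L.dpred_mem[OF piece_dset] L.dmap_id F(1) H(1)) auto
  moreover have "small n d ({x \<in> W. f x \<noteq> H x} \<union> {x \<in> \<Union>\<W>. f x \<noteq> F x})"
    using F(3) H(3) by (intro small_Un) (simp_all add: eventually_generic)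
  then have "\<forall>\<^sub>F x in generic n d (\<Union>(insert W \<W>)). f x = K x"
    unfolding eventually_generic by (rule small_subset) (auto simp: K_def)
  moreover have "\<forall>x\<in>Mn n. K x \<in> Mn m"
    using F(2) H(2) by (simp add: K_def)
  ultimately show ?case
    by blast
qed

lemma approximation:
  assumes V: "L.dset n V" and small: "small n (Suc d) V"
    and f: "N.dmap n f" "\<And>x. x \<in> Mn n \<Longrightarrow> f x \<in> Mn m"
  obtains F where "L.dmap n F" "\<And>x. x \<in> Mn n \<Longrightarrow> F x \<in> Mn m" "\<forall>\<^sub>F x in generic n d V. f x = F x"
proof -
  obtain \<W> where \<W>: "finite \<W>" "\<And>W. W \<in> \<W> \<Longrightarrow> piece d n W \<and> W \<subseteq> V" "small n d (V - \<Union>\<W>)"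
    using piece_decomposition[OF V small] by blast
  have "small n d (\<Union>\<W> - V)"
    using \<W>(2) by (intro small_subset[OF small_empty]) blast
  with \<W>(3) have "generic n d V = generic n d (\<Union>\<W>)"
    by (intro generic_cong)
  then show thesis
    using approximation_on_pieces[OF \<W>(1) _ f, of d] \<W>(2) that by metis
qed

end

section \<open>Definable groups\<close>

context tame_pair
begin

lemma dset_cl:
  assumes Y: "N.dset n Y"
  shows "L.dset n (cl n Y)"
proof -
  define U where "U = Mn n - cl n Y"
  have U: "U = {x \<in> Mn n. \<exists>a\<in>Mn n. \<exists>b\<in>Mn n. x \<in> box n a b \<and> box n a b \<inter> Y = {}}"
    unfolding U_def cl_def Bex_def by auto
  have "box n a b \<inter> Y = {} \<longleftrightarrow> (\<forall>y\<in>Mn n. y \<in> box n a b \<longrightarrow> y \<notin> Y)" for a b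
    using box_subset_Mn[of n a b] by blast
  then have "N.dset n U"
    unfolding U N.dpred_def[symmetric]
    by (simp only:) (intro N.dpred_intros N.dpred_mem[OF Y])
  moreover have "open_n n U"
    unfolding open_n_def
  proof (intro conjI ballI)
    fix x assume "x \<in> U"
    then obtain a b where ab: "a \<in> Mn n" "b \<in> Mn n" "x \<in> box n a b" "box n a b \<inter> Y = {}"
      unfolding U by blast
    then have "box n a b \<subseteq> U"
      unfolding U using box_subset_Mn[of n a b] by blast
    then show "\<exists>a b. length a = n \<and> length b = n \<and> x \<in> box n a b \<and> box n a b \<subseteq> U"
      using ab by auto
  qed (auto simp: U_def)
  ultimately have "L.dset n U"
    using open_DL by (simp add: L.dset_def N.dset_def)
  moreover have "cl n Y = Mn n - U"
    by (auto simp: U_def cl_def)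
  ultimately show ?thesis
    using L.dset_Diff[OF L.dset_Mn] by simp
qed

lemma subset_cl: "Y \<subseteq> Mn n \<Longrightarrow> Y \<subseteq> cl n Y"
  by (auto simp: cl_def)

lemma sq_eq_rel_set:
  assumes "X \<subseteq> Mn n"
  shows "sq X = rel_set n n (\<lambda>x y. x \<in> X \<and> y \<in> X)"
proof (intro equalityI subsetI)
  fix z assume "z \<in> sq X"
  then obtain x y where "x \<in> X" "y \<in> X" "z = x @ y"
    by (auto simp: sq_def)
  moreover from this assms have "x \<in> Mn n" "y \<in> Mn n"
    by blast+
  ultimately show "z \<in> rel_set n n (\<lambda>x y. x \<in> X \<and> y \<in> X)"
    by simp
next
  fix z assume "z \<in> rel_set n n (\<lambda>x y. x \<in> X \<and> y \<in> X)"
  then show "z \<in> sq X"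
    unfolding sq_def by (intro CollectI exI[of _ "take n z"] exI[of _ "drop n z"]) simp
qed

lemma dset_sq:
  assumes "L.dset n X"
  shows "L.dset (n + n) (sq X)"
  unfolding sq_eq_rel_set[OF L.dset_Mn_subset[OF assms]] L.dpred_def[symmetric]
  by (intro L.dpred_intros L.dpred_mem[OF assms])

lemma small_sq:
  assumes X: "L.dset n X" and small: "small n (Suc k) X"
  shows "small (n + n) (Suc (k + k)) (sq X)"
proof -
  have "small (n + n) (k + Suc k) (rel_set n n (\<lambda>x y. x \<in> X \<and> y \<in> X))"
  proof (rule small_if_small_fibres)
    show "N.drel n n (\<lambda>x y. x \<in> X \<and> y \<in> X)"
      by (intro N.dpred_intros N.dpred_mem[OF dset_LN[OF X]])
    have fibre: "small n (Suc k) {y \<in> Mn n. x \<in> X \<and> y \<in> X}" for x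
      by (rule small_subset[OF small]) blast
    then show "small n (Suc (Suc k)) {y \<in> Mn n. x \<in> X \<and> y \<in> X}" for x
      by (rule small_mono) simp
    have "{x \<in> Mn n. \<not> small n (Suc k) {y \<in> Mn n. x \<in> X \<and> y \<in> X}} = {}"
      using fibre by blast
    then show "small n k {x \<in> Mn n. \<not> small n (Suc k) {y \<in> Mn n. x \<in> X \<and> y \<in> X}}"
      by (simp only: small_empty)
  qed (rule small_subset[OF small], blast)
  then show ?thesis
    by (simp add: sq_eq_rel_set[OF L.dset_Mn_subset[OF X]])
qed

lemma approximation_of_subset:
  assumes V: "L.dset n V" "small n (Suc k) V" and Y: "N.dset n Y" "Y \<subseteq> V"
  obtains X where "L.dset n X" "small n k (X - Y)" "small n k (Y - X)"
proof -
  obtain c c' :: 'm where c: "c \<noteq> c'"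
    using gt_ex less_irrefl by metis
  define f where "f x = (if x \<in> Y then [c] else [c'])" for x
  have f: "N.dmap n f"
    unfolding f_def by (intro N.dmap_if N.dpred_mem[OF Y(1)] N.dmap_intros) simp
  have "f x \<in> Mn 1" for x
    by (simp add: f_def)
  then obtain F where F: "L.dmap n F" and eq: "\<forall>\<^sub>F x in generic n k V. f x = F x"
    using approximation[OF V f] by metis
  define X where "X = {x \<in> V. F x = [c]}"
  show thesis
  proof
    show "L.dset n X"
      unfolding X_def by (intro L.dset_Collect V L.dpred_eq F L.dmap_const)
    have "small n k {x \<in> V. f x \<noteq> F x}"
      using eq by (simp add: eventually_generic)
    then show "small n k (X - Y)" "small n k (Y - X)"
      by (rule small_subset, use Y(2) c in \<open>force simp: X_def f_def\<close>)+
  qed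
qed

lemma approximation_on_square:
  assumes V: "L.dset n V" "small n (Suc k) V" and Y: "N.dset n Y" "Y \<subseteq> V"
    and f: "N.dmap (n + n) f" "\<And>z. z \<in> Mn (n + n) \<Longrightarrow> f z \<in> Mn m"
  obtains F where "L.dmap (n + n) F" "\<And>z. z \<in> Mn (n + n) \<Longrightarrow> F z \<in> Mn m"
    "\<forall>\<^sub>F x in generic n k Y. \<forall>\<^sub>F y in generic n k Y. F (x @ y) = f (x @ y)"
proof -
  obtain F where F: "L.dmap (n + n) F" "\<And>z. z \<in> Mn (n + n) \<Longrightarrow> F z \<in> Mn m"
    and eq: "\<forall>\<^sub>F z in generic (n + n) (k + k) (sq V). f z = F z"
    using approximation[OF dset_sq[OF V(1)] small_sq[OF V] f] by metis
  have rel: "N.drel n n (\<lambda>x y. F (x @ y) = f (x @ y))"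
    using N.dpred_eq[OF dmap_LN[OF F(1)] f(1)] by simp
  have small: "small n (Suc k) Y"
    using V(2) Y(2) by (rule small_subset)
  have "small (n + n) (k + k) (rel_set n n (\<lambda>x y. x \<in> Y \<and> y \<in> Y \<and> F (x @ y) \<noteq> f (x @ y)))"
    using eq unfolding eventually_generic sq_eq_rel_set[OF L.dset_Mn_subset[OF V(1)]]
    by (rule small_subset) (use Y(2) in auto)
  then have "\<forall>\<^sub>F x in generic n k Y. \<forall>\<^sub>F y in generic n k Y. F (x @ y) = f (x @ y)"
    using eventually_eventually_generic[OF Y(1) small Y(1) small rel] by blast
  with F that show thesis
    by blast
qed

end

locale tame_group = tame_pair DL DN dimf
  for DL DN :: "('m::{dense_linorder, no_top, no_bot}) list set \<Rightarrow> bool" and dimf +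
  fixes G :: "('m list, 'b) monoid_scheme" and n k :: nat
  assumes definable_group: "definable_group DN n G"
    and dim_G: "dimf (carrier G) = ereal (real k)"
begin

sublocale group G
  using definable_group by (simp add: definable_group_def)

lemma dset_G: "N.dset n (carrier G)"
  using definable_group by (simp add: definable_group_def N.dset_def)

lemma G_length: "x \<in> carrier G \<Longrightarrow> length x = n"
  by (rule N.dset_length[OF dset_G])

lemma small_G: "small n (Suc k) (carrier G)"
  by (simp add: small_iff_dim[OF dset_G] dim_G)

abbreviation generic_G :: "'m list filter" ("\<G>") where
  "\<G> \<equiv> generic n k (carrier G)"

lemma eventually_G_ex: "\<forall>\<^sub>F u in \<G>. P u \<Longrightarrow> \<exists>u\<in>carrier G. P u"
  by (rule generic_ex) (simp_all add: small_iff_dim[OF dset_G] dim_G)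

(* The junk value 1 makes the group operations definable maps on all of M^n. *)
definition gmul :: "'m list \<Rightarrow> 'm list \<Rightarrow> 'm list" (infixl "\<bullet>" 70) where
  "x \<bullet> y = (if x \<in> carrier G \<and> y \<in> carrier G then x \<otimes>\<^bsub>G\<^esub> y else \<one>\<^bsub>G\<^esub>)"

definition ginv :: "'m list \<Rightarrow> 'm list" where
  "ginv x = (if x \<in> carrier G then inv\<^bsub>G\<^esub> x else \<one>\<^bsub>G\<^esub>)"

lemma gmul_closed [simp]: "x \<bullet> y \<in> carrier G"
  and ginv_closed [simp]: "ginv x \<in> carrier G"
  by (auto simp: gmul_def ginv_def)

lemma gmul_length [simp]: "length (x \<bullet> y) = n"
  and ginv_length [simp]: "length (ginv x) = n"
  using G_length by auto

lemma gmul_assoc: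
  "x \<in> carrier G \<Longrightarrow> y \<in> carrier G \<Longrightarrow> z \<in> carrier G \<Longrightarrow> x \<bullet> y \<bullet> z = x \<bullet> (y \<bullet> z)"
  by (simp add: gmul_def m_assoc)

lemma ginv_gmul_cancel [simp]: "x \<in> carrier G \<Longrightarrow> y \<in> carrier G \<Longrightarrow> ginv x \<bullet> (x \<bullet> y) = y"
  and gmul_ginv_cancel [simp]: "x \<in> carrier G \<Longrightarrow> y \<in> carrier G \<Longrightarrow> x \<bullet> (ginv x \<bullet> y) = y"
  by (simp_all add: gmul_def ginv_def m_assoc[symmetric])

lemma gmul_ginv_right_cancel [simp]:
  "x \<in> carrier G \<Longrightarrow> y \<in> carrier G \<Longrightarrow> x \<bullet> y \<bullet> ginv y = x"
  by (simp add: gmul_def ginv_def m_assoc)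

lemma gmul_right_cancel:
  "x \<in> carrier G \<Longrightarrow> y \<in> carrier G \<Longrightarrow> u \<in> carrier G \<Longrightarrow> x \<bullet> u = y \<bullet> u \<longleftrightarrow> x = y"
  by (simp add: gmul_def)

lemma dmap_gmul:
  assumes f: "N.dmap q f" "\<And>x. x \<in> Mn q \<Longrightarrow> f x \<in> Mn n"
    and g: "N.dmap q g" "\<And>x. x \<in> Mn q \<Longrightarrow> g x \<in> Mn n"
  shows "N.dmap q (\<lambda>x. f x \<bullet> g x)"
proof (rule N.dmapI)
  let ?graph = "{x @ y @ (x \<otimes>\<^bsub>G\<^esub> y) | x y. x \<in> carrier G \<and> y \<in> carrier G}"
  have graph: "N.dset (n + (n + n)) ?graph"
    using definable_group G_length by (auto simp: definable_group_def N.dset_def)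
  show "N.drel q n (\<lambda>x w. f x @ g x @ w \<in> ?graph \<or>
      \<not> (f x \<in> carrier G \<and> g x \<in> carrier G) \<and> w = \<one>\<^bsub>G\<^esub>)"
    by (intro N.dpred_disj N.dpred_conj N.dpred_not N.dpred_eq N.dpred_mem[OF graph]
        N.dpred_mem[OF dset_G] N.dmap_comp[OF f(1)] N.dmap_comp[OF g(1)] N.dmap_intros) simp_all
  have graph_iff: "x @ y @ w \<in> ?graph \<longleftrightarrow> x \<in> carrier G \<and> y \<in> carrier G \<and> w = x \<otimes>\<^bsub>G\<^esub> y"
    if "length x = n" "length y = n" for x y w
  proof
    assume "x @ y @ w \<in> ?graph"
    then obtain x' y' where "x' \<in> carrier G" "y' \<in> carrier G" "x @ y @ w = x' @ y' @ (x' \<otimes>\<^bsub>G\<^esub> y')"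
      by blast
    moreover from this have "x = x'" "y = y'"
      using that G_length by simp_all
    ultimately show "x \<in> carrier G \<and> y \<in> carrier G \<and> w = x \<otimes>\<^bsub>G\<^esub> y"
      by simp
  qed blast
  show "f x @ g x @ w \<in> ?graph \<or> \<not> (f x \<in> carrier G \<and> g x \<in> carrier G) \<and> w = \<one>\<^bsub>G\<^esub> \<longleftrightarrow> w = f x \<bullet> g x"
    if "x \<in> Mn q" for x w
    using f(2)[OF that] g(2)[OF that] by (subst graph_iff) (auto simp: gmul_def)
qed simp

lemma dmap_ginv:
  assumes f: "N.dmap q f" "\<And>x. x \<in> Mn q \<Longrightarrow> f x \<in> Mn n"
  shows "N.dmap q (\<lambda>x. ginv (f x))"
proof (rule N.dmapI)
  show "N.drel q n (\<lambda>x w. f x \<in> carrier G \<and> w \<in> carrier G \<and> f x \<bullet> w = \<one>\<^bsub>G\<^esub> \<or>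
      f x \<notin> carrier G \<and> w = \<one>\<^bsub>G\<^esub>)"
    by (intro N.dpred_disj N.dpred_conj N.dpred_not N.dpred_eq N.dpred_mem[OF dset_G] dmap_gmul
        N.dmap_comp[OF f(1)] N.dmap_intros) (use f(2) in simp_all)
  show "f x \<in> carrier G \<and> w \<in> carrier G \<and> f x \<bullet> w = \<one>\<^bsub>G\<^esub> \<or> f x \<notin> carrier G \<and> w = \<one>\<^bsub>G\<^esub> \<longleftrightarrow>
      w = ginv (f x)" for x w
    using inv_equality[of w "f x"] inv_comm[of "f x" w] by (auto simp: ginv_def gmul_def)
qed simp

lemma filterlim_gmul_left:
  assumes "g \<in> carrier G"
  shows "filterlim ((\<bullet>) g) \<G> \<G>"
proof (rule filterlim_generic[OF _ _ _ N.dset_Mn_subset[OF dset_G]])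
  show "N.dmap n ((\<bullet>) g)" "N.dmap n ((\<bullet>) (ginv g))"
    using assms by (intro dmap_gmul N.dmap_intros; simp add: G_length)+
  show "\<forall>\<^sub>F u in \<G>. ginv g \<bullet> (g \<bullet> u) = u"
    using eventually_generic_mem by eventually_elim (simp add: assms)
qed simp_all

lemma filterlim_gmul_right:
  assumes "g \<in> carrier G"
  shows "filterlim (\<lambda>u. u \<bullet> g) \<G> \<G>"
proof (rule filterlim_generic[OF _ _ _ N.dset_Mn_subset[OF dset_G]])
  show "N.dmap n (\<lambda>u. u \<bullet> g)" "N.dmap n (\<lambda>u. u \<bullet> ginv g)"
    using assms by (intro dmap_gmul N.dmap_intros; simp add: G_length)+
  show "\<forall>\<^sub>F u in \<G>. u \<bullet> g \<bullet> ginv g = u"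
    using eventually_generic_mem by eventually_elim (simp add: assms)
qed simp_all

end

section \<open>The group chunk\<close>

locale group_chunk = tame_group DL DN dimf G n k
  for DL DN :: "('m::{dense_linorder, no_top, no_bot}) list set \<Rightarrow> bool" and dimf
    and G :: "('m list, 'b) monoid_scheme" and n k +
  fixes X :: "'m list set" and F Q R :: "'m list \<Rightarrow> 'm list"
  assumes dset_X: "L.dset n X"
    and X_minus_G: "small n k (X - carrier G)" and G_minus_X: "small n k (carrier G - X)"
    and dmap_F: "L.dmap (n + n) F" and F_Mn: "\<And>z. z \<in> Mn (n + n) \<Longrightarrow> F z \<in> Mn n"
    and dmap_Q: "L.dmap (n + n) Q" and Q_Mn: "\<And>z. z \<in> Mn (n + n) \<Longrightarrow> Q z \<in> Mn n"
    and dmap_R: "L.dmap (n + n) R" and R_Mn: "\<And>z. z \<in> Mn (n + n) \<Longrightarrow> R z \<in> Mn n"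
    and F_mul: "\<forall>\<^sub>F x in \<G>. \<forall>\<^sub>F y in \<G>. F (x @ y) = x \<bullet> y"
    and Q_mul: "\<forall>\<^sub>F x in \<G>. \<forall>\<^sub>F y in \<G>. Q (x @ y) = ginv x \<bullet> y"
    and R_mul: "\<forall>\<^sub>F x in \<G>. \<forall>\<^sub>F y in \<G>. R (x @ y) = x \<bullet> ginv y"
begin

lemma generic_X: "generic n k X = \<G>"
  by (rule generic_cong[OF X_minus_G G_minus_X])

lemma map_lengths:
  "length z = n + n \<Longrightarrow> length (F z) = n"
  "length z = n + n \<Longrightarrow> length (Q z) = n"
  "length z = n + n \<Longrightarrow> length (R z) = n"
  using F_Mn Q_Mn R_Mn by simp_all

lemmas L_chunk_intros = L.dpred_conj L.dpred_eq L.dpred_mem[OF dset_X]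
  L_dpred_eventually_generic[OF dset_X] L.dmap_comp[OF dmap_F] L.dmap_comp[OF dmap_Q]
  L.dmap_comp[OF dmap_R] L.dmap_intros

lemmas N_chunk_intros = N.dpred_eq N_dpred_eventually_generic[OF dset_G] dmap_gmul dmap_ginv
  N.dmap_comp[OF dmap_LN[OF dmap_F]] N.dmap_comp[OF dmap_LN[OF dmap_R]] N.dmap_intros

definition translates :: "'m list \<Rightarrow> bool" where
  "translates x \<longleftrightarrow> (\<forall>\<^sub>F y in \<G>. F (x @ y) = x \<bullet> y)"

(* Definable in the o-minimal structure, true of almost all group elements, and strong enough to
   make F (x @ _) a left translation almost everywhere, even for x outside the group. *)
definition regular :: "'m list \<Rightarrow> bool" where
  "regular x \<longleftrightarrow> x \<in> X \<and> (\<forall>\<^sub>F y in \<G>. F (x @ y) \<in> X) \<and>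
    (\<forall>\<^sub>F y in \<G>. Q (x @ F (x @ y)) = y) \<and> (\<forall>\<^sub>F y in \<G>. R (F (x @ y) @ y) = x) \<and>
    (\<forall>\<^sub>F y in \<G>. \<forall>\<^sub>F z in \<G>. F (F (x @ y) @ z) = F (x @ F (y @ z)))"

definition X\<^sub>0 :: "'m list set" where
  "X\<^sub>0 = {x \<in> Mn n. regular x}"

lemma dset_X0: "L.dset n X\<^sub>0"
  unfolding X\<^sub>0_def L.dpred_def[symmetric] regular_def generic_X[symmetric]
  by (intro L_chunk_intros) (simp_all add: map_lengths)

lemma X0_length: "x \<in> X\<^sub>0 \<Longrightarrow> length x = n"
  by (simp add: X\<^sub>0_def)

lemma eventually_mem_X: "\<forall>\<^sub>F u in \<G>. u \<in> X"
  unfolding generic_X[symmetric] by (rule eventually_generic_mem)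

lemma eventually_R_right_inverse: "\<forall>\<^sub>F x in \<G>. \<forall>\<^sub>F y in \<G>. R ((x \<bullet> y) @ y) = x"
proof (rule eventually_generic_swap[OF dset_G small_G dset_G small_G])
  show "N.drel n n (\<lambda>y x. R ((x \<bullet> y) @ y) = x)"
    by (intro N_chunk_intros) simp_all
  have "\<forall>\<^sub>F y in \<G>. \<forall>\<^sub>F x in \<G>. R (x @ y) = x \<bullet> ginv y"
    by (rule eventually_generic_swap[OF dset_G small_G dset_G small_G _ R_mul])
      (intro N_chunk_intros, simp_all)
  then show "\<forall>\<^sub>F y in \<G>. \<forall>\<^sub>F x in \<G>. R ((x \<bullet> y) @ y) = x"
    using eventually_generic_mem
  proof eventually_elim
    case (elim y)
    from eventually_compose_filterlim[OF elim(1) filterlim_gmul_right[OF elim(2)]] eventually_generic_mem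
    show ?case
      by eventually_elim (simp add: elim(2))
  qed
qed

lemma eventually_associative:
  assumes x: "x \<in> carrier G" "translates x"
  shows "\<forall>\<^sub>F y in \<G>. \<forall>\<^sub>F z in \<G>. F (F (x @ y) @ z) = F (x @ F (y @ z))"
proof -
  have translates: "\<forall>\<^sub>F y in \<G>. translates y"
    using F_mul by (simp add: translates_def)
  have F_x: "\<forall>\<^sub>F y in \<G>. F (x @ y) = x \<bullet> y"
    using x(2) by (simp add: translates_def)
  from F_x translates eventually_compose_filterlim[OF translates filterlim_gmul_left[OF x(1)]]
    eventually_generic_mem
  show ?thesis
  proof eventually_elim
    case (elim y)
    have "\<forall>\<^sub>F z in \<G>. F (y @ z) = y \<bullet> z" "\<forall>\<^sub>F z in \<G>. F ((x \<bullet> y) @ z) = x \<bullet> y \<bullet> z"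
      using elim(2,3) by (simp_all add: translates_def)
    with eventually_compose_filterlim[OF F_x filterlim_gmul_left[OF elim(4)]] eventually_generic_mem
    show ?case
      by eventually_elim (simp add: elim(1) gmul_assoc[OF x(1) elim(4)])
  qed
qed

lemma eventually_regular: "\<forall>\<^sub>F x in \<G>. regular x \<and> translates x"
proof -
  have "\<forall>\<^sub>F x in \<G>. translates x"
    using F_mul by (simp add: translates_def)
  with eventually_mem_X Q_mul eventually_R_right_inverse eventually_generic_mem show ?thesis
  proof eventually_elim
    case (elim x)
    have F_x: "\<forall>\<^sub>F y in \<G>. F (x @ y) = x \<bullet> y"
      using elim(5) by (simp add: translates_def)
    note left = filterlim_gmul_left[OF elim(4)]
    from F_x eventually_compose_filterlim[OF eventually_mem_X left]
    have "\<forall>\<^sub>F y in \<G>. F (x @ y) \<in> X"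
      by eventually_elim simp
    moreover from F_x eventually_compose_filterlim[OF elim(2) left] eventually_generic_mem
    have "\<forall>\<^sub>F y in \<G>. Q (x @ F (x @ y)) = y"
      by eventually_elim (simp add: elim(4))
    moreover from F_x elim(3) have "\<forall>\<^sub>F y in \<G>. R (F (x @ y) @ y) = x"
      by eventually_elim simp
    ultimately show ?case
      unfolding regular_def using elim(1,5) eventually_associative[OF elim(4,5)] by simp
  qed
qed

lemma filterlim_F:
  assumes "x \<in> X\<^sub>0"
  shows "filterlim (\<lambda>b. F (x @ b)) \<G> \<G>"
  unfolding generic_X[symmetric]
proof (rule filterlim_generic[OF _ _ _ L.dset_Mn_subset[OF dset_X]])
  show "N.dmap n (\<lambda>b. F (x @ b))" "N.dmap n (\<lambda>b. Q (x @ b))"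
    by (rule dmap_LN, intro L_chunk_intros, simp add: X0_length[OF assms])+
qed (use assms in \<open>simp_all add: generic_X X\<^sub>0_def regular_def map_lengths\<close>)

lemma translation_exists:
  assumes x: "x \<in> X\<^sub>0"
  shows "\<exists>c\<in>carrier G. \<forall>\<^sub>F u in \<G>. F (x @ u) = c \<bullet> u"
proof -
  have translates: "\<forall>\<^sub>F u in \<G>. translates u \<and> u \<in> carrier G"
    using F_mul eventually_generic_mem by (simp add: translates_def eventually_conj)
  have "\<forall>\<^sub>F b in \<G>. \<forall>\<^sub>F c in \<G>. F (F (x @ b) @ c) = F (x @ F (b @ c))"
    using x by (simp add: X\<^sub>0_def regular_def)
  with translates eventually_compose_filterlim[OF translates filterlim_F[OF x]]
  have "\<forall>\<^sub>F b in \<G>. translates b \<and> translates (F (x @ b)) \<and> F (x @ b) \<in> carrier G \<and>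
      (\<forall>\<^sub>F c in \<G>. F (F (x @ b) @ c) = F (x @ F (b @ c)))"
    by eventually_elim simp
  then obtain b where b: "b \<in> carrier G" "F (x @ b) \<in> carrier G"
    and ev: "\<forall>\<^sub>F c in \<G>. F (b @ c) = b \<bullet> c" "\<forall>\<^sub>F c in \<G>. F (F (x @ b) @ c) = F (x @ b) \<bullet> c"
      "\<forall>\<^sub>F c in \<G>. F (F (x @ b) @ c) = F (x @ F (b @ c))"
    unfolding translates_def using eventually_G_ex by blast
  from ev have "\<forall>\<^sub>F c in \<G>. F (x @ (b \<bullet> c)) = F (x @ b) \<bullet> c"
    by eventually_elim simp
  from eventually_compose_filterlim[OF this filterlim_gmul_left[OF ginv_closed[of b]]] eventually_generic_mem
  have "\<forall>\<^sub>F u in \<G>. F (x @ u) = (F (x @ b) \<bullet> ginv b) \<bullet> u"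
    by eventually_elim (simp add: b gmul_assoc)
  then show ?thesis
    using gmul_closed by blast
qed

lemma translation_unique:
  assumes "\<forall>\<^sub>F u in \<G>. F (x @ u) = c \<bullet> u" "\<forall>\<^sub>F u in \<G>. F (x @ u) = c' \<bullet> u"
    and "c \<in> carrier G" "c' \<in> carrier G"
  shows "c = c'"
proof -
  from assms(1,2) have "\<forall>\<^sub>F u in \<G>. c \<bullet> u = c' \<bullet> u"
    by eventually_elim simp
  then show ?thesis
    using eventually_G_ex gmul_right_cancel[OF assms(3,4)] by blast
qed

definition h :: "'m list \<Rightarrow> 'm list" where
  "h x = (if x \<in> X\<^sub>0 then THE c. c \<in> carrier G \<and> (\<forall>\<^sub>F u in \<G>. F (x @ u) = c \<bullet> u) else \<one>\<^bsub>G\<^esub>)"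

lemma h_eq_iff:
  assumes "x \<in> X\<^sub>0"
  shows "h x = c \<longleftrightarrow> c \<in> carrier G \<and> (\<forall>\<^sub>F u in \<G>. F (x @ u) = c \<bullet> u)"
proof -
  obtain c\<^sub>0 where "c\<^sub>0 \<in> carrier G" "\<forall>\<^sub>F u in \<G>. F (x @ u) = c\<^sub>0 \<bullet> u"
    using translation_exists[OF assms] by blast
  moreover from this have "h x = c\<^sub>0"
    using assms unfolding h_def by (auto intro: translation_unique)
  ultimately show ?thesis
    using translation_unique by blast
qed

lemma h_closed: "h x \<in> carrier G"
  using h_eq_iff[of x "h x"] by (cases "x \<in> X\<^sub>0") (simp_all add: h_def)

lemma h_length: "length (h x) = n"
  using h_closed G_length by blast

lemma eventually_F_eq_h: "x \<in> X\<^sub>0 \<Longrightarrow> \<forall>\<^sub>F u in \<G>. F (x @ u) = h x \<bullet> u"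
  using h_eq_iff by blast

lemma dmap_h: "N.dmap n h"
proof (rule N.dmapI)
  show "N.drel n n (\<lambda>x c. x \<in> X\<^sub>0 \<and> c \<in> carrier G \<and> (\<forall>\<^sub>F u in \<G>. F (x @ u) = c \<bullet> u) \<or>
      x \<notin> X\<^sub>0 \<and> c = \<one>\<^bsub>G\<^esub>)"
    by (intro N.dpred_disj N.dpred_conj N.dpred_not N.dpred_mem[OF dset_LN[OF dset_X0]]
        N.dpred_mem[OF dset_G] N_chunk_intros) simp_all
  show "x \<in> X\<^sub>0 \<and> c \<in> carrier G \<and> (\<forall>\<^sub>F u in \<G>. F (x @ u) = c \<bullet> u) \<or> x \<notin> X\<^sub>0 \<and> c = \<one>\<^bsub>G\<^esub> \<longleftrightarrow> c = h x"
    for x c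
    using h_eq_iff[of x c] by (auto simp: h_def)
qed (simp add: h_length)

lemma h_inj: "inj_on h X\<^sub>0"
proof (rule inj_onI)
  fix x y assume xy: "x \<in> X\<^sub>0" "y \<in> X\<^sub>0" "h x = h y"
  have "\<forall>\<^sub>F u in \<G>. R (F (x @ u) @ u) = x" "\<forall>\<^sub>F u in \<G>. R (F (y @ u) @ u) = y"
    using xy by (simp_all add: X\<^sub>0_def regular_def)
  with eventually_F_eq_h[OF xy(1)] eventually_F_eq_h[OF xy(2)] have "\<forall>\<^sub>F u in \<G>. x = y"
    by eventually_elim (simp add: xy(3))
  then show "x = y"
    using eventually_G_ex by blast
qed

lemma eventually_mem_h_image: "\<forall>\<^sub>F x in \<G>. x \<in> h ` X\<^sub>0"
  using eventually_regular eventually_generic_mem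
proof eventually_elim
  case (elim x)
  then have "x \<in> X\<^sub>0"
    using G_length by (simp add: X\<^sub>0_def)
  moreover from this have "h x = x"
    using elim by (simp add: h_eq_iff translates_def)
  ultimately show ?case
    by force
qed

lemma h_image_large: "dimf (carrier G - h ` X\<^sub>0) < ereal (real k)"
proof -
  have "N.dset n (carrier G - h ` X\<^sub>0)"
    by (intro N.dset_Diff dset_G N.dset_image[OF dset_LN[OF dset_X0] dmap_h]) (simp add: h_length)
  moreover have "small n k (carrier G - h ` X\<^sub>0)"
    using eventually_mem_h_image by (simp only: eventually_generic set_diff_eq)
  ultimately show ?thesis
    by (simp add: small_iff_dim)
qed

definition Z :: "'m list set" where
  "Z = rel_set n n (\<lambda>x y. x \<in> X\<^sub>0 \<and> y \<in> X\<^sub>0 \<and> F (x @ y) \<in> X\<^sub>0 \<and>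
    (\<forall>\<^sub>F w in \<G>. F (F (x @ y) @ w) = F (x @ F (y @ w))))"

lemma dset_Z: "L.dset (n + n) Z"
  unfolding Z_def L.dpred_def[symmetric] generic_X[symmetric]
  by (intro L_chunk_intros L.dpred_mem[OF dset_X0]) (simp_all add: map_lengths)

lemma Z_subset: "Z \<subseteq> sq X\<^sub>0"
  unfolding sq_eq_rel_set[OF L.dset_Mn_subset[OF dset_X0]] Z_def by blast

lemma generic_X0: "generic n k X\<^sub>0 = \<G>"
proof -
  have "\<forall>\<^sub>F x in \<G>. x \<in> X\<^sub>0"
    using eventually_regular eventually_generic_mem
    by eventually_elim (simp add: X\<^sub>0_def G_length)
  then have "small n k (X - X\<^sub>0)"
    unfolding generic_X[symmetric] by (simp only: eventually_generic set_diff_eq)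
  moreover have "small n k (X\<^sub>0 - X)"
    by (rule small_subset[OF small_empty]) (auto simp: X\<^sub>0_def regular_def)
  ultimately show ?thesis
    unfolding generic_X[symmetric] by (intro generic_cong)
qed

lemma small_X0: "small n (Suc k) X\<^sub>0"
  by (rule small_subset[OF small_Un[OF small_mono[OF X_minus_G] small_G]])
    (auto simp: X\<^sub>0_def regular_def)

lemma eventually_mem_Z: "\<forall>\<^sub>F x in \<G>. \<forall>\<^sub>F y in \<G>. x @ y \<in> Z"
proof -
  have regular: "\<forall>\<^sub>F y in \<G>. y \<in> X\<^sub>0"
    unfolding generic_X0[symmetric] by (rule eventually_generic_mem)
  from eventually_regular regular eventually_generic_mem show ?thesis
  proof eventually_elim
    case (elim x)
    have "\<forall>\<^sub>F y in \<G>. F (x @ y) = x \<bullet> y"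
      "\<forall>\<^sub>F y in \<G>. \<forall>\<^sub>F w in \<G>. F (F (x @ y) @ w) = F (x @ F (y @ w))"
      using elim(1) by (simp_all add: translates_def regular_def)
    with regular eventually_compose_filterlim[OF regular filterlim_gmul_left[OF elim(3)]] show ?case
      by eventually_elim (use elim(2) X0_length in \<open>simp add: Z_def\<close>)
  qed
qed

lemma Z_large: "dimf (sq X\<^sub>0 - Z) < ereal (real (2 * k))"
proof -
  have rel: "N.drel n n (\<lambda>x y. x @ y \<in> Z)"
    by (intro N.dpred_mem[OF dset_LN[OF dset_Z]] N.dmap_intros)
  have "small (n + n) (k + k) (rel_set n n (\<lambda>x y. x \<in> X\<^sub>0 \<and> y \<in> X\<^sub>0 \<and> x @ y \<notin> Z))"
    using eventually_eventually_generic[OF dset_LN[OF dset_X0] small_X0 dset_LN[OF dset_X0] small_X0 rel]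
      eventually_mem_Z unfolding generic_X0 by blast
  then have "small (n + n) (k + k) (sq X\<^sub>0 - Z)"
    unfolding sq_eq_rel_set[OF L.dset_Mn_subset[OF dset_X0]] by (rule small_subset) auto
  then show ?thesis
    unfolding mult_2 by (simp only: small_iff_dim[OF dset_LN[OF L.dset_Diff[OF dset_sq[OF dset_X0] dset_Z]]])
qed

lemma h_hom:
  assumes xy: "x \<in> X\<^sub>0" "y \<in> X\<^sub>0" "x @ y \<in> Z"
  shows "h x \<bullet> h y = h (F (x @ y))"
proof -
  have F_xy: "F (x @ y) \<in> X\<^sub>0" "\<forall>\<^sub>F w in \<G>. F (F (x @ y) @ w) = F (x @ F (y @ w))"
    using xy X0_length by (simp_all add: Z_def)
  from F_xy(2) eventually_F_eq_h[OF F_xy(1)] eventually_F_eq_h[OF xy(2)]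
    eventually_compose_filterlim[OF eventually_F_eq_h[OF xy(1)] filterlim_gmul_left[OF h_closed[of y]]]
    eventually_generic_mem
  have "\<forall>\<^sub>F w in \<G>. h x \<bullet> h y \<bullet> w = h (F (x @ y)) \<bullet> w"
    by eventually_elim (simp add: gmul_assoc h_closed)
  then show ?thesis
    using eventually_G_ex gmul_right_cancel[OF gmul_closed h_closed] by blast
qed

lemma total_multiplication:
  obtains F' where "L.dmap (n + n) F'" "\<And>z. F' z \<in> X\<^sub>0" "\<And>z. F z \<in> X\<^sub>0 \<Longrightarrow> F' z = F z"
proof -
  obtain x\<^sub>0 where x0: "x\<^sub>0 \<in> X\<^sub>0"
    using eventually_G_ex[OF eventually_mem_h_image] by blast
  define F' where "F' z = (if F z \<in> X\<^sub>0 then F z else x\<^sub>0)" for z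
  have "L.dmap (n + n) F'"
    unfolding F'_def using X0_length[OF x0] map_lengths(1)
    by (intro L.dmap_if L.dpred_mem[OF dset_X0] dmap_F L.dmap_const) simp
  with x0 that show thesis
    by (simp add: F'_def)
qed

end

context tame_group
begin

lemma small_cl_G:
  assumes "strongly_large dimf n (carrier G)"
  shows "small n (Suc k) (cl n (carrier G))"
proof -
  have "dimf (cl n (carrier G)) = ereal (real k)"
    using assms dim_G by (simp add: strongly_large_def)
  then show ?thesis
    by (simp add: small_iff_dim[OF dset_LN[OF dset_cl[OF dset_G]]])
qed

lemma binary_approximation:
  assumes large: "strongly_large dimf n (carrier G)"
    and f: "N.dmap (n + n) (\<lambda>z. f (take n z) (drop n z))" "\<And>x y. f x y \<in> carrier G"
  shows "\<exists>F. L.dmap (n + n) F \<and> (\<forall>z\<in>Mn (n + n). F z \<in> Mn n) \<and>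
    (\<forall>\<^sub>F x in \<G>. \<forall>\<^sub>F y in \<G>. F (x @ y) = f x y)"
proof -
  obtain F where F: "L.dmap (n + n) F" "\<And>z. z \<in> Mn (n + n) \<Longrightarrow> F z \<in> Mn n"
    and eq: "\<forall>\<^sub>F x in \<G>. \<forall>\<^sub>F y in \<G>. F (x @ y) = f (take n (x @ y)) (drop n (x @ y))"
    using approximation_on_square[OF dset_cl[OF dset_G] small_cl_G[OF large] dset_G
        subset_cl[OF N.dset_Mn_subset[OF dset_G]] f(1), of n] f(2) G_length by auto
  from eq eventually_generic_mem have "\<forall>\<^sub>F x in \<G>. \<forall>\<^sub>F y in \<G>. F (x @ y) = f x y"
    by eventually_elim (simp add: G_length)
  with F show ?thesis
    by blast
qed

lemma group_chunk_exists:
  assumes large: "strongly_large dimf n (carrier G)"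
  obtains X F Q R where "group_chunk DL DN dimf G n k X F Q R"
proof -
  have maps: "N.dmap (n + n) (\<lambda>z. take n z \<bullet> drop n z)"
    "N.dmap (n + n) (\<lambda>z. ginv (take n z) \<bullet> drop n z)"
    "N.dmap (n + n) (\<lambda>z. take n z \<bullet> ginv (drop n z))"
    by (intro dmap_gmul dmap_ginv N.dmap_intros; simp)+
  obtain X where "L.dset n X" "small n k (X - carrier G)" "small n k (carrier G - X)"
    using approximation_of_subset[OF dset_cl[OF dset_G] small_cl_G[OF large] dset_G
        subset_cl[OF N.dset_Mn_subset[OF dset_G]]] by blast
  moreover obtain F where "L.dmap (n + n) F" "\<forall>z\<in>Mn (n + n). F z \<in> Mn n"
    "\<forall>\<^sub>F x in \<G>. \<forall>\<^sub>F y in \<G>. F (x @ y) = x \<bullet> y"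
    using binary_approximation[OF large, of "(\<bullet>)", OF maps(1) gmul_closed] by blast
  moreover obtain Q where "L.dmap (n + n) Q" "\<forall>z\<in>Mn (n + n). Q z \<in> Mn n"
    "\<forall>\<^sub>F x in \<G>. \<forall>\<^sub>F y in \<G>. Q (x @ y) = ginv x \<bullet> y"
    using binary_approximation[OF large, of "\<lambda>x y. ginv x \<bullet> y", OF maps(2) gmul_closed] by blast
  moreover obtain R where "L.dmap (n + n) R" "\<forall>z\<in>Mn (n + n). R z \<in> Mn n"
    "\<forall>\<^sub>F x in \<G>. \<forall>\<^sub>F y in \<G>. R (x @ y) = x \<bullet> ginv y"
    using binary_approximation[OF large, of "\<lambda>x y. x \<bullet> ginv y", OF maps(3) gmul_closed] by blast
  ultimately have "group_chunk DL DN dimf G n k X F Q R"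
    by unfold_locales blast+
  then show thesis
    by (rule that)
qed

end

theorem theorem5p1:
  fixes DL DN :: "('m::{dense_linorder, no_top, no_bot}) list set \<Rightarrow> bool"
    and dimf :: "'m list set \<Rightarrow> ereal"
    and G :: "('m list, 'b) monoid_scheme"
    and n k :: nat
  assumes "o_minimal DL"
    and "expansion DL DN"
    and "\<forall>p U. DN U \<and> open_n p U \<longrightarrow> DL U"
    and "dimension_function DL DN dimf"
    and "definable_group DN n G"
    and "strongly_large dimf n (carrier G)"
    and "dimf (carrier G) = ereal (real k)"
  shows "\<exists>m X Z h F.
           DL X \<and> X \<subseteq> Mn m \<and> DL Z \<and> Z \<subseteq> sq X \<and>
           dimf (sq X - Z) < ereal (real (2 * k)) \<and>
           DN {x @ h x | x. x \<in> X} \<and> inj_on h X \<and> h ` X \<subseteq> carrier G \<and>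
           dimf (carrier G - h ` X) < ereal (real k) \<and>
           DL {z @ F z | z. z \<in> sq X} \<and> F ` sq X \<subseteq> X \<and>
           (\<forall>x\<in>X. \<forall>y\<in>X. x @ y \<in> Z \<longrightarrow> h x \<otimes>\<^bsub>G\<^esub> h y = h (F (x @ y)))"
proof -
  interpret tame_group DL DN dimf G n k
    by unfold_locales (use assms in \<open>auto simp: expansion_def\<close>)
  obtain X F Q R where "group_chunk DL DN dimf G n k X F Q R"
    using group_chunk_exists[OF assms(6)] by blast
  then interpret group_chunk DL DN dimf G n k X F Q R .
  obtain F' where F': "L.dmap (n + n) F'" "\<And>z. F' z \<in> X\<^sub>0" "\<And>z. F z \<in> X\<^sub>0 \<Longrightarrow> F' z = F z"
    using total_multiplication by blast
  have "DL {z @ F' z | z. z \<in> sq X\<^sub>0}"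
    using L.dset_graph[OF dset_sq[OF dset_X0] F'(1), of n] F'(2) X0_length by (simp add: L.dset_def)
  moreover have "DN {x @ h x | x. x \<in> X\<^sub>0}"
    using N.dset_graph[OF dset_LN[OF dset_X0] dmap_h, of n] h_length by (simp add: N.dset_def)
  moreover have "h x \<otimes>\<^bsub>G\<^esub> h y = h (F' (x @ y))" if "x \<in> X\<^sub>0" "y \<in> X\<^sub>0" "x @ y \<in> Z" for x y
    using h_hom[OF that] that X0_length F'(3)[of "x @ y"] h_closed by (simp add: gmul_def Z_def)
  ultimately show ?thesis
    using dset_X0 dset_Z Z_subset Z_large h_inj h_closed h_image_large F'(2)
    by (intro exI[of _ n] exI[of _ X\<^sub>0] exI[of _ Z] exI[of _ h] exI[of _ F']) (auto simp: L.dset_def)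
qed

end
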